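(* There is a universal constant $C>0$ and a deterministic polynomial-time algorithm which, given any matrix $A\in\mathbb{R}^{n\times n}$ each of whose columns has Euclidean norm at most $1$, outputs $x\in\{\pm 1\}^n$ such that \[ \|Ax\|_\infty \le C\left(1+\sqrt{\lambda(A)\log n}\right). \]
   Context: For $A\in\mathbb{R}^{m\times n}$, let $B\in\mathbb{R}^{m\times n}$ be the entrywise square, $B_{ij}=A_{ij}^2$, and define $\lambda(A):=\sup\{\|Bu\|_2 : u\in\mathbb{R}^n,\ \|u\|_2=1,\ \langle u,\mathbf{1}\rangle=0\}$, where $\mathbf{1}=(1,\dots,1)$. $\log$ is the natural logarithm. *)

theory Defs
  imports
    Complex_Main
    "HOL-Library.Log_Nat"
    "HOL-Computational_Algebra.Polynomial"
    "HOL-Analysis.L2_Norm"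
    "Jordan_Normal_Form.Matrix"
begin

section \<open>Norms and the parameter \<open>\<lambda>(A)\<close>\<close>

definition l2_norm :: "real vec \<Rightarrow> real" where
  "l2_norm v = L2_set (\<lambda>i. v $ i) {..<dim_vec v}"

text \<open>Only meant for vectors of positive dimension.\<close>

definition linf_norm :: "real vec \<Rightarrow> real" where
  "linf_norm v = Max ((\<lambda>i. \<bar>v $ i\<bar>) ` {..<dim_vec v})"

definition entrywise_square :: "real mat \<Rightarrow> real mat" where
  "entrywise_square A = map_mat (\<lambda>a. a\<^sup>2) A"

text \<open>
  If \<open>A\<close> has at least two columns, the set below is nonempty and bounded. With a single column
  it is empty and the supremum is an unspecified real; where \<open>lambda A\<close> is used for an
  \<open>n \<times> n\<close> matrix it is multiplied by \<open>ln n\<close>, which vanishes for \<open>n = 1\<close>.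
\<close>

definition lambda :: "real mat \<Rightarrow> real" where
  "lambda A = Sup {l2_norm (entrywise_square A *\<^sub>v u) | u.
     u \<in> carrier_vec (dim_col A) \<and> l2_norm u = 1 \<and> u \<bullet> vec (dim_col A) (\<lambda>_. 1) = 0}"


section \<open>Deterministic real random access machines\<close>

text \<open>
  Algorithms on real matrices are programs of a real RAM, presented as a structured imperative
  language. A state has natural number registers, used as counters and addresses, and
  two-dimensional arrays of real numbers. The only exact real operations are the four field
  operations (division by zero yields zero), comparison, and the embedding of natural number
  registers. There is no rounding, no root extraction, and the only constants a program
  may contain are natural numbers, so no information can be hidden in a real constant.
  Natural numbers have no unit-cost multiplication.
\<close>

record ram_state =
  nreg :: "nat \<Rightarrow> nat"
  rarr :: "nat \<Rightarrow> nat \<Rightarrow> nat \<Rightarrow> real"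

datatype nexp =
    NConst nat
  | NReg nat
  | NAdd nexp nexp
  | NSub nexp nexp

datatype rexp =
    OfNat nexp
  | Entry nat nexp nexp
  | Add rexp rexp
  | Sub rexp rexp
  | Mul rexp rexp
  | Div rexp rexp

datatype bexp =
    BLess rexp rexp
  | BNot bexp
  | BAnd bexp bexp

datatype prog =
    Skip
  | NAssign nat nexp
  | RAssign nat nexp nexp rexp
  | Seq prog prog
  | Cond bexp prog prog
  | While bexp prog

fun nval :: "nexp \<Rightarrow> ram_state \<Rightarrow> nat" where
  "nval (NConst k) s = k"
| "nval (NReg r) s = nreg s r"
| "nval (NAdd d e) s = nval d s + nval e s"
| "nval (NSub d e) s = nval d s - nval e s"

fun rval :: "rexp \<Rightarrow> ram_state \<Rightarrow> real" where
  "rval (OfNat e) s = real (nval e s)"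
| "rval (Entry a i j) s = rarr s a (nval i s) (nval j s)"
| "rval (Add d e) s = rval d s + rval e s"
| "rval (Sub d e) s = rval d s - rval e s"
| "rval (Mul d e) s = rval d s * rval e s"
| "rval (Div d e) s = rval d s / rval e s"

fun bval :: "bexp \<Rightarrow> ram_state \<Rightarrow> bool" where
  "bval (BLess d e) s \<longleftrightarrow> rval d s < rval e s"
| "bval (BNot b) s \<longleftrightarrow> \<not> bval b s"
| "bval (BAnd b c) s \<longleftrightarrow> bval b s \<and> bval c s"

text \<open>
  Costs are relative to a charge \<open>w\<close> for handling a number: each evaluation of a subexpression
  (array indices included) is charged according to the number it produces.
\<close>

fun ncost :: "(real \<Rightarrow> nat) \<Rightarrow> nexp \<Rightarrow> ram_state \<Rightarrow> nat" where
  "ncost w (NConst k) s = w (real (nval (NConst k) s))"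
| "ncost w (NReg r) s = w (real (nval (NReg r) s))"
| "ncost w (NAdd d e) s = ncost w d s + ncost w e s + w (real (nval (NAdd d e) s))"
| "ncost w (NSub d e) s = ncost w d s + ncost w e s + w (real (nval (NSub d e) s))"

fun rcost :: "(real \<Rightarrow> nat) \<Rightarrow> rexp \<Rightarrow> ram_state \<Rightarrow> nat" where
  "rcost w (OfNat e) s = ncost w e s + w (rval (OfNat e) s)"
| "rcost w (Entry a i j) s = ncost w i s + ncost w j s + w (rval (Entry a i j) s)"
| "rcost w (Add d e) s = rcost w d s + rcost w e s + w (rval (Add d e) s)"
| "rcost w (Sub d e) s = rcost w d s + rcost w e s + w (rval (Sub d e) s)"
| "rcost w (Mul d e) s = rcost w d s + rcost w e s + w (rval (Mul d e) s)"
| "rcost w (Div d e) s = rcost w d s + rcost w e s + w (rval (Div d e) s)"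

fun bcost :: "(real \<Rightarrow> nat) \<Rightarrow> bexp \<Rightarrow> ram_state \<Rightarrow> nat" where
  "bcost w (BLess d e) s = rcost w d s + rcost w e s + 1"
| "bcost w (BNot b) s = bcost w b s + 1"
| "bcost w (BAnd b c) s = bcost w b s + bcost w c s + 1"

text \<open>\<open>exec w p s t s'\<close>: started in \<open>s\<close>, the program \<open>p\<close> halts in \<open>s'\<close>, at total cost \<open>t\<close>.\<close>

inductive exec ::
  "(real \<Rightarrow> nat) \<Rightarrow> prog \<Rightarrow> ram_state \<Rightarrow> nat \<Rightarrow> ram_state \<Rightarrow> bool" for w where
  Skip: "exec w Skip s 1 s"
| NAssign: "exec w (NAssign r e) s (ncost w e s + 1) (s\<lparr>nreg := (nreg s)(r := nval e s)\<rparr>)"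
| RAssign: "exec w (RAssign a i j e) s (ncost w i s + ncost w j s + rcost w e s + 1)
     (s\<lparr>rarr := (rarr s)(a := (rarr s a)(nval i s :=
        (rarr s a (nval i s))(nval j s := rval e s)))\<rparr>)"
| Seq: "exec w p s t s' \<Longrightarrow> exec w q s' t' s'' \<Longrightarrow> exec w (Seq p q) s (t + t') s''"
| CondTrue: "bval b s \<Longrightarrow> exec w p s t s' \<Longrightarrow> exec w (Cond b p q) s (bcost w b s + t) s'"
| CondFalse: "\<not> bval b s \<Longrightarrow> exec w q s t s' \<Longrightarrow> exec w (Cond b p q) s (bcost w b s + t) s'"
| WhileFalse: "\<not> bval b s \<Longrightarrow> exec w (While b p) s (bcost w b s) s"
| WhileTrue: "bval b s \<Longrightarrow> exec w p s t s' \<Longrightarrow> exec w (While b p) s' t' s'' \<Longrightarrow>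
     exec w (While b p) s (bcost w b s + t + t') s''"

text \<open>Programs are deterministic, and the charge does not influence the computation.\<close>

lemma exec_deterministic:
  assumes "exec w p s t s'" "exec v p s u s''"
  shows "s' = s''" and "w = v \<Longrightarrow> t = u"
proof -
  have "s' = s'' \<and> (w = v \<longrightarrow> t = u)"
    using assms
  proof (induction arbitrary: u s'' rule: exec.induct)
    case (Seq p s t s' q t' s'')
    from Seq.prems show ?case by cases (use Seq.IH in blast)
  next
    case (WhileTrue b s p t s' t' s'')
    from WhileTrue.prems show ?case by cases (use WhileTrue in blast)+
  qed (erule exec.cases; force)+
  then show "s' = s''" and "w = v \<Longrightarrow> t = u" by auto
qed

lemma exec_charge_irrelevant:
  assumes "exec w p s t s'" shows "\<exists>u. exec v p s u s'"
  using assms by induction (blast intro: exec.intros)+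


section \<open>Polynomial time\<close>

definition uniform_charge :: "real \<Rightarrow> nat" where
  "uniform_charge x = 1"

text \<open>
  The binary length of a rational number written in lowest terms (at least 1); the value at
  irrational arguments is irrelevant. Natural numbers are charged as rationals.
\<close>

definition bit_length :: "real \<Rightarrow> nat" where
  "bit_length x = (case quotient_of (the_inv (of_rat :: rat \<Rightarrow> real) x) of
     (p, q) \<Rightarrow> nat (bitlen \<bar>p\<bar> + bitlen q))"

definition input_length :: "real mat \<Rightarrow> nat" where
  "input_length A = (\<Sum>i<dim_row A. \<Sum>j<dim_col A. bit_length (A $$ (i, j)))"

text \<open>A square matrix is given in array 0 and its dimension in register 0; all other memory is 0.\<close>

definition input_state :: "real mat \<Rightarrow> ram_state" where
  "input_state A = \<lparr>
     nreg = (\<lambda>r. if r = 0 then dim_row A else 0),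
     rarr = (\<lambda>a i j. if a = 0 \<and> i < dim_row A \<and> j < dim_col A then A $$ (i, j) else 0)\<rparr>"

text \<open>The output is read off column 0 of array 1.\<close>

definition outputs :: "prog \<Rightarrow> real mat \<Rightarrow> real vec \<Rightarrow> bool" where
  "outputs p A x \<longleftrightarrow> (\<exists>t s. exec uniform_charge p (input_state A) t s \<and>
     x = vec (dim_col A) (\<lambda>i. rarr s 1 i 0))"

text \<open>
  Polynomial time, on a class of admissible inputs, both in the real RAM sense and in the
  bit model: on \<open>n \<times> n\<close> real matrices the program performs polynomially many (in \<open>n\<close>)
  exact real operations, and on rational matrices its logarithmic cost is polynomial in the
  binary length of the input. The second condition rules out the abuse of unit-cost
  arithmetic on exponentially long numbers.
\<close>

definition polynomial_time :: "(real mat \<Rightarrow> bool) \<Rightarrow> prog \<Rightarrow> bool" where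
  "polynomial_time adm p \<longleftrightarrow>
     (\<exists>f :: nat poly. \<forall>A. adm A \<longrightarrow>
        (\<exists>t s. exec uniform_charge p (input_state A) t s \<and> t \<le> poly f (dim_row A))) \<and>
     (\<exists>g :: nat poly. \<forall>A. adm A \<and> elements_mat A \<subseteq> \<rat> \<longrightarrow>
        (\<exists>t s. exec bit_length p (input_state A) t s \<and> t \<le> poly g (input_length A)))"

definition admissible :: "real mat \<Rightarrow> bool" where
  "admissible A \<longleftrightarrow> 1 \<le> dim_row A \<and> square_mat A \<and>
     (\<forall>j<dim_col A. l2_norm (col A j) \<le> 1)"

end

theory Submission
  imports Defs "HOL-Analysis.Convex"
begin

text \<open>A point \<open>x\<close> of the cube moves from the origin towards a vertex by small steps. A coordinate is
  alive until it comes within \<open>1/n\<close> of \<open>\<plusminus>1\<close>, and only alive coordinates move; the final rounding costs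
  \<open>O(1)\<close> per row. A phase lasts while the number of alive coordinates stays above \<open>\<kappa> / 2\<close>, with
  \<open>\<kappa> = 2 n / 2 ^ p\<close>. At the start of a phase, the definition of \<open>\<lambda>(A)\<close> applied to the centred indicator of the alive set
  shows that, with at most \<open>\<kappa> / 40\<close> exceptions, the squared entries of a row on the alive set either have
  their proportional share of the squared norm of the row or sum up to \<open>O(\<lambda>(A))\<close>. The exceptions are blocked: the steps
  are nearly orthogonal to them. Every other row \<open>i\<close> carries a weight that dominates the exponential of
  \<open>\<alpha>\<^sub>i\<close> times its discrepancy, minus an energy term. In the first case the rates are \<open>\<alpha>\<^sub>i = (3/2) ^ l\<close> with \<open>l\<close>
  increasing from phase to phase, so the gains of the row form a geometric series; in the second case
  \<open>\<alpha>\<^sub>i\<close> is about \<open>sqrt (ln n / \<lambda>(A))\<close>, and the gain is \<open>O(sqrt (\<lambda>(A) ln n))\<close>.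

  A dimension count together with a trace bound in the kernel of the blocked rows provides a direction
  in which the sum of the weights grows by less than \<open>\<bar>x\<bar>\<^sup>2\<close>. It is the top of the spectrum of a
  rational matrix, so the power method finds a sufficient approximation of it, which is then rounded.
  Neither \<open>\<lambda>(A)\<close> nor \<open>ln n\<close> has to be computed: the algorithm tries all integers
  \<open>Lg \<le> n\<close> and powers of two \<open>T < 2 ^ n\<close> and keeps the best of the resulting sign vectors.\<close>

subsection \<open>Directions in the kernel of few linear forms\<close>

text \<open>The machine has neither roots nor exponentials and is charged for bit length, and this
  shapes the argument. Weights are products of rational factors
  \<open>1 + u + 3 * u\<^sup>2 - c\<close> instead of exponentials. The step is an approximate
  eigenvector rounded to the grid of width \<open>1 / (16000 * n ^ 7)\<close>, so no division by a
  computed entry occurs. A rounded vector is no longer exactly orthogonal to the blocked rows; hence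
  their drift \<open>d\<close> is penalised by \<open>V * d\<^sup>2\<close> in the potential, and
  the exact kernel appears only in the proof that a good direction exists. The energy term makes the
  trace bound possible: its diagonal \<open>32 * w * s\<^sup>2\<close> exceeds the diagonal
  \<open>3 * w * g\<^sup>2 \<le> 12 * w * s\<^sup>2\<close> of the rank one terms by a constant
  factor, whatever the weights are. A new phase halves the weights of rows at the final rate, which
  keeps the potential \<open>O(n)\<close>; the loss of \<open>ln 2\<close> per phase adds up to at
  most \<open>ln (2 n)\<close>, the same order as what the logarithm of a weight may reach
  anyway.\<close>

lemma null_vector:
  fixes c :: "'e \<Rightarrow> 'b \<Rightarrow> real"
  assumes "finite E" "finite S" "card E < card S"
  shows "\<exists>v. (\<exists>j\<in>S. v j \<noteq> 0) \<and> (\<forall>j. j \<notin> S \<longrightarrow> v j = 0) \<and> (\<forall>e\<in>E. (\<Sum>j\<in>S. c e j * v j) = 0)"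
  using assms
proof (induction E arbitrary: S c rule: finite_induct)
  case empty
  then obtain j where "j \<in> S" by (metis card_gt_0_iff card.empty ex_in_conv)
  then show ?case by (intro exI[of _ "\<lambda>i. if i \<in> S then 1 else 0"]) auto
next
  case (insert e E)
  show ?case
  proof (cases "\<forall>j\<in>S. c e j = 0")
    case True
    have "card E < card S" using insert by auto
    from insert.IH[OF insert.prems(1) this] obtain v where
      "\<exists>j\<in>S. v j \<noteq> 0" "\<forall>j. j \<notin> S \<longrightarrow> v j = 0" "\<forall>e\<in>E. (\<Sum>j\<in>S. c e j * v j) = 0" by blast
    with True show ?thesis by (intro exI[of _ v]) auto
  next
    case False
    then obtain h where h: "h \<in> S" "c e h \<noteq> 0" by auto
    define S' where "S' = S - {h}"
    have fin: "finite S'" "h \<notin> S'" and S: "S = insert h S'" using insert.prems h by (auto simp: S'_def)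
    have cd: "card E < card S'" using insert S fin by auto
    \<comment> \<open>Gaussian elimination of the unknown \<open>h\<close>: the other forms are
      reduced modulo the form of \<open>e\<close>, and \<open>z\<close> below solves the equation of
      \<open>e\<close> for the eliminated unknown.\<close>
    from insert.IH[OF fin(1) cd, of "\<lambda>e' j. c e' j - c e' h * c e j / c e h"] obtain v where
      v: "\<exists>j\<in>S'. v j \<noteq> 0" "\<forall>j. j \<notin> S' \<longrightarrow> v j = 0"
        "\<forall>e'\<in>E. (\<Sum>j\<in>S'. (c e' j - c e' h * c e j / c e h) * v j) = 0" by blast
    define z where "z = - (\<Sum>j\<in>S'. c e j * v j) / c e h"
    have small_part: "(\<Sum>j\<in>S. k j * (v(h := z)) j) = k h * z + (\<Sum>j\<in>S'. k j * v j)" for k :: "'b \<Rightarrow> real"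
    proof -
      have "(\<Sum>j\<in>S'. k j * (v(h := z)) j) = (\<Sum>j\<in>S'. k j * v j)"
        by (rule sum.cong) (use fin in auto)
      then show ?thesis unfolding S using fin by simp
    qed
    show ?thesis
    proof (intro exI[of _ "v(h := z)"] conjI ballI)
      show "\<exists>j\<in>S. (v(h := z)) j \<noteq> 0" using v(1) fin S by (metis fun_upd_other insertCI)
      show "\<forall>j. j \<notin> S \<longrightarrow> (v(h := z)) j = 0" using v(2) S by auto
      fix e' assume e': "e' \<in> insert e E"
      show "(\<Sum>j\<in>S. c e' j * (v(h := z)) j) = 0"
      proof (cases "e' = e")
        case True
        show ?thesis unfolding True by (simp only: small_part) (use h in \<open>simp add: z_def\<close>)
      next
        case False
        with e' v(3) have "0 = (\<Sum>j\<in>S'. (c e' j - c e' h * c e j / c e h) * v j)" by auto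
        also have "\<dots> = (\<Sum>j\<in>S'. c e' j * v j) - c e' h / c e h * (\<Sum>j\<in>S'. c e j * v j)"
          by (simp add: algebra_simps sum_subtractf sum_distrib_left)
        finally show ?thesis by (simp only: small_part) (simp add: z_def)
      qed
    qed
  qed
qed

text \<open>Gram-Schmidt without projections: orthogonality to the vectors already found is just a
  further set of linear conditions, so \<open>null_vector\<close> yields the next vector as long as
  fewer than \<open>card S\<close> conditions are imposed.\<close>

lemma orthonormal_in_kernel:
  fixes D :: "'b \<Rightarrow> real" and c :: "'e \<Rightarrow> 'b \<Rightarrow> real"
  assumes fin: "finite S" "finite E" and D: "\<And>j. j \<in> S \<Longrightarrow> D j > 0"
    and m: "m + card E \<le> card S"
  shows "\<exists>v :: nat \<Rightarrow> 'b \<Rightarrow> real.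
    (\<forall>l<m. (\<forall>j. j \<notin> S \<longrightarrow> v l j = 0) \<and> (\<forall>e\<in>E. (\<Sum>j\<in>S. c e j * v l j) = 0)) \<and>
    (\<forall>l<m. \<forall>l'<m. (\<Sum>j\<in>S. D j * v l j * v l' j) = (if l = l' then 1 else 0))"
  using m
proof (induction m)
  case 0
  then show ?case by auto
next
  case (Suc m)
  then have "m + card E \<le> card S" by simp
  from Suc.IH[OF this] obtain v :: "nat \<Rightarrow> 'b \<Rightarrow> real"
    where v0: "(\<forall>l<m. (\<forall>j. j \<notin> S \<longrightarrow> v l j = 0) \<and> (\<forall>e\<in>E. (\<Sum>j\<in>S. c e j * v l j) = 0)) \<and>
    (\<forall>l<m. \<forall>l'<m. (\<Sum>j\<in>S. D j * v l j * v l' j) = (if l = l' then 1 else 0))"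
    by (elim exE)
  have v: "\<And>l. l < m \<Longrightarrow> (\<forall>j. j \<notin> S \<longrightarrow> v l j = 0) \<and> (\<forall>e\<in>E. (\<Sum>j\<in>S. c e j * v l j) = 0)"
    "\<And>l l'. l < m \<Longrightarrow> l' < m \<Longrightarrow> (\<Sum>j\<in>S. D j * v l j * v l' j) = (if l = l' then 1 else (0::real))"
    using v0 by simp_all
  have "card (Inl ` E \<union> Inr ` {..<m} :: ('e + nat) set) = card E + m"
    using fin by (subst card_Un_disjoint) (auto simp: card_image)
  then have "card (Inl ` E \<union> Inr ` {..<m} :: ('e + nat) set) < card S" using Suc.prems by simp
  from null_vector[OF _ fin(1) this, of "\<lambda>e j. case e of Inl e \<Rightarrow> c e j | Inr l \<Rightarrow> D j * v l j"]
  obtain u where u0: "\<exists>j\<in>S. u j \<noteq> 0" "\<forall>j. j \<notin> S \<longrightarrow> u j = 0"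
    "\<forall>e\<in>Inl ` E \<union> Inr ` {..<m}. (\<Sum>j\<in>S. (case e of Inl e \<Rightarrow> c e j | Inr l \<Rightarrow> D j * v l j) * u j) = 0"
    using fin by blast
  have u: "\<exists>j\<in>S. u j \<noteq> 0" "\<forall>j. j \<notin> S \<longrightarrow> u j = 0"
    "\<forall>e\<in>E. (\<Sum>j\<in>S. c e j * u j) = 0" "\<forall>l<m. (\<Sum>j\<in>S. D j * v l j * u j) = 0"
    using u0 by (simp_all add: ball_Un)
  define N where "N = (\<Sum>j\<in>S. D j * u j * u j)"
  have N: "N > 0" unfolding N_def
  proof -
    obtain j where j: "j \<in> S" "u j \<noteq> 0" using u(1) by auto
    have "0 < D j * u j * u j" using D[OF j(1)] j by (simp add: mult.assoc zero_less_mult_iff not_less) (metis linorder_neqE_linordered_idom)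
    also have "\<dots> \<le> (\<Sum>j\<in>S. D j * u j * u j)"
      by (rule member_le_sum[OF j(1)]) (use fin D in \<open>force simp: mult.assoc zero_le_mult_iff\<close>)+
    finally show "0 < (\<Sum>j\<in>S. D j * u j * u j)" .
  qed
  define w where "w j = u j / sqrt N" for j
  have w0: "(\<Sum>j\<in>S. k j * w j) = (\<Sum>j\<in>S. k j * u j) / sqrt N" for k :: "'b \<Rightarrow> real"
    by (simp add: w_def sum_divide_distrib)
  have ww: "(\<Sum>j\<in>S. D j * w j * w j) = 1"
  proof -
    have "(\<Sum>j\<in>S. D j * w j * w j) = N / (sqrt N * sqrt N)"
      by (simp add: w_def N_def sum_divide_distrib)
    then show ?thesis using N by simp
  qed
  have vw: "(\<Sum>j\<in>S. D j * v l j * w j) = 0" if "l < m" for l using u(4) that w0[of "\<lambda>j. D j * v l j"] by simp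
  then have wv: "(\<Sum>j\<in>S. D j * w j * v l j) = 0" if "l < m" for l using that
    by (simp add: mult.assoc mult.left_commute mult.commute)
  show ?case
  proof (intro exI[of _ "v(m := w)"] conjI allI impI)
    fix l assume "l < Suc m"
    then show "(v(m := w)) l j = 0" if "j \<notin> S" for j
      using v(1)[of l] u(2) that by (cases "l = m") (auto simp: w_def)
    show "\<forall>e\<in>E. (\<Sum>j\<in>S. c e j * (v(m := w)) l j) = 0"
      using v(1)[of l] u(3) w0 \<open>l < Suc m\<close> by (cases "l = m") auto
    fix l' assume "l' < Suc m"
    show "(\<Sum>j\<in>S. D j * (v(m := w)) l j * (v(m := w)) l' j) = (if l = l' then 1 else 0)"
      using v(2)[of l l'] vw[of l] wv[of l'] ww \<open>l < Suc m\<close> \<open>l' < Suc m\<close> by (auto simp: less_Suc_eq)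
  qed
qed

text \<open>Bessel's inequality for the scalar product with weights \<open>D\<close>: expand the
  squared \<open>D\<close>-distance of \<open>g / D\<close> from its projection onto the span of the
  \<open>v l\<close>.\<close>

lemma bessel:
  fixes D :: "'b \<Rightarrow> real" and v :: "nat \<Rightarrow> 'b \<Rightarrow> real"
  assumes fin: "finite S" and D: "\<And>j. j \<in> S \<Longrightarrow> D j > 0"
    and v: "\<And>l l'. l < m \<Longrightarrow> l' < m \<Longrightarrow> (\<Sum>j\<in>S. D j * v l j * v l' j) = (if l = l' then 1 else (0::real))"
  shows "(\<Sum>l<m. (\<Sum>j\<in>S. g j * v l j)\<^sup>2) \<le> (\<Sum>j\<in>S. (g j)\<^sup>2 / D j)"
proof -
  define c where "c l = (\<Sum>j\<in>S. g j * v l j)" for l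
  have "0 \<le> (\<Sum>j\<in>S. D j * (g j / D j - (\<Sum>l<m. c l * v l j))\<^sup>2)"
    by (intro sum_nonneg mult_nonneg_nonneg) (use D in \<open>auto intro: less_imp_le\<close>)
  also have "\<dots> = (\<Sum>j\<in>S. (g j)\<^sup>2 / D j - 2 * (\<Sum>l<m. c l * (g j * v l j))
      + (\<Sum>l<m. \<Sum>l'<m. c l * c l' * (D j * v l j * v l' j)))"
  proof (rule sum.cong[OF refl])
    fix j assume "j \<in> S"
    with D have Dj: "D j > 0" by auto
    have "D j * (g j / D j - (\<Sum>l<m. c l * v l j))\<^sup>2 = (g j)\<^sup>2 / D j - 2 * (g j * (\<Sum>l<m. c l * v l j))
        + D j * ((\<Sum>l<m. c l * v l j) * (\<Sum>l'<m. c l' * v l' j))"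
      using Dj by (simp add: power2_eq_square field_simps)
    also have "(\<Sum>l<m. c l * v l j) * (\<Sum>l'<m. c l' * v l' j) = (\<Sum>l<m. \<Sum>l'<m. c l * v l j * (c l' * v l' j))"
      by (rule sum_product)
    finally show "D j * (g j / D j - (\<Sum>l<m. c l * v l j))\<^sup>2 = (g j)\<^sup>2 / D j - 2 * (\<Sum>l<m. c l * (g j * v l j))
      + (\<Sum>l<m. \<Sum>l'<m. c l * c l' * (D j * v l j * v l' j))"
      by (simp add: sum_distrib_left mult_ac)
  qed
  also have "\<dots> = (\<Sum>j\<in>S. (g j)\<^sup>2 / D j) - 2 * (\<Sum>j\<in>S. \<Sum>l<m. c l * (g j * v l j))
      + (\<Sum>j\<in>S. \<Sum>l<m. \<Sum>l'<m. c l * c l' * (D j * v l j * v l' j))"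
    by (simp add: sum.distrib sum_subtractf sum_distrib_left)
  also have "(\<Sum>j\<in>S. \<Sum>l<m. c l * (g j * v l j)) = (\<Sum>l<m. (c l)\<^sup>2)"
    by (subst sum.swap) (simp add: c_def power2_eq_square sum_distrib_left)
  also have "(\<Sum>j\<in>S. \<Sum>l<m. \<Sum>l'<m. c l * c l' * (D j * v l j * v l' j)) = (\<Sum>l<m. \<Sum>l'<m. \<Sum>j\<in>S. c l * c l' * (D j * v l j * v l' j))"
    by (subst sum.swap) (rule sum.cong[OF refl], rule sum.swap)
  also have "\<dots> = (\<Sum>l<m. \<Sum>l'<m. c l * c l' * (if l = l' then 1 else 0))"
    by (intro sum.cong refl) (simp add: sum_distrib_left[symmetric] v)
  also have "\<dots> = (\<Sum>l<m. (c l)\<^sup>2)" by (simp add: power2_eq_square if_distrib cong: if_cong)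
  finally show ?thesis by (simp add: c_def)
qed

text \<open>Averaging: the kernel of the forms in \<open>E\<close> contains at least
  \<open>9/10 * card S\<close> vectors orthonormal for \<open>D\<close>. By Bessel and the trace
  bound, the values of the left form on them add up to at most \<open>3/8 * card S\<close>, so one
  value is at most \<open>5/12 < 1/2\<close>.\<close>

lemma small_direction_in_kernel:
  fixes D :: "'b \<Rightarrow> real" and W :: "'i \<Rightarrow> real" and b :: "'e \<Rightarrow> 'b \<Rightarrow> real" and g :: "'i \<Rightarrow> 'b \<Rightarrow> real"
  assumes fin: "finite S" "finite E" "finite I" and S: "S \<noteq> {}" and cd: "10 * card E \<le> card S"
    and D: "\<And>j. j \<in> S \<Longrightarrow> D j > 0" and W: "\<And>i. i \<in> I \<Longrightarrow> W i \<ge> 0"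
    and tr: "\<And>j. j \<in> S \<Longrightarrow> (\<Sum>i\<in>I. W i * (g i j)\<^sup>2) \<le> 3/8 * D j"
  shows "\<exists>v. (\<exists>j\<in>S. v j \<noteq> 0) \<and> (\<forall>j. j \<notin> S \<longrightarrow> v j = 0) \<and> (\<forall>e\<in>E. (\<Sum>j\<in>S. b e j * v j) = 0) \<and>
     (\<Sum>i\<in>I. W i * (\<Sum>j\<in>S. g i j * v j)\<^sup>2) \<le> 1/2 * (\<Sum>j\<in>S. D j * (v j)\<^sup>2)"
proof -
  define m where "m = card S - card E"
  have cS: "card S > 0" using S fin by (simp add: card_gt_0_iff)
  have m: "m + card E \<le> card S" "10 * m \<ge> 9 * card S" "m > 0" using cd cS by (auto simp: m_def)
  obtain v where v: "\<And>l. l < m \<Longrightarrow> (\<forall>j. j \<notin> S \<longrightarrow> v l j = 0) \<and> (\<forall>e\<in>E. (\<Sum>j\<in>S. b e j * v l j) = 0)"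
    "\<And>l l'. l < m \<Longrightarrow> l' < m \<Longrightarrow> (\<Sum>j\<in>S. D j * v l j * v l' j) = (if l = l' then 1 else (0::real))"
    using orthonormal_in_kernel[where D = D and c = b, OF fin(1,2) D m(1)] by blast
  have "\<exists>l<m. (\<Sum>i\<in>I. W i * (\<Sum>j\<in>S. g i j * v l j)\<^sup>2) \<le> 1/2"
  proof (rule ccontr)
    assume "\<not> ?thesis"
    then have "(\<Sum>l<m. 1/2) < (\<Sum>l<m. \<Sum>i\<in>I. W i * (\<Sum>j\<in>S. g i j * v l j)\<^sup>2)"
      using m by (intro sum_strict_mono) auto
    also have "\<dots> = (\<Sum>i\<in>I. W i * (\<Sum>l<m. (\<Sum>j\<in>S. g i j * v l j)\<^sup>2))"
      by (subst sum.swap) (simp add: sum_distrib_left)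
    also have "\<dots> \<le> (\<Sum>i\<in>I. W i * (\<Sum>j\<in>S. (g i j)\<^sup>2 / D j))"
      by (intro sum_mono mult_left_mono bessel W v D fin) auto
    also have "\<dots> = (\<Sum>j\<in>S. (\<Sum>i\<in>I. W i * (g i j)\<^sup>2) / D j)"
      by (simp add: sum_distrib_left sum_divide_distrib) (rule sum.swap)
    also have "\<dots> \<le> (\<Sum>j\<in>S. 3/8)"
      by (intro sum_mono) (use tr D in \<open>auto simp: divide_le_eq\<close>)
    finally have "real m * (1/2) < real (card S) * (3/8)" by simp
    moreover have "real (10 * m) \<ge> real (9 * card S)" using m(2) by (subst of_nat_le_iff)
    ultimately show False using cS by simp
  qed
  then obtain l where l: "l < m" "(\<Sum>i\<in>I. W i * (\<Sum>j\<in>S. g i j * v l j)\<^sup>2) \<le> 1/2" by auto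
  have one: "(\<Sum>j\<in>S. D j * (v l j)\<^sup>2) = 1" using v(2)[OF l(1) l(1)] by (simp add: power2_eq_square mult.assoc)
  then have "\<exists>j\<in>S. v l j \<noteq> 0" by (metis (mono_tags, lifting) mult_zero_right sum.neutral power_zero_numeral zero_neq_one)
  then show ?thesis using v(1)[OF l(1)] l one by (intro exI[of _ "v l"]) auto
qed

subsection \<open>The power method\<close>

definition ip :: "nat \<Rightarrow> (nat \<Rightarrow> real) \<Rightarrow> (nat \<Rightarrow> real) \<Rightarrow> real" where
  "ip n u v = (\<Sum>j<n. u j * v j)"

definition app :: "nat \<Rightarrow> (nat \<Rightarrow> nat \<Rightarrow> real) \<Rightarrow> (nat \<Rightarrow> real) \<Rightarrow> nat \<Rightarrow> real" where
  "app n P v j = (\<Sum>l<n. P j l * v l)"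

definition unitv :: "nat \<Rightarrow> nat \<Rightarrow> real" where "unitv j l = (if l = j then 1 else 0)"

lemma ip_commute: "ip n u v = ip n v u" by (simp add: ip_def mult.commute)

lemma ip_nonneg: "ip n v v \<ge> 0" by (simp add: ip_def sum_nonneg)

text \<open>Source of both Cauchy-Schwarz inequalities below. The leading coefficient may vanish,
  because one of the two forms is only semidefinite.\<close>

lemma discriminant_le:
  fixes A B C :: real
  assumes "\<And>t. 0 \<le> A + 2 * t * B + t\<^sup>2 * C" "C \<ge> 0"
  shows "B\<^sup>2 \<le> A * C"
proof (cases "C = 0")
  case True
  have "B = 0"
  proof (rule ccontr)
    assume "B \<noteq> 0"
    \<comment> \<open>At this \<open>t\<close> the affine function takes the value -1.\<close>
    then show False using assms(1)[of "- (A + 1) / (2 * B)"] True by (simp add: field_simps)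
  qed
  then show ?thesis using True by simp
next
  case False
  then have C: "C > 0" using assms by auto
  have "0 \<le> A + 2 * (- B / C) * B + (- B / C)\<^sup>2 * C" by (rule assms)
  also have "\<dots> = A - B\<^sup>2 / C" using C by (simp add: power2_eq_square field_simps)
  finally show ?thesis using C by (simp add: field_simps)
qed

locale psd =
  fixes n :: nat and P :: "nat \<Rightarrow> nat \<Rightarrow> real"
  assumes sym: "\<And>j l. j < n \<Longrightarrow> l < n \<Longrightarrow> P j l = P l j"
    and psd: "\<And>v. ip n v (app n P v) \<ge> 0"
begin

abbreviation "T \<equiv> app n P"

lemma ip_app: "ip n u (T v) = ip n (T u) v"
proof -
  have "ip n u (T v) = (\<Sum>j<n. \<Sum>l<n. u j * P j l * v l)"
    by (simp add: ip_def app_def sum_distrib_left mult.assoc)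
  also have "\<dots> = (\<Sum>j<n. \<Sum>l<n. P j l * u l * v j)"
    by (subst sum.swap, intro sum.cong refl) (auto simp: sym)
  finally show ?thesis by (simp add: ip_def app_def sum_distrib_right)
qed

lemma ip_pow: "ip n ((T ^^ s) u) ((T ^^ t) v) = ip n u ((T ^^ (s + t)) v)"
proof (induction s arbitrary: t)
  case (Suc s)
  have "ip n ((T ^^ Suc s) u) ((T ^^ t) v) = ip n ((T ^^ s) u) ((T ^^ Suc t) v)"
    using ip_app[of "(T ^^ s) u" "(T ^^ t) v"] by simp
  then show ?case using Suc[of "Suc t"] by simp
qed simp

lemma app_add: "T (\<lambda>j. u j + t * v j) = (\<lambda>j. T u j + t * T v j)"
  by (auto simp: app_def fun_eq_iff algebra_simps sum.distrib sum_distrib_left)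

lemma ip_add: "ip n (\<lambda>j. u j + t * v j) z = ip n u z + t * ip n v z"
  by (simp add: ip_def algebra_simps sum.distrib sum_distrib_left)

lemma cauchy_ip: "(ip n u v)\<^sup>2 \<le> ip n u u * ip n v v"
proof (rule discriminant_le)
  fix t
  have "0 \<le> ip n (\<lambda>j. u j + t * v j) (\<lambda>j. u j + t * v j)" by (rule ip_nonneg)
  also have "\<dots> = ip n u u + 2 * t * ip n u v + t\<^sup>2 * ip n v v"
    by (simp add: ip_add ip_commute[of n _ "\<lambda>j. u j + t * v j"] ip_commute[of n v u] algebra_simps power2_eq_square)
  finally show "0 \<le> \<dots>" .
qed (rule ip_nonneg)

lemma cauchy_T: "(ip n u (T v))\<^sup>2 \<le> ip n u (T u) * ip n v (T v)"
proof (rule discriminant_le)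
  fix t
  have c: "ip n (T u) z = ip n z (T u)" for u z by (rule ip_commute)
  have "0 \<le> ip n (\<lambda>j. u j + t * v j) (T (\<lambda>j. u j + t * v j))" by (rule psd)
  also have "\<dots> = ip n u (T u) + 2 * t * ip n u (T v) + t\<^sup>2 * ip n v (T v)"
    unfolding app_add ip_add ip_commute[of n _ "\<lambda>j. T u j + t * T v j"] c
    using ip_app[of v u] by (simp add: c algebra_simps power2_eq_square)
  finally show "0 \<le> \<dots>" .
qed (rule psd)

text \<open>In spectral terms, the moments of the spectral measure of \<open>u\<close>.\<close>

definition mom :: "(nat \<Rightarrow> real) \<Rightarrow> nat \<Rightarrow> real" where "mom u t = ip n u ((T ^^ t) u)"

lemma mom_even: "mom u (2 * s) = ip n ((T ^^ s) u) ((T ^^ s) u)"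
  by (simp add: mom_def ip_pow mult_2)

lemma mom_odd: "mom u (Suc (2 * s)) = ip n ((T ^^ s) u) (T ((T ^^ s) u))"
  using ip_pow[of s u "Suc s" u] by (simp add: mom_def mult_2)

lemma mom_nonneg: "mom u t \<ge> 0"
  by (cases "even t") (auto elim!: evenE oddE simp: mom_even mom_odd ip_nonneg psd)

text \<open>The exponent is split between the two arguments. For even \<open>t\<close>
  Cauchy-Schwarz is applied in the Euclidean product, for odd \<open>t\<close> in the semidefinite
  form of \<open>P\<close>.\<close>

lemma mom_log_convex: "(mom u (Suc t))\<^sup>2 \<le> mom u t * mom u (Suc (Suc t))"
proof (cases "even t")
  case True
  then obtain s where s: "t = 2 * s" by (elim evenE)
  have "mom u (Suc (Suc t)) = ip n ((T ^^ Suc s) u) ((T ^^ Suc s) u)" using mom_even[of u "Suc s"] by (simp add: s)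
  then show ?thesis using cauchy_ip[of "(T ^^ s) u" "(T ^^ Suc s) u"] by (simp add: s mom_even mom_odd)
next
  case False
  then obtain s where s: "t = Suc (2 * s)" by (auto elim!: oddE)
  have e: "mom u (Suc t) = ip n ((T ^^ s) u) (T ((T ^^ Suc s) u))"
    using ip_pow[of s u "Suc (Suc s)" u] by (simp add: mom_def s mult_2)
  have "mom u (Suc (Suc t)) = ip n ((T ^^ Suc s) u) (T ((T ^^ Suc s) u))" using mom_odd[of u "Suc s"] by (simp add: s)
  then show ?thesis using cauchy_T[of "(T ^^ s) u" "(T ^^ Suc s) u"] e by (simp add: s mom_odd)
qed

text \<open>Log-convexity says that consecutive ratios of moments do not decrease. The form without
  division allows for vanishing moments.\<close>

lemma mom_ratio_mono:
  assumes "mom u (Suc s) \<ge> r * mom u s" "s \<le> t" "r > 0"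
  shows "mom u (Suc t) \<ge> r * mom u t"
  using assms(2)
proof (induction t rule: dec_induct)
  case base
  then show ?case by (rule assms)
next
  case (step t)
  show ?case
  proof (cases "mom u t = 0")
    case True
    then have "mom u (Suc t) = 0" using mom_log_convex[of u t] by simp
    then show ?thesis using mom_nonneg by simp
  next
    case False
    then have p: "mom u t > 0" using mom_nonneg[of u t] by simp
    have "mom u t * (r * mom u (Suc t)) \<le> mom u (Suc t) * mom u (Suc t)"
      using mult_right_mono[OF step.IH mom_nonneg[of u "Suc t"]] by (simp add: mult_ac)
    also have "\<dots> \<le> mom u t * mom u (Suc (Suc t))" using mom_log_convex[of u t] by (simp add: power2_eq_square)
    finally show ?thesis using p by simp
  qed
qed

lemma mom_lower:
  assumes "mom u 1 \<ge> r * mom u 0" "r > 0"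
  shows "mom u t \<ge> r ^ t * mom u 0"
proof (induction t)
  case (Suc t)
  have "r ^ Suc t * mom u 0 \<le> r * mom u t" using Suc assms(2) by (simp add: mult.assoc)
  also have "\<dots> \<le> mom u (Suc t)" using mom_ratio_mono[of r u 0 t] assms by simp
  finally show ?case .
qed simp

lemma mom_upper:
  assumes "mom u (Suc t) < r * mom u t" "s \<le> t" "r > 0"
  shows "mom u s \<le> r ^ s * mom u 0"
  using assms(2)
proof (induction s)
  case (Suc s)
  have "mom u (Suc s) < r * mom u s"
    using mom_ratio_mono[of r u s t] assms Suc.prems by fastforce
  also have "\<dots> \<le> r * (r ^ s * mom u 0)" using Suc assms by simp
  finally show ?case by simp
qed simp

lemma ip_unitv: "j < n \<Longrightarrow> ip n (unitv j) v = v j"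
  by (simp add: ip_def unitv_def if_distrib[of "\<lambda>x. x * _"] cong: if_cong)

lemma pow_expand: "j < n \<Longrightarrow> (T ^^ N) v j = (\<Sum>l<n. v l * (T ^^ N) (unitv l) j)"
proof (induction N arbitrary: j)
  case 0
  then show ?case by (simp add: unitv_def if_distrib cong: if_cong)
next
  case (Suc N)
  have "(T ^^ Suc N) v j = (\<Sum>h<n. P j h * (T ^^ N) v h)"
    by (simp only: funpow.simps o_apply) (simp only: app_def)
  also have "\<dots> = (\<Sum>h<n. P j h * (\<Sum>l<n. v l * (T ^^ N) (unitv l) h))"
    by (intro sum.cong refl) (simp add: Suc.IH)
  also have "\<dots> = (\<Sum>h<n. \<Sum>l<n. v l * (P j h * (T ^^ N) (unitv l) h))"
    by (simp add: sum_distrib_left mult_ac)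
  also have "\<dots> = (\<Sum>l<n. \<Sum>h<n. v l * (P j h * (T ^^ N) (unitv l) h))" by (rule sum.swap)
  finally have e: "(T ^^ Suc N) v j = (\<Sum>l<n. \<Sum>h<n. v l * (P j h * (T ^^ N) (unitv l) h))" .
  have "(T ^^ Suc N) (unitv l) j = (\<Sum>h<n. P j h * (T ^^ N) (unitv l) h)" for l
    by (simp only: funpow.simps o_apply) (simp only: app_def)
  then show ?case by (simp only: e sum_distrib_left)
qed

text \<open>An even power is the Gram matrix of the vectors \<open>(T ^^ N) (unitv j)\<close>, so
  Cauchy-Schwarz bounds every entry by the largest diagonal entry.\<close>

lemma pow_entry_le:
  assumes "\<And>l. l < n \<Longrightarrow> mom (unitv l) (2 * N) \<le> M" "j < n" "l < n"
  shows "\<bar>(T ^^ (2 * N)) (unitv j) l\<bar> \<le> M"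
proof -
  have "(T ^^ (2 * N)) (unitv j) l = ip n ((T ^^ N) (unitv l)) ((T ^^ N) (unitv j))"
    using assms by (simp add: ip_pow ip_unitv mult_2)
  then have "((T ^^ (2 * N)) (unitv j) l)\<^sup>2 \<le> mom (unitv l) (2*N) * mom (unitv j) (2*N)"
    by (simp add: cauchy_ip mom_even)
  also have "\<dots> \<le> M * M" using assms mom_nonneg by (intro mult_mono) (auto intro: order_trans)
  finally have "\<bar>(T ^^ (2 * N)) (unitv j) l\<bar>\<^sup>2 \<le> M\<^sup>2" by (simp add: power2_eq_square)
  moreover have "M \<ge> 0" using assms mom_nonneg order_trans by blast
  ultimately show ?thesis by (rule power2_le_imp_le)
qed

text \<open>The moments \<open>\<langle>u, P\<^sup>t u\<rangle>\<close> are log-convex in \<open>t\<close>, which replaces the spectral theorem in the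
  analysis of the power method.\<close>

lemma power_method:
  assumes jmax: "js < n" "\<And>j. j < n \<Longrightarrow> (T ^^ (2 * N)) (unitv j) j \<le> (T ^^ (2 * N)) (unitv js) js"
    and v: "ip n v v > 0" "ip n v (T v) \<ge> (c + \<gamma>) * ip n v v"
    and c: "c > 0" "\<gamma> > 0" and N: "real (2 * N) * (\<gamma> / 2) \<ge> real n * (c + \<gamma> / 2)"
  defines "y \<equiv> (T ^^ (2 * N)) (unitv js)"
  shows "y js > 0" "\<And>l. l < n \<Longrightarrow> \<bar>y l\<bar> \<le> y js" "ip n y (T y) \<ge> (c + \<gamma> / 2) * ip n y y"
proof -
  have ent: "mom (unitv j) t = (T ^^ t) (unitv j) j" if "j < n" for j t using that by (simp add: mom_def ip_unitv)
  have le: "\<bar>(T ^^ (2 * N)) (unitv j) l\<bar> \<le> y js" if "j < n" "l < n" for j l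
    using pow_entry_le[of N "y js"] that jmax ent by (auto simp: y_def)
  then show "\<bar>y l\<bar> \<le> y js" if "l < n" for l using that jmax unfolding y_def by blast
  have yp: "y js \<ge> 0" using le jmax by (meson abs_ge_zero order_trans)
  have sq: "(\<Sum>j<n. \<bar>v j\<bar>)\<^sup>2 \<le> real n * ip n v v"
    using cauchy_ip[of "\<lambda>j. \<bar>v j\<bar>" "\<lambda>_. 1"] by (simp add: ip_def mult.commute)
  \<comment> \<open>Lower bound for the selected diagonal entry: the moment of \<open>v\<close> is
    large, and it is a combination of entries of the power, none of which exceeds
    \<open>y js\<close> in absolute value.\<close>
  have "(c + \<gamma>) ^ (2 * N) * ip n v v \<le> mom v (2 * N)"
    using mom_lower[of "c + \<gamma>" v "2 * N"] v c by (simp add: mom_def)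
  also have "\<dots> = (\<Sum>j<n. \<Sum>l<n. v j * v l * (T ^^ (2*N)) (unitv l) j)"
    unfolding mom_def ip_def by (intro sum.cong refl, subst pow_expand) (auto simp: sum_distrib_left mult.assoc)
  also have "\<dots> \<le> (\<Sum>j<n. \<Sum>l<n. \<bar>v j\<bar> * \<bar>v l\<bar> * y js)"
  proof (intro sum_mono)
    fix j l assume jl: "j \<in> {..<n}" "l \<in> {..<n}"
    have "v j * v l * (T ^^ (2*N)) (unitv l) j \<le> \<bar>v j\<bar> * \<bar>v l\<bar> * \<bar>(T ^^ (2*N)) (unitv l) j\<bar>"
      by (metis abs_ge_self abs_mult)
    also have "\<dots> \<le> \<bar>v j\<bar> * \<bar>v l\<bar> * y js" using le jl by (intro mult_left_mono) auto
    finally show "v j * v l * (T ^^ (2*N)) (unitv l) j \<le> \<bar>v j\<bar> * \<bar>v l\<bar> * y js" .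
  qed
  also have "\<dots> = y js * (\<Sum>j<n. \<bar>v j\<bar>)\<^sup>2"
    by (simp add: power2_eq_square sum_product sum_distrib_left mult_ac)
  also have "\<dots> \<le> y js * (real n * ip n v v)" by (intro mult_left_mono sq yp)
  finally have low: "(c + \<gamma>) ^ (2 * N) \<le> y js * real n" using v(1) by simp
  have n: "real n > 0" using jmax by simp
  show pos: "y js > 0"
  proof (rule ccontr)
    assume "\<not> y js > 0"
    then have "y js = 0" using yp by simp
    moreover have "(c + \<gamma>) ^ (2 * N) > 0" using c by simp
    ultimately show False using low by simp
  qed
  show "ip n y (T y) \<ge> (c + \<gamma> / 2) * ip n y y"
  proof (rule ccontr)
    assume "\<not> ?thesis"
    \<comment> \<open>A small Rayleigh quotient of \<open>y\<close> is a small ratio of the moments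
      of \<open>unitv js\<close> at \<open>4 N\<close>, hence at all smaller exponents; this bounds
      \<open>y js\<close>, the moment at \<open>2 N\<close>, from above.\<close>
    then have "mom (unitv js) (Suc (2 * (2 * N))) < (c + \<gamma> / 2) * mom (unitv js) (2 * (2 * N))"
      by (simp only: mom_even mom_odd y_def not_le)
    from mom_upper[OF this, of "2 * N"] have up: "y js \<le> (c + \<gamma> / 2) ^ (2 * N)"
      using c jmax ent[of js "2 * N"] ent[of js 0] by (simp add: y_def unitv_def)
    \<comment> \<open>By Bernoulli and the hypothesis on \<open>N\<close>, the quotient
      \<open>1 + q\<close> of the two rates, raised to \<open>2 N\<close>, exceeds the factor
      \<open>n\<close> lost in the lower bound.\<close>
    define q where "q = (\<gamma> / 2) / (c + \<gamma> / 2)"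
    have q: "q \<ge> 0" "c + \<gamma> = (c + \<gamma> / 2) * (1 + q)" using c by (auto simp: q_def field_simps)
    have "1 + real (2 * N) * q \<le> (1 + q) ^ (2 * N)" using q by (intro Bernoulli_inequality) auto
    moreover have "real (2 * N) * q \<ge> real n" using N c unfolding q_def times_divide_eq_right
      by (subst pos_le_divide_eq) auto
    ultimately have "real n < (1 + q) ^ (2 * N)" by simp
    then have "(c + \<gamma> / 2) ^ (2 * N) * real n < (c + \<gamma>) ^ (2 * N)"
      unfolding q(2) power_mult_distrib using c by simp
    also have "\<dots> \<le> (c + \<gamma> / 2) ^ (2 * N) * real n"
      using low mult_right_mono[OF up, of "real n"] by simp
    finally show False by simp
  qed
qed

end

subsection \<open>One step of the walk\<close>

lemma ip_add_right: "ip n z (\<lambda>j. u j + t * v j) = ip n z u + t * ip n z v"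
  by (simp add: ip_def algebra_simps sum.distrib sum_distrib_left)

text \<open>The situation at one step: \<open>S\<close> is the alive set, \<open>s i\<close> the
  retained coefficients of row \<open>i\<close> times its rate, \<open>g i\<close> the gradient of
  its exponent, and \<open>act\<close> fails on blocked rows. The column sums are 2 because every
  row occurs with both signs.\<close>

locale descent =
  fixes n :: nat and a s g :: "nat \<Rightarrow> nat \<Rightarrow> real" and w :: "nat \<Rightarrow> real" and act :: "nat \<Rightarrow> bool"
    and S :: "nat set"
  assumes n: "n \<ge> 1" and S: "S \<subseteq> {..<n}" "S \<noteq> {}"
    and col: "\<And>j. j < n \<Longrightarrow> (\<Sum>i<2*n. (a i j)\<^sup>2) \<le> 2"
    and w0: "\<And>i. i < 2*n \<Longrightarrow> w i \<ge> 0" and wsum: "(\<Sum>i<2*n. w i) \<le> 14 * real n"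
    and s: "\<And>i j. i < 2*n \<Longrightarrow> j < n \<Longrightarrow> \<bar>s i j\<bar> \<le> 1/128"
    and g: "\<And>i j. i < 2*n \<Longrightarrow> j < n \<Longrightarrow> \<bar>g i j\<bar> \<le> 2 * \<bar>s i j\<bar>"
    and few: "10 * card {i. i < 2*n \<and> \<not> act i} \<le> card S"
begin

text \<open>\<open>- Qm\<close> is the matrix of the second-order change of the potential. The shift
  \<open>c\<close> exceeds the negative part of \<open>Qm\<close>, which makes \<open>P\<close>
  semidefinite, and it also bounds the entries of \<open>P\<close> minus the shift. The extra 1
  stems from the term \<open>\<bar>x\<bar>\<^sup>2\<close>, so a descent direction is a vector whose
  Rayleigh quotient for \<open>P\<close> exceeds \<open>c\<close>.\<close>

definition "V = 100 * real n ^ 3"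
definition "c = 300 * real n ^ 4"
definition "Qm j l = (\<Sum>i<2*n. if act i then (if j = l then 32 * w i * s i j * s i j - 3 * w i * g i j * g i l else - (3 * w i * g i j * g i l))
    else - (V * a i j * a i l))"
definition "P j l = (if j \<in> S \<and> l \<in> S then (if j = l then Qm j l + (c + 1) else Qm j l) else 0)"

lemma finS: "finite S" using S finite_subset by blast

lemma n1: "real n \<ge> 1" using n by simp

lemma pown: "real n ^ i \<le> real n ^ (i + k)"
  using n1 by (intro power_increasing) auto

lemma c_pos: "c > 0" using n1 by (simp add: c_def)
lemma V_nonneg: "V \<ge> 0" by (simp add: V_def)

lemma g2: "i < 2*n \<Longrightarrow> j < n \<Longrightarrow> (g i j)\<^sup>2 \<le> 4 * (s i j)\<^sup>2"
  using g[of i j] power_mono[of "\<bar>g i j\<bar>" "2 * \<bar>s i j\<bar>" 2] by (simp add: power_mult_distrib)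

lemma s2: "i < 2*n \<Longrightarrow> j < n \<Longrightarrow> (s i j)\<^sup>2 \<le> 1/16384"
  using s[of i j] power_mono[of "\<bar>s i j\<bar>" "1/128" 2] by (simp add: power2_eq_square)

lemma P_sym: "P j l = P l j"
  by (auto simp: P_def Qm_def mult_ac intro!: sum.cong)

lemma sum_S: "(\<Sum>j<n. if j \<in> S then f j else 0) = (\<Sum>j\<in>S. f j)" for f :: "nat \<Rightarrow> real"
  using S by (subst sum.inter_restrict[symmetric]) (auto simp: Int_absorb1)

lemma diag_form:
  fixes v :: "nat \<Rightarrow> real"
  shows "(\<Sum>j\<in>S. \<Sum>l\<in>S. v j * (if j = l then k j else 0) * v l) = (\<Sum>j\<in>S. k j * (v j)\<^sup>2)"
proof (rule sum.cong[OF refl])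
  fix j assume "j \<in> S"
  have "(\<Sum>l\<in>S. v j * (if j = l then k j else 0) * v l) = (\<Sum>l\<in>S. if j = l then v j * k j * v l else 0)"
    by (intro sum.cong) auto
  also have "\<dots> = k j * (v j)\<^sup>2" using \<open>j \<in> S\<close> finS by (simp add: power2_eq_square)
  finally show "(\<Sum>l\<in>S. v j * (if j = l then k j else 0) * v l) = k j * (v j)\<^sup>2" .
qed

lemma rank_one_form:
  fixes v :: "nat \<Rightarrow> real"
  shows "(\<Sum>j\<in>S. \<Sum>l\<in>S. v j * (k * b j * b l) * v l) = k * (\<Sum>j\<in>S. b j * v j)\<^sup>2"
  by (simp add: power2_eq_square sum_product sum_distrib_left mult_ac)

lemma quadratic_form: "ip n v (app n P v) = (c + 1) * (\<Sum>j\<in>S. (v j)\<^sup>2) +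
   (\<Sum>i<2*n. if act i then 32 * w i * (\<Sum>j\<in>S. (s i j * v j)\<^sup>2) - 3 * w i * (\<Sum>j\<in>S. g i j * v j)\<^sup>2
      else - V * (\<Sum>j\<in>S. a i j * v j)\<^sup>2)"
proof -
  define q where "q i j l = (if act i then (if j = l then 32 * w i * s i j * s i j else 0) - 3 * w i * g i j * g i l
    else - V * a i j * a i l)" for i j l
  have Qq: "Qm j l = (\<Sum>i<2*n. q i j l)" for j l
    unfolding Qm_def q_def by (intro sum.cong) auto
  have "ip n v (app n P v) = (\<Sum>j<n. \<Sum>l<n. v j * P j l * v l)"
    by (simp add: ip_def app_def sum_distrib_left mult.assoc)
  also have "\<dots> = (\<Sum>j<n. if j \<in> S then (\<Sum>l<n. if l \<in> S then v j * ((if j = l then c + 1 else 0) + Qm j l) * v l else 0) else 0)"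
    by (intro sum.cong refl) (auto simp: P_def intro!: sum.cong sum.neutral)
  also have "\<dots> = (\<Sum>j\<in>S. \<Sum>l\<in>S. v j * ((if j = l then c + 1 else 0) + Qm j l) * v l)"
    by (simp only: sum_S)
  also have "\<dots> = (\<Sum>j\<in>S. \<Sum>l\<in>S. v j * (if j = l then c + 1 else 0) * v l) + (\<Sum>j\<in>S. \<Sum>l\<in>S. v j * Qm j l * v l)"
    by (simp add: sum.distrib[symmetric] algebra_simps)
  also have "(\<Sum>j\<in>S. \<Sum>l\<in>S. v j * Qm j l * v l) = (\<Sum>j\<in>S. \<Sum>l\<in>S. \<Sum>i<2*n. v j * q i j l * v l)"
    by (simp add: Qq sum_distrib_left sum_distrib_right)
  also have "\<dots> = (\<Sum>i<2*n. \<Sum>j\<in>S. \<Sum>l\<in>S. v j * q i j l * v l)"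
    by (subst sum.swap[of _ "{..<2*n}"]) (rule sum.swap)
  also have "\<dots> = (\<Sum>i<2*n. if act i then 32 * w i * (\<Sum>j\<in>S. (s i j * v j)\<^sup>2) - 3 * w i * (\<Sum>j\<in>S. g i j * v j)\<^sup>2
      else - V * (\<Sum>j\<in>S. a i j * v j)\<^sup>2)"
  proof (intro sum.cong refl)
    fix i
    have "(\<Sum>j\<in>S. \<Sum>l\<in>S. v j * ((if j = l then 32 * w i * s i j * s i j else 0) - 3 * w i * g i j * g i l) * v l)
      = (\<Sum>j\<in>S. \<Sum>l\<in>S. v j * (if j = l then 32 * w i * s i j * s i j else 0) * v l) - (\<Sum>j\<in>S. \<Sum>l\<in>S. v j * (3 * w i * g i j * g i l) * v l)"
      by (simp add: sum_subtractf[symmetric] algebra_simps)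
    also have "\<dots> = 32 * w i * (\<Sum>j\<in>S. (s i j * v j)\<^sup>2) - 3 * w i * (\<Sum>j\<in>S. g i j * v j)\<^sup>2"
      unfolding diag_form rank_one_form by (simp add: sum_distrib_left power2_eq_square mult_ac)
    finally show "(\<Sum>j\<in>S. \<Sum>l\<in>S. v j * q i j l * v l) = (if act i then 32 * w i * (\<Sum>j\<in>S. (s i j * v j)\<^sup>2) - 3 * w i * (\<Sum>j\<in>S. g i j * v j)\<^sup>2
      else - V * (\<Sum>j\<in>S. a i j * v j)\<^sup>2)"
    proof (cases "act i")
      case False
      have "(\<Sum>j\<in>S. \<Sum>l\<in>S. v j * (- V * a i j * a i l) * v l) = - V * (\<Sum>j\<in>S. a i j * v j)\<^sup>2"
        by (rule rank_one_form)
      with False show ?thesis by (simp only: q_def if_False)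
    qed (simp only: q_def if_True)
  qed
  also have "(\<Sum>j\<in>S. \<Sum>l\<in>S. v j * (if j = l then c + 1 else 0) * v l) = (c + 1) * (\<Sum>j\<in>S. (v j)\<^sup>2)"
    using diag_form[of v "\<lambda>_. c + 1"] by (simp add: sum_distrib_left)
  finally show ?thesis .
qed

lemma row_sum_swap: "(\<Sum>i<2*n. \<Sum>j\<in>S. (a i j)\<^sup>2) \<le> 2 * real n"
proof -
  have "(\<Sum>i<2*n. \<Sum>j\<in>S. (a i j)\<^sup>2) = (\<Sum>j\<in>S. \<Sum>i<2*n. (a i j)\<^sup>2)" by (rule sum.swap)
  also have "\<dots> \<le> (\<Sum>j\<in>S. 2)" by (intro sum_mono col) (use S in auto)
  also have "\<dots> \<le> 2 * real n" using card_mono[OF _ S(1)] by simp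
  finally show ?thesis .
qed

lemma card_S: "card S \<le> n" using card_mono[OF _ S(1)] by simp

sublocale psd n P
proof
  show "P j l = P l j" for j l by (rule P_sym)
  fix v :: "nat \<Rightarrow> real"
  define X where "X = (\<Sum>j\<in>S. (v j)\<^sup>2)"
  have X: "X \<ge> 0" by (auto simp: X_def intro: sum_nonneg)
  \<comment> \<open>Only the rank one terms are negative. By Cauchy-Schwarz the active rows
    contribute at most \<open>n\<^sup>2\<close> in total, since the weights sum to at most
    \<open>14 * n\<close>, and the blocked rows at most
    \<open>V * 2 * n = 200 * n ^ 4\<close>.\<close>
  have "- ((real n) ^ 2 + 200 * real n ^ 4) * X \<le> (\<Sum>i<2*n. - (w i * real n / 14 + V * (\<Sum>j\<in>S. (a i j)\<^sup>2)) * X)"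
  proof -
    have "(\<Sum>i<2*n. w i * real n / 14 + V * (\<Sum>j\<in>S. (a i j)\<^sup>2)) = (\<Sum>i<2*n. w i) * real n / 14 + V * (\<Sum>i<2*n. \<Sum>j\<in>S. (a i j)\<^sup>2)"
      by (simp add: sum.distrib sum_distrib_left sum_distrib_right sum_divide_distrib)
    also have "\<dots> \<le> (14 * real n) * real n / 14 + V * (2 * real n)"
      using wsum row_sum_swap by (intro add_mono divide_right_mono mult_right_mono mult_left_mono V_nonneg) auto
    also have "\<dots> = real n ^ 2 + 200 * real n ^ 4" by (simp add: V_def power2_eq_square eval_nat_numeral)
    finally have "(\<Sum>i<2*n. w i * real n / 14 + V * (\<Sum>j\<in>S. (a i j)\<^sup>2)) * X \<le> (real n ^ 2 + 200 * real n ^ 4) * X"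
      using X by (rule mult_right_mono)
    then show ?thesis by (simp only: sum_negf mult_minus_left sum_distrib_right[symmetric] neg_le_iff_le)
  qed
  also have "\<dots> \<le> (\<Sum>i<2*n. if act i then 32 * w i * (\<Sum>j\<in>S. (s i j * v j)\<^sup>2) - 3 * w i * (\<Sum>j\<in>S. g i j * v j)\<^sup>2
      else - V * (\<Sum>j\<in>S. a i j * v j)\<^sup>2)"
  proof (rule sum_mono)
    fix i assume "i \<in> {..<2*n}" then have i: "i < 2*n" by simp
    have "(\<Sum>j\<in>S. g i j * v j)\<^sup>2 \<le> (\<Sum>j\<in>S. (g i j)\<^sup>2) * X" unfolding X_def by (rule Cauchy_Schwarz_ineq_sum)
    also have "(\<Sum>j\<in>S. (g i j)\<^sup>2) \<le> (\<Sum>j\<in>S. 1/4096)"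
    proof (rule sum_mono)
      fix j assume "j \<in> S" then have "j < n" using S by auto
      then show "(g i j)\<^sup>2 \<le> 1/4096" using g2[OF i, of j] s2[OF i, of j] by simp
    qed
    also have "\<dots> \<le> real n / 4096" using card_S by simp
    finally have "(\<Sum>j\<in>S. g i j * v j)\<^sup>2 \<le> real n / 4096 * X" using X by (simp add: mult_right_mono)
    then have "3 * w i * (\<Sum>j\<in>S. g i j * v j)\<^sup>2 \<le> 3 * w i * (real n / 4096 * X)"
      using w0[OF i] by (intro mult_left_mono) auto
    also have "\<dots> \<le> w i * real n / 14 * X" using w0[OF i] X by (simp add: field_simps)
    finally have 1: "3 * w i * (\<Sum>j\<in>S. g i j * v j)\<^sup>2 \<le> w i * real n / 14 * X" .
    have 2: "V * (\<Sum>j\<in>S. a i j * v j)\<^sup>2 \<le> V * (\<Sum>j\<in>S. (a i j)\<^sup>2) * X"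
      unfolding X_def mult.assoc by (intro mult_left_mono Cauchy_Schwarz_ineq_sum V_nonneg)
    have 3: "0 \<le> 32 * w i * (\<Sum>j\<in>S. (s i j * v j)\<^sup>2)" "0 \<le> w i * real n / 14 * X" "0 \<le> V * (\<Sum>j\<in>S. (a i j)\<^sup>2) * X"
      using w0[OF i] X V_nonneg by (auto intro!: mult_nonneg_nonneg sum_nonneg)
    have e: "- (w i * real n / 14 + V * (\<Sum>j\<in>S. (a i j)\<^sup>2)) * X = - (w i * real n / 14 * X) - V * (\<Sum>j\<in>S. (a i j)\<^sup>2) * X"
      by (simp add: algebra_simps)
    show "- (w i * real n / 14 + V * (\<Sum>j\<in>S. (a i j)\<^sup>2)) * X \<le> (if act i then 32 * w i * (\<Sum>j\<in>S. (s i j * v j)\<^sup>2) - 3 * w i * (\<Sum>j\<in>S. g i j * v j)\<^sup>2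
      else - V * (\<Sum>j\<in>S. a i j * v j)\<^sup>2)"
      unfolding e using 1 2 3 by auto
  qed
  finally have "(c + 1 - ((real n) ^ 2 + 200 * real n ^ 4)) * X \<le> ip n v (app n P v)"
    unfolding quadratic_form X_def[symmetric] by (simp add: algebra_simps)
  moreover have "c + 1 - ((real n) ^ 2 + 200 * real n ^ 4) \<ge> 0"
  proof -
    have "(real n) ^ 2 \<le> real n ^ 4" "real n ^ 4 \<ge> 0" using pown[of 2 2] by simp_all
    then show ?thesis unfolding c_def by linarith
  qed
  ultimately show "ip n v (app n P v) \<ge> 0" using X by (meson mult_nonneg_nonneg order_trans)
qed

lemma entry_bound:
  assumes "j < n" "l < n"
  shows "\<bar>P j l - (if j = l then c else 0)\<bar> \<le> c"
proof (cases "j \<in> S \<and> l \<in> S")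
  case True
  have "\<bar>Qm j l\<bar> \<le> (\<Sum>i<2*n. w i / 14 + V * ((a i j)\<^sup>2 + (a i l)\<^sup>2) / 2)"
    unfolding Qm_def
  proof (rule order_trans[OF sum_abs], rule sum_mono)
    fix i assume "i \<in> {..<2*n}" then have i: "i < 2*n" by simp
    have gj: "\<bar>g i j\<bar> \<le> 1/64" "\<bar>g i l\<bar> \<le> 1/64" using g[OF i assms(1)] s[OF i assms(1)] g[OF i assms(2)] s[OF i assms(2)] by auto
    have "\<bar>3 * w i * g i j * g i l\<bar> = 3 * w i * (\<bar>g i j\<bar> * \<bar>g i l\<bar>)" using w0[OF i] by (simp add: abs_mult)
    also have "\<dots> \<le> 3 * w i * (1/64 * (1/64))" using gj w0[OF i] by (intro mult_left_mono mult_mono) auto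
    finally have 1: "\<bar>3 * w i * g i j * g i l\<bar> \<le> 3 * w i / 4096" by simp
    have "32 * w i * (s i j * s i j) \<le> 32 * w i * (1/16384)"
      using s2[OF i assms(1)] w0[OF i] by (intro mult_left_mono) (auto simp: power2_eq_square)
    then have 2: "\<bar>32 * w i * s i j * s i j\<bar> \<le> w i / 512" using w0[OF i] by (simp add: abs_mult mult.assoc)
    have "\<bar>a i j\<bar> * \<bar>a i l\<bar> \<le> ((a i j)\<^sup>2 + (a i l)\<^sup>2) / 2"
      using sum_squares_bound[of "\<bar>a i j\<bar>" "\<bar>a i l\<bar>"] by simp
    then have 3: "\<bar>V * a i j * a i l\<bar> \<le> V * (((a i j)\<^sup>2 + (a i l)\<^sup>2) / 2)"
      using V_nonneg by (simp add: abs_mult mult.assoc mult_left_mono)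
    have 4: "0 \<le> V * ((a i j)\<^sup>2 + (a i l)\<^sup>2) / 2" using V_nonneg by simp
    show "\<bar>if act i then if j = l then 32 * w i * s i j * s i j - 3 * w i * g i j * g i l else - (3 * w i * g i j * g i l)
           else - (V * a i j * a i l)\<bar> \<le> w i / 14 + V * ((a i j)\<^sup>2 + (a i l)\<^sup>2) / 2"
    proof (cases "act i")
      case True
      have "\<bar>32 * w i * s i j * s i j - 3 * w i * g i j * g i l\<bar> \<le> w i / 14" "\<bar>- (3 * w i * g i j * g i l)\<bar> \<le> w i / 14"
        using 1 2 w0[OF i] unfolding abs_le_iff by linarith+
      then have "\<bar>if act i then if j = l then 32 * w i * s i j * s i j - 3 * w i * g i j * g i l else - (3 * w i * g i j * g i l)
           else - (V * a i j * a i l)\<bar> \<le> w i / 14"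
        by (simp only: True if_True simp_thms split: if_split)
      then show ?thesis using 4 by linarith
    next
      case False
      then show ?thesis using 3 w0[OF i] by auto
    qed
  qed
  also have "\<dots> = (\<Sum>i<2*n. w i) / 14 + V * ((\<Sum>i<2*n. (a i j)\<^sup>2) + (\<Sum>i<2*n. (a i l)\<^sup>2)) / 2"
    by (simp add: sum.distrib sum_divide_distrib sum_distrib_left algebra_simps add_divide_distrib)
  also have "\<dots> \<le> (14 * real n) / 14 + V * (2 + 2) / 2"
    using wsum col[OF assms(1)] col[OF assms(2)] V_nonneg by (intro add_mono divide_right_mono mult_left_mono) auto
  finally have "\<bar>Qm j l\<bar> \<le> real n + 2 * V" by simp
  moreover have "1 + real n + 2 * V \<le> c"
  proof -
    have "real n ^ 3 \<le> real n ^ 4" "real n \<le> real n ^ 4" "1 \<le> real n ^ 4"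
      using pown[of 3 1] pown[of 1 3] pown[of 0 4] by simp_all
    then show ?thesis unfolding c_def V_def by linarith
  qed
  ultimately show ?thesis using True by (auto simp: P_def)
next
  case False
  then show ?thesis using c_pos by (auto simp: P_def)
qed

text \<open>In the kernel of the blocked rows the term with \<open>V\<close> vanishes. With
  \<open>D\<close> the diagonal of the energy term plus 1, the trace constant is
  \<open>12/32 = 3/8\<close>; the rank one terms then consume at most half of the form of
  \<open>D\<close>, and the other half is at least
  \<open>1/2 * \<bar>v\<bar>\<^sup>2\<close>.\<close>

lemma good_direction: "\<exists>v. ip n v v > 0 \<and> ip n v (app n P v) \<ge> (c + 1/2) * ip n v v"
proof -
  define Ac where "Ac = {i. i < 2*n \<and> act i}"
  define E where "E = {i. i < 2*n \<and> \<not> act i}"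
  define D where "D j = 32 * (\<Sum>i\<in>Ac. w i * (s i j)\<^sup>2) + 1" for j
  have fin: "finite Ac" "finite E" by (auto simp: Ac_def E_def)
  have w': "w i \<ge> 0" if "i \<in> Ac" for i using w0 that by (auto simp: Ac_def)
  have D1: "D j \<ge> 1" for j using w' by (auto simp: D_def intro!: sum_nonneg)
  have tr: "(\<Sum>i\<in>Ac. 3 * w i * (g i j)\<^sup>2) \<le> 3/8 * D j" if "j \<in> S" for j
  proof -
    have "(\<Sum>i\<in>Ac. 3 * w i * (g i j)\<^sup>2) \<le> (\<Sum>i\<in>Ac. 3 * w i * (4 * (s i j)\<^sup>2))"
      using that S w' by (intro sum_mono mult_left_mono g2) (auto simp: Ac_def)
    also have "\<dots> = 12 * (\<Sum>i\<in>Ac. w i * (s i j)\<^sup>2)" by (simp add: sum_distrib_left mult_ac)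
    also have "\<dots> \<le> 3/8 * D j" by (simp add: D_def)
    finally show ?thesis .
  qed
  have Dp: "D j > 0" for j using D1[of j] by linarith
  have W3: "3 * w i \<ge> 0" if "i \<in> Ac" for i using w'[OF that] by simp
  have cE: "10 * card E \<le> card S" using few by (simp add: E_def)
  obtain v where v: "\<exists>j\<in>S. v j \<noteq> 0" "\<And>j. j \<notin> S \<Longrightarrow> v j = 0" "\<And>e. e \<in> E \<Longrightarrow> (\<Sum>j\<in>S. a e j * v j) = 0"
     "(\<Sum>i\<in>Ac. 3 * w i * (\<Sum>j\<in>S. g i j * v j)\<^sup>2) \<le> 1/2 * (\<Sum>j\<in>S. D j * (v j)\<^sup>2)"
    using small_direction_in_kernel[where D = D and W = "\<lambda>i. 3 * w i" and g = g and b = a,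
        OF finS fin(2,1) S(2) cE Dp W3 tr] by blast
  define X where "X = (\<Sum>j\<in>S. (v j)\<^sup>2)"
  have vv: "ip n v v = X"
    unfolding ip_def X_def sum_S[symmetric] by (intro sum.cong refl) (auto simp: v(2) power2_eq_square)
  have X: "X > 0"
  proof -
    obtain j where "j \<in> S" "v j \<noteq> 0" using v(1) by auto
    then show ?thesis unfolding X_def using finS by (intro sum_pos2[of S j]) auto
  qed
  have "{..<2*n} \<inter> {i. act i} = Ac" "{..<2*n} \<inter> - {i. act i} = E" by (auto simp: Ac_def E_def)
  then have "(\<Sum>i<2*n. if act i then 32 * w i * (\<Sum>j\<in>S. (s i j * v j)\<^sup>2) - 3 * w i * (\<Sum>j\<in>S. g i j * v j)\<^sup>2
      else - V * (\<Sum>j\<in>S. a i j * v j)\<^sup>2) = (\<Sum>i\<in>Ac. 32 * w i * (\<Sum>j\<in>S. (s i j * v j)\<^sup>2) - 3 * w i * (\<Sum>j\<in>S. g i j * v j)\<^sup>2)"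
    by (subst sum.If_cases) (auto simp: v(3) intro!: sum.neutral)
  also have "\<dots> = (\<Sum>i\<in>Ac. 32 * w i * (\<Sum>j\<in>S. (s i j * v j)\<^sup>2)) - (\<Sum>i\<in>Ac. 3 * w i * (\<Sum>j\<in>S. g i j * v j)\<^sup>2)"
    by (rule sum_subtractf)
  also have "(\<Sum>i\<in>Ac. 32 * w i * (\<Sum>j\<in>S. (s i j * v j)\<^sup>2)) = (\<Sum>j\<in>S. (D j - 1) * (v j)\<^sup>2)"
    unfolding D_def by (simp add: sum_distrib_left sum_distrib_right power_mult_distrib mult_ac) (rule sum.swap)
  also have "\<dots> = (\<Sum>j\<in>S. D j * (v j)\<^sup>2) - X" by (simp add: X_def algebra_simps sum_subtractf)
  finally have "ip n v (app n P v) \<ge> (c + 1) * X + (\<Sum>j\<in>S. D j * (v j)\<^sup>2) / 2 - X"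
    unfolding quadratic_form X_def[symmetric] using v(4) by simp
  moreover have "(\<Sum>j\<in>S. D j * (v j)\<^sup>2) \<ge> X"
    unfolding X_def by (intro sum_mono) (metis D1 mult_right_mono mult_1 zero_le_power2)
  ultimately have "ip n v (app n P v) \<ge> (c + 1/2) * ip n v v" by (simp add: vv algebra_simps)
  with X vv show ?thesis by auto
qed

text \<open>Controls the rounding error: the form of \<open>P\<close> minus the shift, on vectors
  whose coordinates are at most 1.\<close>

lemma bilinear_bound:
  assumes "\<And>l. l < n \<Longrightarrow> \<bar>u l\<bar> \<le> 1" "\<And>l. l < n \<Longrightarrow> \<bar>v l\<bar> \<le> 1"
  shows "\<bar>ip n u (app n P v) - c * ip n u v\<bar> \<le> c * (real n)\<^sup>2"
proof -
  have "c * ip n u v = (\<Sum>j<n. \<Sum>l<n. u j * (if j = l then c else 0) * v l)"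
    unfolding ip_def sum_distrib_left
  proof (rule sum.cong[OF refl])
    fix j assume "j \<in> {..<n}"
    have "(\<Sum>l<n. u j * (if j = l then c else 0) * v l) = (\<Sum>l<n. if j = l then u j * c * v l else 0)"
      by (intro sum.cong) auto
    then show "c * (u j * v j) = (\<Sum>l<n. u j * (if j = l then c else 0) * v l)" using \<open>j \<in> {..<n}\<close> by simp
  qed
  moreover have "ip n u (app n P v) = (\<Sum>j<n. \<Sum>l<n. u j * P j l * v l)"
    by (simp add: ip_def app_def sum_distrib_left mult.assoc)
  ultimately have e: "ip n u (app n P v) - c * ip n u v = (\<Sum>j<n. \<Sum>l<n. u j * (P j l - (if j = l then c else 0)) * v l)"
    by (simp add: sum_subtractf[symmetric] algebra_simps)
  have "\<bar>ip n u (app n P v) - c * ip n u v\<bar> \<le> (\<Sum>j<n. \<Sum>l<n. c)"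
    unfolding e
  proof (rule order_trans[OF sum_abs], rule sum_mono, rule order_trans[OF sum_abs], rule sum_mono)
    fix j l assume jl: "j \<in> {..<n}" "l \<in> {..<n}"
    have "\<bar>u j\<bar> * \<bar>P j l - (if j = l then c else 0)\<bar> * \<bar>v l\<bar> \<le> 1 * c * 1"
      using jl assms entry_bound c_pos by (intro mult_mono) auto
    then show "\<bar>u j * (P j l - (if j = l then c else 0)) * v l\<bar> \<le> c" by (simp add: abs_mult)
  qed
  also have "\<dots> = c * (real n)\<^sup>2" by (simp add: power2_eq_square)
  finally show ?thesis .
qed

lemma power_vector:
  defines "Y j \<equiv> (app n P ^^ (4000 * n ^ 5)) (unitv j)"
  assumes js: "js < n" "\<And>j. j < n \<Longrightarrow> Y j j \<le> Y js js"
  shows "Y js js > 0" "\<And>l. l < n \<Longrightarrow> \<bar>Y js l\<bar> \<le> Y js js"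
    "ip n (Y js) (app n P (Y js)) \<ge> (c + 1/2 / 2) * ip n (Y js) (Y js)"
proof -
  obtain v where v: "ip n v v > 0" "ip n v (app n P v) \<ge> (c + 1/2) * ip n v v" using good_direction by auto
  have Ne: "4000 * n ^ 5 = 2 * (2000 * n ^ 5)" by simp
  \<comment> \<open>The exponent: a quarter of \<open>4000 * n ^ 5\<close> has to dominate
    \<open>n * (c + 1/4)\<close>, which is \<open>300 * n ^ 5\<close> up to a lower-order
    term.\<close>
  have h3: "real (2 * (2000 * n ^ 5)) * (1/2 / 2) \<ge> real n * (c + 1/2 / 2)"
  proof -
    have "real n * real n ^ 4 = real n ^ 5" by (simp add: eval_nat_numeral)
    moreover have "real n \<le> 2800 * real n ^ 5"
    proof -
      have "real n \<le> real n ^ 5" using pown[of 1 4] by simp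
      moreover have "real n ^ 5 \<ge> 0" by simp
      ultimately show ?thesis by linarith
    qed
    ultimately show ?thesis by (simp add: c_def distrib_left mult.left_commute[of "real n"])
  qed
  have h1: "(app n P ^^ (2 * (2000 * n ^ 5))) (unitv j) j \<le> (app n P ^^ (2 * (2000 * n ^ 5))) (unitv js) js" if "j < n" for j
    using js(2)[OF that] unfolding Y_def Ne .
  have h2: "(0::real) < 1/2" by simp
  note pm = power_method[where N = "2000 * n ^ 5" and c = c and \<gamma> = "1/2" and v = v and js = js, OF js(1) h1 v c_pos h2 h3]
  show "Y js js > 0" "\<And>l. l < n \<Longrightarrow> \<bar>Y js l\<bar> \<le> Y js js"
    "ip n (Y js) (app n P (Y js)) \<ge> (c + 1/2 / 2) * ip n (Y js) (Y js)"
    unfolding Y_def Ne by (rule pm; assumption)+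
qed

text \<open>With \<open>z\<close> the computed vector scaled to maximum norm 1,
  \<open>\<delta>\<close> is \<open>z / (2 * n)\<close> rounded to the grid. The form of
  \<open>P\<close> minus \<open>c\<close> is at least \<open>1/4\<close> at \<open>z\<close>, and
  the terms containing the rounding error consume at most half of that.\<close>

lemma descent_step:
  fixes \<delta> :: "nat \<Rightarrow> real"
  defines "Y j \<equiv> (app n P ^^ (4000 * n ^ 5)) (unitv j)"
  assumes js: "js < n" "\<And>j. j < n \<Longrightarrow> Y j j \<le> Y js js"
    and \<delta>: "\<And>l. l < n \<Longrightarrow> \<bar>16000 * real n ^ 7 * \<delta> l - 8000 * real n ^ 6 * Y js l / Y js js\<bar> \<le> 1"
    and \<delta>S: "\<And>l. l \<notin> S \<Longrightarrow> \<delta> l = 0"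
  shows "(\<Sum>i<2*n. if act i then 3 * w i * (\<Sum>j<n. g i j * \<delta> j)\<^sup>2 - 32 * w i * (\<Sum>j<n. (s i j * \<delta> j)\<^sup>2)
      else V * (\<Sum>j<n. a i j * \<delta> j)\<^sup>2) - (\<Sum>j<n. (\<delta> j)\<^sup>2) \<le> - 1 / (32 * (real n)\<^sup>2)"
proof -
  define m where "m = 8000 * real n ^ 6"
  define G where "G = 16000 * real n ^ 7"
  define z where "z l = Y js l / Y js js" for l
  define r where "r l = G * \<delta> l - m * z l" for l
  have js': "(app n P ^^ (4000 * n ^ 5)) (unitv j) j \<le> (app n P ^^ (4000 * n ^ 5)) (unitv js) js" if "j < n" for j
    using js(2)[OF that] unfolding Y_def .
  note pv = power_vector[of js, OF js(1) js']
  have y: "Y js js > 0" "\<And>l. l < n \<Longrightarrow> \<bar>Y js l\<bar> \<le> Y js js"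
    "ip n (Y js) (app n P (Y js)) \<ge> (c + 1/2 / 2) * ip n (Y js) (Y js)"
    unfolding Y_def by (rule pv; assumption)+
  have z1: "\<bar>z l\<bar> \<le> 1" if "l < n" for l using y(1) y(2)[OF that] by (simp add: z_def)
  have zz: "ip n z z = ip n (Y js) (Y js) / (Y js js)\<^sup>2"
    by (simp add: z_def ip_def power2_eq_square sum_divide_distrib)
  have zP: "ip n z (app n P z) = ip n (Y js) (app n P (Y js)) / (Y js js)\<^sup>2"
    by (simp add: z_def ip_def app_def power2_eq_square sum_divide_distrib[symmetric])
  have f1: "ip n z (app n P z) \<ge> (c + 1/4) * ip n z z"
    using divide_right_mono[OF y(3), of "(Y js js)\<^sup>2"] by (simp add: zz zP)
  have "ip n z z \<ge> z js * z js" unfolding ip_def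
    by (rule member_le_sum[of js "{..<n}" "\<lambda>j. z j * z j"]) (use js in auto)
  then have f2: "ip n z z \<ge> 1" using y(1) by (simp add: z_def)
  have r1: "\<bar>r l\<bar> \<le> 1" if "l < n" for l using \<delta>[OF that] by (simp add: r_def G_def m_def z_def)
  have Gd: "(\<lambda>l. G * \<delta> l) = (\<lambda>l. r l + m * z l)" by (auto simp: r_def)
  have c1: "ip n (T u) q = ip n q (T u)" for u q by (rule ip_commute)
  define f where "f u q = ip n u (T q) - c * ip n u q" for u q
  have f3: "ip n (\<lambda>l. G * \<delta> l) (T (\<lambda>l. G * \<delta> l)) - c * ip n (\<lambda>l. G * \<delta> l) (\<lambda>l. G * \<delta> l)
     = f r r + 2 * m * f r z + m\<^sup>2 * f z z"
    unfolding Gd app_add ip_add ip_add_right f_def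
    using ip_app[of z r] ip_commute[of n z r] c1[of z r] by (simp add: algebra_simps power2_eq_square)
  have m0: "m \<ge> 0" by (simp add: m_def)
  have "f r r \<ge> - (c * (real n)\<^sup>2)" "f r z \<ge> - (c * (real n)\<^sup>2)"
    using bilinear_bound[of r r] bilinear_bound[of r z] r1 z1 by (auto simp: f_def)
  moreover have "f z z \<ge> 1/4" using f1 f2 by (simp add: f_def algebra_simps)
  ultimately have "f r r + 2 * m * f r z + m\<^sup>2 * f z z \<ge> - (c * (real n)\<^sup>2) + 2 * m * (- (c * (real n)\<^sup>2)) + m\<^sup>2 * (1/4)"
    using m0 by (intro add_mono mult_left_mono) auto
  \<comment> \<open>This fixes the resolution: \<open>c * n\<^sup>2\<close> is
    \<open>3/80 * m\<close>, so the error terms stay below \<open>9/80 * m\<^sup>2\<close>.\<close>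
  moreover have "m\<^sup>2 / 8 \<ge> (2 * m + 1) * (c * (real n)\<^sup>2)"
  proof -
    have "c * (real n)\<^sup>2 = 300 * real n ^ 6" by (simp add: c_def power_add[symmetric])
    also have "\<dots> = 3 / 80 * m" by (simp add: m_def)
    finally have "(2 * m + 1) * (c * (real n)\<^sup>2) = (2 * m + 1) * (3 / 80 * m)" by simp
    moreover have "m \<ge> 1" using pown[of 0 6] by (simp add: m_def)
    then have "m * m \<ge> 1 * m" by (intro mult_right_mono) auto
    moreover have "(2 * m + 1) * (3 / 80 * m) = 3 / 40 * (m * m) + 3 / 80 * m" by (simp add: algebra_simps)
    ultimately show ?thesis using m0 unfolding power2_eq_square by linarith
  qed
  ultimately have main: "ip n (\<lambda>l. G * \<delta> l) (T (\<lambda>l. G * \<delta> l)) - c * ip n (\<lambda>l. G * \<delta> l) (\<lambda>l. G * \<delta> l) \<ge> m\<^sup>2 / 8"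
    unfolding f3 by (simp add: algebra_simps)
  have sc: "ip n (\<lambda>l. G * \<delta> l) (T (\<lambda>l. G * \<delta> l)) = G\<^sup>2 * ip n \<delta> (T \<delta>)"
    "ip n (\<lambda>l. G * \<delta> l) (\<lambda>l. G * \<delta> l) = G\<^sup>2 * ip n \<delta> \<delta>"
    by (simp_all add: ip_def app_def power2_eq_square sum_distrib_left mult_ac)
  have G: "G > 0" "m / G = 1 / (2 * real n)" using n1 by (auto simp: G_def m_def eval_nat_numeral)
  have "ip n \<delta> (T \<delta>) - c * ip n \<delta> \<delta> \<ge> m\<^sup>2 / 8 / G\<^sup>2"
    using main G(1) unfolding sc by (subst pos_divide_le_eq) (auto simp: algebra_simps)
  also have "m\<^sup>2 / 8 / G\<^sup>2 = (m / G)\<^sup>2 / 8" by (simp add: power_divide)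
  also have "\<dots> = 1 / (32 * (real n)\<^sup>2)" unfolding G(2) by (simp add: power2_eq_square)
  finally have fin: "ip n \<delta> (T \<delta>) - c * ip n \<delta> \<delta> \<ge> 1 / (32 * (real n)\<^sup>2)" .
  have eS: "(\<Sum>j\<in>S. h j) = (\<Sum>j<n. h j)" if "\<And>j. j \<notin> S \<Longrightarrow> h j = 0" for h :: "nat \<Rightarrow> real"
    unfolding sum_S[symmetric] by (intro sum.cong) (auto simp: that)
  have "ip n \<delta> \<delta> = (\<Sum>j<n. (\<delta> j)\<^sup>2)" by (simp add: ip_def power2_eq_square)
  moreover have "(\<Sum>i<2*n. if act i then 3 * w i * (\<Sum>j<n. g i j * \<delta> j)\<^sup>2 - 32 * w i * (\<Sum>j<n. (s i j * \<delta> j)\<^sup>2)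
      else V * (\<Sum>j<n. a i j * \<delta> j)\<^sup>2) = - (\<Sum>i<2*n. if act i then 32 * w i * (\<Sum>j<n. (s i j * \<delta> j)\<^sup>2) - 3 * w i * (\<Sum>j<n. g i j * \<delta> j)\<^sup>2
      else - V * (\<Sum>j<n. a i j * \<delta> j)\<^sup>2)"
    unfolding sum_negf[symmetric] by (intro sum.cong) auto
  moreover have "(\<Sum>j\<in>S. (\<delta> j)\<^sup>2) = (\<Sum>j<n. (\<delta> j)\<^sup>2)"
    "\<And>i. (\<Sum>j\<in>S. (s i j * \<delta> j)\<^sup>2) = (\<Sum>j<n. (s i j * \<delta> j)\<^sup>2)"
    "\<And>i. (\<Sum>j\<in>S. g i j * \<delta> j) = (\<Sum>j<n. g i j * \<delta> j)"
    "\<And>i. (\<Sum>j\<in>S. a i j * \<delta> j) = (\<Sum>j<n. a i j * \<delta> j)"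
    by (rule eS; simp add: \<delta>S)+
  ultimately show ?thesis using fin unfolding quadratic_form by (simp only: distrib_right; linarith)
qed

end

subsection \<open>The invariant of a row\<close>

text \<open>Take \<open>ln (1 + y) \<ge> y - 2 * y\<^sup>2\<close> at
  \<open>y = u + 3 * u\<^sup>2 - c\<close>: the summand \<open>3 * u\<^sup>2\<close> pays for
  \<open>2 * y\<^sup>2\<close> up to one further \<open>c\<close>.\<close>

lemma ln_update_bound:
  fixes u c :: real
  assumes u: "\<bar>u\<bar> \<le> 1/128" and c: "0 \<le> c" "c \<le> 1/2048"
  shows "0 < 1 + u + 3 * u\<^sup>2 - c" "1 + u + 3 * u\<^sup>2 - c \<le> 2" "ln (1 + u + 3 * u\<^sup>2 - c) \<ge> u - 2 * c"
proof -
  define p where "p = u + 3 * u\<^sup>2"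
  define y where "y = p - c"
  have u2: "u\<^sup>2 \<le> 1/16384" "0 \<le> u\<^sup>2" using power_mono[OF u, of 2] by (simp_all add: power2_eq_square)
  have yb: "\<bar>y\<bar> \<le> 1/2" using u u2 c unfolding y_def p_def by linarith
  have pe: "p\<^sup>2 = u\<^sup>2 * (1 + 3 * u)\<^sup>2" by (simp add: p_def power2_eq_square algebra_simps)
  have "\<bar>1 + 3 * u\<bar> \<le> 128/125" using u by (simp add: abs_le_iff)
  from power_mono[OF this, of 2] have "(1 + 3 * u)\<^sup>2 \<le> 21/20" by (simp add: power2_eq_square)
  then have p2: "p\<^sup>2 \<le> u\<^sup>2 * (21/20)" unfolding pe by (intro mult_left_mono) auto
  \<comment> \<open>Expanded, this square is the weighted Young inequality for the mixed term of
    \<open>(p - c)\<^sup>2\<close>.\<close>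
  have "0 \<le> (p + 10 * c)\<^sup>2" by simp
  then have "y\<^sup>2 \<le> 11/10 * p\<^sup>2 + 11 * c\<^sup>2" by (simp add: y_def power2_eq_square algebra_simps)
  moreover have "c\<^sup>2 \<le> c * (1/2048)" unfolding power2_eq_square using c by (intro mult_left_mono) auto
  ultimately have y2: "2 * y\<^sup>2 \<le> 3 * u\<^sup>2 + c" using p2 u2 c by linarith
  have "\<bar>ln (1 + y) - y\<bar> \<le> 2 * y\<^sup>2" using yb by (rule abs_ln_one_plus_x_minus_x_bound)
  then have "ln (1 + y) \<ge> u - 2 * c" using y2 unfolding y_def p_def by linarith
  moreover have e: "1 + y = 1 + u + 3 * u\<^sup>2 - c" by (simp add: y_def p_def)
  ultimately show "ln (1 + u + 3 * u\<^sup>2 - c) \<ge> u - 2 * c" by simp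
  show "0 < 1 + u + 3 * u\<^sup>2 - c" "1 + u + 3 * u\<^sup>2 - c \<le> 2" using yb unfolding e[symmetric] by auto
qed

text \<open>The \<open>2 n\<close> rows are those of the matrix and their negatives, and \<open>T\<close> is a guess for the discrepancy:
  \<open>lam\<close> is to be at least \<open>\<lambda>(A)\<close>, and \<open>spectral\<close> is its only consequence that is needed.\<close>

locale discrepancy =
  fixes n :: nat and a :: "nat \<Rightarrow> nat \<Rightarrow> real" and Lg T lam :: real
  assumes n: "n \<ge> 1"
    and col: "\<And>j. j < n \<Longrightarrow> (\<Sum>i<2*n. (a i j)\<^sup>2) \<le> 2"
    and Lg: "Lg \<ge> 1" "ln (real n) \<le> Lg" and T: "T \<ge> 1" and lam: "lam = T\<^sup>2 / Lg"
    and spectral: "\<And>S. S \<subseteq> {..<n} \<Longrightarrow>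
      (\<Sum>i<2*n. ((\<Sum>j\<in>S. (a i j)\<^sup>2) - real (card S) / real n * (\<Sum>j<n. (a i j)\<^sup>2))\<^sup>2) \<le> 2 * lam\<^sup>2 * real (card S)"
begin

text \<open>For \<open>n = 1\<close> the interval is empty, so no coordinate is ever alive.\<close>

definition alive :: "(nat \<Rightarrow> real) \<Rightarrow> nat set" where
  "alive x = {j. j < n \<and> - (real n - 1) < real n * x j \<and> real n * x j < real n - 1}"
text \<open>The summand 1 keeps the levels and logarithms of very short rows under control; over all
  rows it adds only \<open>2 * n\<close>.\<close>

definition R :: "nat \<Rightarrow> real" where "R i = 1 + (\<Sum>j<n. (a i j)\<^sup>2)"
definition energy :: "nat set \<Rightarrow> nat \<Rightarrow> real" where "energy S i = (\<Sum>j\<in>S. (a i j)\<^sup>2)"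
definition small_part :: "real \<Rightarrow> nat \<Rightarrow> nat \<Rightarrow> real" where
  "small_part \<alpha> i j = (if \<bar>128 * (\<alpha> * a i j)\<bar> \<le> 1 then \<alpha> * a i j else 0)"
definition dot :: "nat \<Rightarrow> (nat \<Rightarrow> real) \<Rightarrow> real" where "dot i v = (\<Sum>j<n. a i j * v j)"
text \<open>Its partial derivatives are the coefficients \<open>g i j\<close> of the walk. Being
  quadratic, it equals its second-order expansion along a step.\<close>

definition psi :: "real \<Rightarrow> nat \<Rightarrow> (nat \<Rightarrow> real) \<Rightarrow> real" where
  "psi \<alpha> i x = (\<Sum>j<n. small_part \<alpha> i j * x j - 64 * (small_part \<alpha> i j)\<^sup>2 * (x j)\<^sup>2)"
text \<open>Three times the constant 10240011 from \<open>level_gain\<close>, rounded up.\<close>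

definition K1 :: real where "K1 = 31000000"

lemma alive_sub: "alive x \<subseteq> {..<n}" by (auto simp: alive_def)
lemma fin_alive: "finite (alive x)" using alive_sub finite_subset by blast
lemma card_alive: "card (alive x) \<le> n" using card_mono[OF _ alive_sub] by fastforce
lemma R_ge: "R i \<ge> 1" by (simp add: R_def sum_nonneg)
lemma n1: "real n \<ge> 1" using n by simp
lemma lam_pos: "lam > 0" using Lg T by (simp add: lam)

text \<open>A step multiplies the weight of an active row by \<open>1 + u + 3 u\<^sup>2 - c\<close>, so by \<open>ln_update_bound\<close> the logarithm of
  the weight grows at least as much as \<open>psi\<close>; the quadratic term of \<open>psi\<close> pays for the loss \<open>2 c\<close>.
  Entries with \<open>\<alpha> \<bar>a i j\<bar> > 1/128\<close> are left out of \<open>psi\<close>: each of them contributes at most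
  \<open>2 \<bar>a i j\<bar> \<le> 256 \<alpha> (a i j)\<^sup>2\<close>.\<close>

lemma row_gain:
  assumes \<alpha>: "\<alpha> > 0" and x: "\<And>j. j < n \<Longrightarrow> \<bar>x j\<bar> \<le> 1" "\<And>j. j < n \<Longrightarrow> \<bar>x0 j\<bar> \<le> 1"
    and S: "S \<subseteq> {..<n}" "\<And>j. j < n \<Longrightarrow> j \<notin> S \<Longrightarrow> x j = x0 j"
    and \<Lambda>: "psi \<alpha> i x - psi \<alpha> i x0 \<le> \<Lambda>"
  shows "dot i x \<le> dot i x0 + \<Lambda> / \<alpha> + 256 * \<alpha> * energy S i"
proof -
  have "\<alpha> * (dot i x - dot i x0) = (\<Sum>j<n. \<alpha> * a i j * (x j - x0 j))"
    by (simp add: dot_def sum_subtractf[symmetric] sum_distrib_left algebra_simps)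
  also have "\<dots> \<le> (\<Sum>j<n. (small_part \<alpha> i j * x j - 64 * (small_part \<alpha> i j)\<^sup>2 * (x j)\<^sup>2) - (small_part \<alpha> i j * x0 j - 64 * (small_part \<alpha> i j)\<^sup>2 * (x0 j)\<^sup>2)
      + (if j \<in> S then 256 * \<alpha>\<^sup>2 * (a i j)\<^sup>2 else 0))"
  proof (rule sum_mono)
    fix j assume "j \<in> {..<n}" then have j: "j < n" by simp
    show "\<alpha> * a i j * (x j - x0 j) \<le> (small_part \<alpha> i j * x j - 64 * (small_part \<alpha> i j)\<^sup>2 * (x j)\<^sup>2) - (small_part \<alpha> i j * x0 j - 64 * (small_part \<alpha> i j)\<^sup>2 * (x0 j)\<^sup>2)
      + (if j \<in> S then 256 * \<alpha>\<^sup>2 * (a i j)\<^sup>2 else 0)"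
    proof (cases "j \<in> S")
      case False
      then show ?thesis using S(2)[OF j False] by simp
    next
      case True
      define b where "b = \<alpha> * a i j"
      have sq: "256 * \<alpha>\<^sup>2 * (a i j)\<^sup>2 = 256 * b\<^sup>2" by (simp add: b_def power_mult_distrib)
      show ?thesis
      proof (cases "\<bar>128 * b\<bar> \<le> 1")
        case True
        then have s: "small_part \<alpha> i j = b" by (simp add: small_part_def b_def)
        have "(x j)\<^sup>2 \<le> 1" "(x0 j)\<^sup>2 \<ge> 0" using x(1)[OF j] by (simp_all add: abs_square_le_1)
        then have "64 * b\<^sup>2 * (x j)\<^sup>2 \<le> 64 * b\<^sup>2 * 1" "64 * b\<^sup>2 * (x0 j)\<^sup>2 \<ge> 0"
          by (intro mult_left_mono) auto
        moreover have "b\<^sup>2 \<ge> 0" by simp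
        ultimately have "b * (x j - x0 j) \<le> (b * x j - 64 * b\<^sup>2 * (x j)\<^sup>2) - (b * x0 j - 64 * b\<^sup>2 * (x0 j)\<^sup>2) + 256 * b\<^sup>2"
          unfolding right_diff_distrib by linarith
        then show ?thesis using \<open>j \<in> S\<close> unfolding s sq b_def[symmetric] by simp
      next
        case False
        then have s: "small_part \<alpha> i j = 0" by (simp add: small_part_def b_def)
        have "\<bar>x j - x0 j\<bar> \<le> 2" using x(1)[OF j] x(2)[OF j] by linarith
        then have "\<bar>b\<bar> * \<bar>x j - x0 j\<bar> \<le> \<bar>b\<bar> * 2" by (intro mult_left_mono) auto
        moreover have "\<bar>b\<bar> * 1 \<le> \<bar>b\<bar> * \<bar>128 * b\<bar>" using False by (intro mult_left_mono) auto
        then have "\<bar>b\<bar> \<le> 128 * b\<^sup>2" by (simp add: abs_mult power2_eq_square)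
        moreover have "b * (x j - x0 j) \<le> \<bar>b\<bar> * \<bar>x j - x0 j\<bar>" by (metis abs_ge_self abs_mult)
        ultimately show ?thesis using \<open>j \<in> S\<close> unfolding s sq b_def[symmetric] by simp
      qed
    qed
  qed
  also have "\<dots> = psi \<alpha> i x - psi \<alpha> i x0 + (\<Sum>j<n. if j \<in> S then 256 * \<alpha>\<^sup>2 * (a i j)\<^sup>2 else 0)"
    by (simp only: psi_def sum.distrib sum_subtractf)
  also have "(\<Sum>j<n. if j \<in> S then 256 * \<alpha>\<^sup>2 * (a i j)\<^sup>2 else 0) = 256 * \<alpha>\<^sup>2 * energy S i"
    using S(1) by (subst sum.inter_restrict[symmetric]) (auto simp: Int_absorb1 energy_def sum_distrib_left)
  finally have "\<alpha> * (dot i x - dot i x0) \<le> \<Lambda> + 256 * \<alpha>\<^sup>2 * energy S i" using \<Lambda> by linarith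
  then have "dot i x - dot i x0 \<le> (\<Lambda> + 256 * \<alpha>\<^sup>2 * energy S i) / \<alpha>"
    using \<alpha> by (simp add: pos_le_divide_eq mult.commute)
  also have "\<dots> = \<Lambda> / \<alpha> + 256 * \<alpha> * energy S i" using \<alpha> by (simp add: add_divide_distrib power2_eq_square)
  finally show ?thesis by simp
qed

text \<open>At rate \<open>(3/2) ^ l\<close> the logarithm of the weight contributes the first
  summand, and the energy, of order \<open>2 ^ -l\<close>, the second. Since
  \<open>9/8 * 2/3 = 3/4\<close>, the linear factor \<open>11 + l\<close> fits into the ratio
  \<open>3/4\<close>.\<close>

lemma level_gain:
  fixes l :: nat
  shows "(11 + real l) * (2/3) ^ l + 10240000 * (3/4) ^ l \<le> K1 * (3/4) ^ l / 3"
proof -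
  have "1 + real l * (1/8) \<le> (1 + 1/8) ^ l" by (rule Bernoulli_inequality) simp
  then have "11 + real l \<le> 11 * (9/8) ^ l" by simp
  then have "(11 + real l) * (2/3) ^ l \<le> 11 * (9/8) ^ l * (2/3) ^ l" by (rule mult_right_mono) simp
  also have "\<dots> = 11 * (3/4) ^ l" by (simp add: power_mult_distrib[symmetric])
  finally have "(11 + real l) * (2/3) ^ l + 10240000 * (3/4) ^ l \<le> 10240011 * (3/4 :: real) ^ l" by simp
  also have "\<dots> \<le> K1 / 3 * (3/4) ^ l" by (intro mult_right_mono) (auto simp: K1_def)
  finally show ?thesis by simp
qed

text \<open>A row is blocked if \<open>st \<le> 1\<close>, active at the rate \<open>(3/2) ^ l\<close> if \<open>st = 2\<close>, and active at the final
  rate \<open>Lg / T\<close> if \<open>st > 2\<close>. The point \<open>x0\<close> is where its present rate was adopted, and \<open>p / (2 n)\<close>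
  collects the drifts \<open>d\<close> of earlier phases in which it was blocked. An active row is blocked with \<open>st = 1\<close> once
  \<open>1400 n \<le> w \<kappa>\<close>; the weights add up to at most \<open>14 n\<close>, so this happens to at most \<open>\<kappa> / 100\<close> rows.\<close>

definition level_inv where
  "level_inv p \<kappa> x l w i \<longleftrightarrow> l \<ge> 1 \<and> 0 < w \<and> w * \<kappa> \<le> 2800 * real n \<and>
    (\<exists>x0. (\<forall>j<n. \<bar>x0 j\<bar> \<le> 1) \<and> (\<forall>j<n. j \<notin> alive x0 \<longrightarrow> x j = x0 j) \<and> energy (alive x0) i * real n \<le> 20 * \<kappa> * R i \<and>
      dot i x0 \<le> K1 * (1 - (3/4) ^ (l - 1)) + real p / (2 * real n) \<and>
      ln w - ln (R i) \<ge> psi ((3/2) ^ l) i x - psi ((3/2) ^ l) i x0)"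

definition final_inv where
  "final_inv p x w i \<longleftrightarrow> 0 < w \<and>
    (\<exists>x0. (\<forall>j<n. \<bar>x0 j\<bar> \<le> 1) \<and> (\<forall>j<n. j \<notin> alive x0 \<longrightarrow> x j = x0 j) \<and> energy (alive x0) i \<le> 20 * lam \<and>
      dot i x0 \<le> K1 + real p / (2 * real n) \<and>
      ln w + real p * ln 2 \<ge> psi (Lg / T) i x - psi (Lg / T) i x0)"

text \<open>For \<open>l \<ge> 1\<close>, \<open>2 ^ l\<close> is comparable to
  \<open>n / (\<kappa> * R i)\<close> up to constants: \<open>l\<close> rises by one whenever
  \<open>\<kappa>\<close> is halved, so the product does not change. Level 0 is for rows with too
  large a norm, and for the start.\<close>

definition at_level :: "nat \<Rightarrow> real \<Rightarrow> nat \<Rightarrow> nat \<Rightarrow> bool" where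
  "at_level p \<kappa> i l \<longleftrightarrow> (l = 0 \<longrightarrow> p = 0 \<or> \<kappa> * R i > 1000 * real n) \<and>
     (l \<ge> 1 \<longrightarrow> real n \<le> 2 ^ (l - 1) * (\<kappa> * R i) \<and> 2 ^ (l - 1) * (\<kappa> * R i) \<le> 1000 * real n)"

definition row_inv where
  "row_inv p \<kappa> x \<alpha> w st d i \<longleftrightarrow>
     (st > (2::real) \<and> \<alpha> = Lg / T \<and> d = 0 \<and> final_inv p x w i) \<or>
     (\<exists>l. st \<le> 2 \<and> \<alpha> = (3/2) ^ l \<and> at_level p \<kappa> i l \<and>
       (st = 2 \<and> d = 0 \<and> level_inv p \<kappa> x l w i \<or>
        (st = 0 \<or> st = 1 \<and> 1400 * real n \<le> w * \<kappa>) \<and> w \<ge> 0 \<and> dot i x \<le> K1 * (1 - (3/4) ^ l) + real p / (2 * real n) + d))"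

text \<open>The gain at level \<open>l\<close> is at most \<open>K1 * (3/4) ^ l / 3\<close>, which
  is exactly the difference of the allowances for \<open>l\<close> and \<open>l - 1\<close>.\<close>

lemma level_inv_bound:
  assumes A: "level_inv p \<kappa> x l w i" and at_level: "at_level p \<kappa> i l" and \<kappa>: "\<kappa> > 0" and x: "\<And>j. j < n \<Longrightarrow> \<bar>x j\<bar> \<le> 1"
  shows "dot i x \<le> K1 * (1 - (3/4) ^ l) + real p / (2 * real n)"
proof -
  define \<alpha> where "\<alpha> = (3/2 :: real) ^ l"
  from A obtain x0 where l: "l \<ge> 1" and w: "0 < w" "w * \<kappa> \<le> 2800 * real n" and x0: "\<And>j. j < n \<Longrightarrow> \<bar>x0 j\<bar> \<le> 1"
    "\<And>j. j < n \<Longrightarrow> j \<notin> alive x0 \<Longrightarrow> x j = x0 j" "energy (alive x0) i * real n \<le> 20 * \<kappa> * R i"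
    "dot i x0 \<le> K1 * (1 - (3/4) ^ (l - 1)) + real p / (2 * real n)" "psi \<alpha> i x - psi \<alpha> i x0 \<le> ln w - ln (R i)"
    unfolding level_inv_def \<alpha>_def by auto
  have \<alpha>: "\<alpha> > 0" "\<alpha> \<ge> 1" by (auto simp: \<alpha>_def)
  have lv: "real n \<le> 2 ^ (l - 1) * (\<kappa> * R i)" "2 ^ (l - 1) * (\<kappa> * R i) \<le> 1000 * real n" using at_level l by (auto simp: at_level_def)
  have R: "R i > 0" using R_ge[of i] by simp
  have nn: "real n > 0" using n1 by simp
  have pl: "(2::real) ^ l = 2 * 2 ^ (l - 1)" using l by (cases l) auto
  \<comment> \<open>Being at level \<open>l\<close> turns the cap
    \<open>w * \<kappa> \<le> 2800 * n\<close> into a bound on \<open>w / R\<close>; 2800 is rounded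
    up to \<open>2 ^ 12\<close>, whence the constant \<open>11 = 12 - 1\<close> below.\<close>
  have "w / R i \<le> 2 ^ 12 * 2 ^ (l - 1)"
  proof -
    have "w * \<kappa> \<le> 2800 * (2 ^ (l - 1) * (\<kappa> * R i))" using w lv by linarith
    then have "w \<le> 2800 * (2 ^ (l - 1) * R i)" using \<kappa> by (simp add: mult_ac)
    then have "w / R i \<le> 2800 * 2 ^ (l - 1)" using R by (simp add: divide_le_eq mult_ac)
    also have "\<dots> \<le> 2 ^ 12 * 2 ^ (l - 1)" by (intro mult_right_mono) auto
    finally show ?thesis .
  qed
  then have "ln (w / R i) \<le> ln (2 ^ (12 + (l - 1)))" using w R by (subst ln_le_cancel_iff) (auto simp: power_add)
  also have "\<dots> = real (12 + (l - 1)) * ln 2" by (rule ln_realpow)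
  also have "\<dots> \<le> real (12 + (l - 1)) * 1" using ln_2_less_1 by (intro mult_left_mono) auto
  finally have lnw: "ln w - ln (R i) \<le> 11 + real l" using w R l by (simp add: ln_div)
  have e: "energy (alive x0) i \<le> 40000 / 2 ^ l"
  proof -
    have "energy (alive x0) i * real n * 2 ^ (l - 1) \<le> 20 * \<kappa> * R i * 2 ^ (l - 1)" using x0(3) by (rule mult_right_mono) simp
    also have "\<dots> \<le> 20 * (1000 * real n)" using lv(2) by (simp add: mult_ac)
    finally have "energy (alive x0) i * 2 ^ (l - 1) \<le> 20000" using nn by (simp add: mult_ac)
    then have "energy (alive x0) i \<le> 20000 / 2 ^ (l - 1)" by (simp add: pos_le_divide_eq)
    then show ?thesis unfolding pl by simp
  qed
  have "dot i x \<le> dot i x0 + (ln w - ln (R i)) / \<alpha> + 256 * \<alpha> * energy (alive x0) i"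
    by (rule row_gain[OF \<alpha>(1) x x0(1) alive_sub x0(2) x0(5)])
  also have "\<dots> \<le> dot i x0 + (11 + real l) / \<alpha> + 256 * \<alpha> * (40000 / 2 ^ l)"
    using lnw e \<alpha> by (intro add_mono mult_left_mono divide_right_mono) auto
  also have "(11 + real l) / \<alpha> = (11 + real l) * (2/3) ^ l" by (simp add: \<alpha>_def power_divide)
  also have "256 * \<alpha> * (40000 / 2 ^ l) = 10240000 * (3/4) ^ l"
  proof -
    have "(3/2 :: real) ^ l / 2 ^ l = (3/4) ^ l" by (simp add: power_divide[symmetric])
    then show ?thesis by (simp add: \<alpha>_def)
  qed
  also have "dot i x0 + (11 + real l) * (2/3) ^ l + 10240000 * (3/4) ^ l \<le> dot i x0 + K1 * (3/4) ^ l / 3"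
    using level_gain[of l] by simp
  also have "\<dots> \<le> K1 * (1 - (3/4) ^ (l - 1)) + real p / (2 * real n) + K1 * (3/4) ^ l / 3" using x0(4) by simp
  also have "K1 * (1 - (3/4) ^ (l - 1)) + real p / (2 * real n) + K1 * (3/4) ^ l / 3 = K1 * (1 - (3/4) ^ l) + real p / (2 * real n)"
    using l by (cases l) (auto simp: algebra_simps)
  finally show ?thesis .
qed

definition V where "V = 100 * real n ^ 3"

definition potential where
  "potential w st d = (\<Sum>i<2*n. w i + (if st i > (1::real) then 0 else V * (d i)\<^sup>2))"

text \<open>The count of rows of status 0 is required only for \<open>p \<ge> 1\<close>: at the
  start every row has status 0, but with \<open>\<kappa> = 2 * n\<close> no step can precede the
  first new phase. The condition \<open>\<kappa> \<ge> 1\<close> limits the number of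
  phases.\<close>

definition walk_inv where
  "walk_inv p \<kappa> x al w st d \<longleftrightarrow> \<kappa> = 2 * real n / 2 ^ p \<and> \<kappa> \<ge> 1 \<and> (\<forall>j<n. \<bar>x j\<bar> \<le> 1) \<and>
     (\<forall>i<2*n. row_inv p \<kappa> x (al i) (w i) (st i) (d i) i) \<and>
     potential w st d - (\<Sum>j<n. (x j)\<^sup>2) \<le> 13 * real n \<and>
     (p \<ge> 1 \<longrightarrow> 40 * real (card {i. i < 2*n \<and> st i = 0}) \<le> \<kappa>)"

lemma sum_x_le:
  assumes "\<And>j. j < n \<Longrightarrow> \<bar>x j\<bar> \<le> 1" shows "(\<Sum>j<n. (x j)\<^sup>2) \<le> real n"
proof -
  have "(\<Sum>j<n. (x j)\<^sup>2) \<le> (\<Sum>j<n. 1)" by (intro sum_mono) (use assms in \<open>auto simp: abs_square_le_1\<close>)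
  then show ?thesis by simp
qed

lemma row_inv_w_nonneg: "row_inv p \<kappa> x \<alpha> w st d i \<Longrightarrow> w \<ge> 0"
  by (auto simp: row_inv_def level_inv_def final_inv_def)

lemma row_inv_st: "row_inv p \<kappa> x \<alpha> w st d i \<Longrightarrow> st > 2 \<or> st = 0 \<or> st = 1 \<or> st = 2"
  by (auto simp: row_inv_def)

lemma walk_inv_facts:
  assumes "walk_inv p \<kappa> x al w st d"
  shows "(\<Sum>i<2*n. w i) \<le> 14 * real n" "\<And>i. i < 2*n \<Longrightarrow> w i \<ge> 0"
    "\<And>i. i < 2*n \<Longrightarrow> \<bar>d i\<bar> \<le> 1 / (2 * real n)" "potential w st d \<le> 14 * real n" "p \<le> 2 * n" "(2::real) ^ p \<le> 2 * real n"
    "\<And>i. i < 2*n \<Longrightarrow> w i \<le> 14 * real n"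
proof -
  have V0: "V \<ge> 0" by (simp add: V_def)
  show w: "w i \<ge> 0" if "i < 2*n" for i using assms that row_inv_w_nonneg by (auto simp: walk_inv_def)
  show potential: "potential w st d \<le> 14 * real n" using assms sum_x_le[of x] by (auto simp: walk_inv_def)
  have "(\<Sum>i<2*n. w i) \<le> potential w st d" unfolding potential_def by (intro sum_mono) (simp add: V0)
  then show ws: "(\<Sum>i<2*n. w i) \<le> 14 * real n" using potential by simp
  show "w i \<le> 14 * real n" if "i < 2*n" for i
    using member_le_sum[of i "{..<2*n}" w] w that ws by auto
  have k: "2 * real n / 2 ^ p \<ge> 1" using assms by (auto simp: walk_inv_def)
  then show p2: "(2::real) ^ p \<le> 2 * real n" by (simp add: pos_le_divide_eq)
  have "real p < 2 ^ p" by (rule of_nat_less_two_power)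
  then have "real p \<le> real (2 * n)" using p2 by linarith
  then show "p \<le> 2 * n" by (subst (asm) of_nat_le_iff)
  show "\<bar>d i\<bar> \<le> 1 / (2 * real n)" if i: "i < 2*n" for i
  proof (cases "st i > 1")
    case True
    then have "d i = 0" using assms i by (auto simp: walk_inv_def row_inv_def)
    then show ?thesis by simp
  next
    case False
    have "V * (d i)\<^sup>2 = (if st i > 1 then 0 else V * (d i)\<^sup>2)" using False by simp
    also have "\<dots> \<le> w i + (if st i > 1 then 0 else V * (d i)\<^sup>2)" using w[OF i] by simp
    also have "\<dots> \<le> potential w st d" unfolding potential_def
      by (rule member_le_sum[of i "{..<2*n}" "\<lambda>i. w i + (if st i > 1 then 0 else V * (d i)\<^sup>2)"]) (use i w V0 in auto)
    \<comment> \<open>The choice of \<open>V\<close>: since \<open>14/100 \<le> 1/4\<close>, the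
      drift in one phase is at most \<open>1 / (2 * n)\<close>, and over at most
      \<open>2 * n\<close> phases it adds up to at most 1.\<close>
    finally have "100 * real n ^ 3 * (d i)\<^sup>2 \<le> 14 * real n" using potential by (simp add: V_def)
    then have "real n * (100 * (real n * d i)\<^sup>2) \<le> real n * 14" by (simp add: power2_eq_square eval_nat_numeral mult_ac)
    then have "100 * (real n * d i)\<^sup>2 \<le> 14" using n1 by simp
    then have "(real n * d i)\<^sup>2 \<le> 1/4" by linarith
    then have "\<bar>real n * d i\<bar>\<^sup>2 \<le> (1/2)\<^sup>2" by (simp only: power2_abs) (simp add: power2_eq_square)
    then have "\<bar>real n * d i\<bar> \<le> 1/2" by (rule power2_le_imp_le) simp
    then show ?thesis using n1 by (simp add: abs_mult pos_le_divide_eq mult_ac)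
  qed
qed

text \<open>At the final rate the logarithms are at most \<open>7 * Lg\<close> and the energy is at
  most \<open>20 * lam\<close>. Since \<open>lam = T\<^sup>2 / Lg\<close>, the rate
  \<open>Lg / T\<close> makes both contributions multiples of \<open>T\<close>.\<close>

lemma walk_inv_bound:
  assumes "walk_inv p \<kappa> x al w st d" "i < 2*n"
  shows "dot i x \<le> (K1 + 6000) * T"
proof -
  note f = walk_inv_facts[OF assms(1)]
  have r: "row_inv p \<kappa> x (al i) (w i) (st i) (d i) i" and x: "\<And>j. j < n \<Longrightarrow> \<bar>x j\<bar> \<le> 1" and \<kappa>: "\<kappa> > 0"
    using assms by (auto simp: walk_inv_def)
  have "real p \<le> 2 * real n" using f(5) by linarith
  then have p1: "real p / (2 * real n) \<le> 1" using n1 by simp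
  have "1 / (2 * real n) \<le> 1" using n1 by simp
  then have d1: "d i \<le> 1" using f(3)[OF assms(2)] by linarith
  have K0: "K1 * (1 - (3/4) ^ l) \<le> K1" for l :: nat
    using mult_left_mono[of "1 - (3/4 :: real) ^ l" 1 K1] by (simp add: K1_def)
  have TT: "(K1 + 6000) * T \<ge> K1 + 5990 + 10 * T" "T \<ge> 1"
  proof -
    have "(K1 + 5990) * 1 \<le> (K1 + 5990) * T" using T by (intro mult_left_mono) (auto simp: K1_def)
    then show "(K1 + 6000) * T \<ge> K1 + 5990 + 10 * T" by (simp add: algebra_simps)
  qed (rule T)
  show ?thesis
  proof (cases "st i > 2")
    case False
    then obtain l where l: "al i = (3/2) ^ l" "at_level p \<kappa> i l"
      "st i = 2 \<and> d i = 0 \<and> level_inv p \<kappa> x l (w i) i \<or> dot i x \<le> K1 * (1 - (3/4) ^ l) + real p / (2 * real n) + d i"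
      using r unfolding row_inv_def by auto
    from l(3) have "dot i x \<le> K1 * (1 - (3/4) ^ l) + real p / (2 * real n) + d i"
      using level_inv_bound[OF _ l(2) \<kappa> x] by auto
    then show ?thesis using p1 d1 K0[of l] TT by linarith
  next
    case True
    then have B: "final_inv p x (w i) i" using r by (auto simp: row_inv_def)
    then obtain x0 where w: "0 < w i" and x0: "\<And>j. j < n \<Longrightarrow> \<bar>x0 j\<bar> \<le> 1" "\<And>j. j < n \<Longrightarrow> j \<notin> alive x0 \<Longrightarrow> x j = x0 j"
      "energy (alive x0) i \<le> 20 * lam" "dot i x0 \<le> K1 + real p / (2 * real n)"
      "psi (Lg / T) i x - psi (Lg / T) i x0 \<le> ln (w i) + real p * ln 2" by (auto simp: final_inv_def)
    have \<alpha>: "Lg / T > 0" using Lg T by simp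
    have "ln (w i) \<le> ln (2 ^ 4 * real n)" using w f(7)[OF assms(2)] n1 by (subst ln_le_cancel_iff) auto
    also have "\<dots> = real 4 * ln 2 + ln (real n)"
      using n1 ln_realpow[of 2 4] by (subst ln_mult_pos) (simp_all del: ln_realpow power_numeral_reduce)
    finally have 1: "ln (w i) \<le> 4 + Lg" using ln_2_less_1 Lg by linarith
    have "real p * ln 2 = ln (2 ^ p)" by (simp add: ln_realpow)
    also have "\<dots> \<le> ln (2 * real n)" using f(6) n1 by (subst ln_le_cancel_iff) auto
    also have "\<dots> = ln 2 + ln (real n)" using n1 by (subst ln_mult_pos) auto
    finally have 2: "real p * ln 2 \<le> 1 + Lg" using ln_2_less_1 Lg by linarith
    have "dot i x \<le> dot i x0 + (ln (w i) + real p * ln 2) / (Lg / T) + 256 * (Lg / T) * energy (alive x0) i"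
      by (rule row_gain[OF \<alpha> x x0(1) alive_sub x0(2) x0(5)])
    also have "\<dots> \<le> (K1 + 1) + (7 * Lg) / (Lg / T) + 256 * (Lg / T) * (20 * lam)"
      using 1 2 Lg \<alpha> x0(3,4) p1 by (intro add_mono divide_right_mono mult_left_mono) auto
    also have "(7 * Lg) / (Lg / T) = 7 * T" using Lg T by simp
    also have "256 * (Lg / T) * (20 * lam) = 5120 * T" using Lg T by (simp add: lam power2_eq_square)
    also have "(K1 + 1) + 7 * T + 5120 * T \<le> (K1 + 6000) * T"
    proof -
      have "(K1 + 1) * 1 \<le> (K1 + 1) * T" using T by (intro mult_left_mono) (auto simp: K1_def)
      then show ?thesis using T by (simp add: algebra_simps)
    qed
    finally show ?thesis .
  qed
qed

end

subsection \<open>Preservation of the invariant\<close>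

lemma markov_card:
  fixes f :: "'b \<Rightarrow> real"
  assumes "finite A" "Z \<subseteq> A" "\<And>i. i \<in> A \<Longrightarrow> f i \<ge> 0" "\<And>i. i \<in> Z \<Longrightarrow> f i \<ge> t" "(\<Sum>i\<in>A. f i) \<le> M"
  shows "real (card Z) * t \<le> M"
proof -
  have "real (card Z) * t = (\<Sum>i\<in>Z. t)" by simp
  also have "\<dots> \<le> (\<Sum>i\<in>Z. f i)" by (intro sum_mono assms)
  also have "\<dots> \<le> (\<Sum>i\<in>A. f i)" by (rule sum_mono2) (use assms in auto)
  finally show ?thesis using assms(5) by simp
qed

context discrepancy
begin

lemma sum_R: "(\<Sum>i<2*n. R i) \<le> 4 * real n"
proof -
  have "(\<Sum>i<2*n. \<Sum>j<n. (a i j)\<^sup>2) = (\<Sum>j<n. \<Sum>i<2*n. (a i j)\<^sup>2)" by (rule sum.swap)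
  also have "\<dots> \<le> (\<Sum>j<n. 2)" by (intro sum_mono col) auto
  finally show ?thesis by (simp add: R_def sum.distrib)
qed

text \<open>Two kinds of exceptions. As the \<open>R i\<close> sum to at most \<open>4 * n\<close>,
  at most \<open>\<kappa> / 250\<close> rows have \<open>R i > 1000 * n / \<kappa>\<close>. In the
  remaining ones the energy exceeds \<open>20 * lam\<close> and 20 times its proportional share, so
  it deviates from that share by at least \<open>19 * lam\<close>; by \<open>spectral\<close> there
  are at most \<open>2/361 * \<kappa>\<close> of these.\<close>

lemma blocked_at_start:
  assumes \<kappa>: "\<kappa> > 0" "real (card (alive x)) \<le> \<kappa>"
  shows "40 * real (card {i. i < 2*n \<and> energy (alive x) i * Lg > 20 * T\<^sup>2 \<and>
    (\<kappa> * R i > 1000 * real n \<or> energy (alive x) i * real n > 20 * (\<kappa> * R i))}) \<le> \<kappa>"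
proof -
  define k where "k = real (card (alive x))"
  have nn: "real n > 0" using n1 by simp
  define Z1 where "Z1 = {i. i < 2*n \<and> \<kappa> * R i > 1000 * real n}"
  define Z2 where "Z2 = {i. i < 2*n \<and> energy (alive x) i * Lg > 20 * T\<^sup>2 \<and> energy (alive x) i * real n > 20 * (\<kappa> * R i)}"
  have R0: "R i \<ge> 0" for i using R_ge[of i] by simp
  have "real (card Z1) * (1000 * real n) \<le> \<kappa> * (4 * real n)"
  proof (rule markov_card[of "{..<2*n}" _ "\<lambda>i. \<kappa> * R i"])
    show "(\<Sum>i<2*n. \<kappa> * R i) \<le> \<kappa> * (4 * real n)"
      unfolding sum_distrib_left[symmetric] using sum_R \<kappa> by (intro mult_left_mono) auto
  qed (use \<kappa> R0 in \<open>auto simp: Z1_def\<close>)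
  then have c1: "real (card Z1) * 250 \<le> \<kappa>" using nn by simp
  have "real (card Z2) * (19 * lam)\<^sup>2 \<le> 2 * lam\<^sup>2 * k"
  proof (rule markov_card[of "{..<2*n}" _ "\<lambda>i. (energy (alive x) i - k / real n * (\<Sum>j<n. (a i j)\<^sup>2))\<^sup>2"])
    show "(\<Sum>i<2*n. (energy (alive x) i - k / real n * (\<Sum>j<n. (a i j)\<^sup>2))\<^sup>2) \<le> 2 * lam\<^sup>2 * k"
      unfolding k_def energy_def by (rule spectral[OF alive_sub])
    fix i assume "i \<in> Z2"
    then have e: "energy (alive x) i * Lg > 20 * T\<^sup>2" "energy (alive x) i * real n > 20 * (\<kappa> * R i)" by (auto simp: Z2_def)
    have e1: "energy (alive x) i > 20 * lam" using e(1) Lg by (simp add: lam field_simps)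
    have "k * (\<Sum>j<n. (a i j)\<^sup>2) \<le> \<kappa> * R i"
      using \<kappa> by (intro mult_mono) (auto simp: k_def R_def sum_nonneg)
    also have "\<dots> \<le> energy (alive x) i * real n / 20" using e(2) by simp
    finally have "k / real n * (\<Sum>j<n. (a i j)\<^sup>2) \<le> energy (alive x) i / 20" using nn by (simp add: field_simps)
    then have "energy (alive x) i - k / real n * (\<Sum>j<n. (a i j)\<^sup>2) \<ge> 19 * lam" using e1 by linarith
    then show "(energy (alive x) i - k / real n * (\<Sum>j<n. (a i j)\<^sup>2))\<^sup>2 \<ge> (19 * lam)\<^sup>2"
      using lam_pos by (intro power_mono) auto
  qed (auto simp: Z2_def)
  then have "lam\<^sup>2 * (real (card Z2) * 361) \<le> lam\<^sup>2 * (2 * k)" by (simp add: power2_eq_square mult_ac)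
  then have c2: "real (card Z2) * 361 \<le> 2 * k" using lam_pos by simp
  have "card {i. i < 2*n \<and> energy (alive x) i * Lg > 20 * T\<^sup>2 \<and>
    (\<kappa> * R i > 1000 * real n \<or> energy (alive x) i * real n > 20 * (\<kappa> * R i))} \<le> card (Z1 \<union> Z2)"
    by (rule card_mono) (auto simp: Z1_def Z2_def)
  also have "\<dots> \<le> card Z1 + card Z2" by (rule card_Un_le)
  finally have h: "card {i. i < 2*n \<and> energy (alive x) i * Lg > 20 * T\<^sup>2 \<and>
    (\<kappa> * R i > 1000 * real n \<or> energy (alive x) i * real n > 20 * (\<kappa> * R i))} \<le> card Z1 + card Z2" .
  have "real (card {i. i < 2*n \<and> energy (alive x) i * Lg > 20 * T\<^sup>2 \<and>
    (\<kappa> * R i > 1000 * real n \<or> energy (alive x) i * real n > 20 * (\<kappa> * R i))}) \<le> real (card Z1) + real (card Z2)"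
    using of_nat_mono[OF h, where 'a = real] by (simp only: of_nat_add)
  then show ?thesis using c1 c2 \<kappa> unfolding k_def by linarith
qed

text \<open>Weights restart at 1 or \<open>R i\<close>, except at the final rate, where they are
  halved and the loss \<open>ln 2\<close> is booked in \<open>p * ln 2\<close>. So the potential
  becomes at most \<open>14 * n / 2 + 4 * n\<close>. The old drifts move into the summand
  \<open>p / (2 * n)\<close>.\<close>

lemma newphase_inv:
  assumes inv: "walk_inv p \<kappa> x al w st d" and ne: "alive x \<noteq> {}" and k: "2 * real (card (alive x)) \<le> \<kappa>"
    and \<kappa>': "\<kappa>' = \<kappa> / 2"
    and st': "\<And>i. i < 2*n \<Longrightarrow> st' i = (if st i > 2 then 4 else if energy (alive x) i * Lg \<le> 20 * T\<^sup>2 then 3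
        else if \<kappa>' * R i \<le> 1000 * real n \<and> energy (alive x) i * real n \<le> 20 * (\<kappa>' * R i) then 2 else 0)"
    and al': "\<And>i. i < 2*n \<Longrightarrow> al' i = (if st' i = 3 then Lg / T else if st' i = 4 then al i
        else if \<kappa>' * R i \<le> 1000 * real n then al i * (3/2) else al i)"
    and w': "\<And>i. i < 2*n \<Longrightarrow> w' i = (if st' i = 4 then w i / 2 else if st' i = 3 then 1 else if st' i = 2 then R i else 0)"
    and d': "\<And>i. i < 2*n \<Longrightarrow> d' i = 0"
  shows "walk_inv (Suc p) \<kappa>' x al' w' st' d'"
proof -
  note f = walk_inv_facts[OF inv]
  have nn: "real n > 0" using n1 by simp
  have x: "\<And>j. j < n \<Longrightarrow> \<bar>x j\<bar> \<le> 1" and \<kappa>: "\<kappa> = 2 * real n / 2 ^ p" using inv by (auto simp: walk_inv_def)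
  have "card (alive x) \<ge> 1" using ne fin_alive by (simp add: Suc_le_eq card_gt_0_iff)
  then have \<kappa>1: "\<kappa>' \<ge> 1" "\<kappa> > 0" using k \<kappa>' by auto
  have dl: "\<bar>d i\<bar> \<le> 1 / (2 * real n)" if "i < 2*n" for i using f(3)[OF that] .
  have psum: "real (Suc p) / (2 * real n) = real p / (2 * real n) + 1 / (2 * real n)" by (simp add: add_divide_distrib)
  have rows: "row_inv (Suc p) \<kappa>' x (al' i) (w' i) (st' i) (d' i) i" if i: "i < 2*n" for i
  proof (cases "st i > 2")
    case True
    then have s4: "st' i = 4" using st' i by simp
    have "row_inv p \<kappa> x (al i) (w i) (st i) (d i) i" using inv i by (auto simp: walk_inv_def)
    then have B: "final_inv p x (w i) i" "al i = Lg / T" using True by (auto simp: row_inv_def)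
    from B(1) obtain x0 where x0: "0 < w i" "\<forall>j<n. \<bar>x0 j\<bar> \<le> 1" "\<forall>j<n. j \<notin> alive x0 \<longrightarrow> x j = x0 j"
      "energy (alive x0) i \<le> 20 * lam" "dot i x0 \<le> K1 + real p / (2 * real n)"
      "ln (w i) + real p * ln 2 \<ge> psi (Lg / T) i x - psi (Lg / T) i x0" by (auto simp: final_inv_def)
    have "ln (w i / 2) + real (Suc p) * ln 2 = ln (w i) + real p * ln 2"
      using x0(1) by (simp add: ln_div algebra_simps)
    moreover have hs: "0 \<le> 1 / (2 * real n)" by simp
    have "dot i x0 \<le> K1 + real (Suc p) / (2 * real n)" using x0(5) hs unfolding psum by linarith
    ultimately have "final_inv (Suc p) x (w i / 2) i" unfolding final_inv_def using x0 by (intro conjI exI[of _ x0]) auto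
    moreover have e: "w' i = w i / 2" "al' i = Lg / T" "d' i = 0" using s4 al'[OF i] w'[OF i] d'[OF i] B(2) by simp_all
    ultimately show ?thesis unfolding e s4 by (simp add: row_inv_def)
  next
    case False
    have "row_inv p \<kappa> x (al i) (w i) (st i) (d i) i" using inv i by (auto simp: walk_inv_def)
    then obtain l where l: "al i = (3/2) ^ l" "at_level p \<kappa> i l" and
      c: "st i = 2 \<and> d i = 0 \<and> level_inv p \<kappa> x l (w i) i \<or> dot i x \<le> K1 * (1 - (3/4) ^ l) + real p / (2 * real n) + d i"
      using False unfolding row_inv_def by fastforce
    have dx: "dot i x \<le> K1 * (1 - (3/4) ^ l) + real (Suc p) / (2 * real n)"
    proof -
      have "dot i x \<le> K1 * (1 - (3/4) ^ l) + real p / (2 * real n) + d i"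
        using c level_inv_bound[OF _ l(2) \<kappa>1(2) x] by auto
      then show ?thesis using dl[OF i] unfolding psum by linarith
    qed
    have Kl: "K1 * (1 - (3/4 :: real) ^ l) \<le> K1 * (1 - (3/4) ^ Suc l)" "K1 * (1 - (3/4 :: real) ^ l) \<le> K1"
    proof -
      have "(3/4 :: real) ^ Suc l \<le> (3/4) ^ l" by (rule power_decreasing) auto
      then show "K1 * (1 - (3/4 :: real) ^ l) \<le> K1 * (1 - (3/4) ^ Suc l)" by (intro mult_left_mono) (auto simp: K1_def)
      have "K1 * (1 - (3/4 :: real) ^ l) \<le> K1 * 1" by (intro mult_left_mono) (auto simp: K1_def)
      then show "K1 * (1 - (3/4 :: real) ^ l) \<le> K1" by simp
    qed
    show ?thesis
    proof (cases "energy (alive x) i * Lg \<le> 20 * T\<^sup>2")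
      case True
      then have s3: "st' i = 3" using False st' i by simp
      have "energy (alive x) i \<le> 20 * lam" using True Lg by (simp add: lam field_simps)
      then have "final_inv (Suc p) x 1 i" unfolding final_inv_def using x dx Kl(2) by (intro conjI exI[of _ x]) auto
      then show ?thesis using s3 al'[OF i] w'[OF i] d'[OF i] by (simp add: row_inv_def)
    next
      case e: False
      define l' where "l' = (if \<kappa>' * R i \<le> 1000 * real n then Suc l else l)"
      have R1: "R i \<ge> 1" by (rule R_ge)
      have lev': "at_level (Suc p) \<kappa>' i l'"
      proof (cases "\<kappa>' * R i \<le> 1000 * real n")
        case True
        have "real n \<le> 2 ^ l * (\<kappa>' * R i) \<and> 2 ^ l * (\<kappa>' * R i) \<le> 1000 * real n"
        proof (cases l)
          case 0
          \<comment> \<open>A row leaves level 0 either in the first phase, where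
            \<open>\<kappa>' = n\<close> and \<open>R i \<ge> 1\<close>, or when halving brings
            \<open>\<kappa> * R i\<close> from above \<open>1000 * n\<close> down to a value that
            still exceeds \<open>500 * n\<close>.\<close>
          then have "p = 0 \<or> \<kappa> * R i > 1000 * real n" using l(2) by (simp add: at_level_def)
          then have "real n \<le> \<kappa>' * R i"
          proof
            assume "p = 0"
            then have "\<kappa>' = real n" using \<kappa> \<kappa>' by simp
            then show ?thesis using R1 nn by (simp add: mult_le_cancel_left1)
          next
            assume "\<kappa> * R i > 1000 * real n"
            moreover have "\<kappa>' * R i = \<kappa> * R i / 2" using \<kappa>' by simp
            ultimately show ?thesis using nn by linarith
          qed
          then show ?thesis using 0 True by simp
        next
          case (Suc m)
          have e: "2 ^ Suc m * (\<kappa>' * R i) = 2 ^ m * (\<kappa> * R i)" using \<kappa>' by simp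
          show ?thesis unfolding Suc e using l(2) Suc by (simp add: at_level_def)
        qed
        then show ?thesis using True by (simp add: at_level_def l'_def)
      next
        case False
        have "l = 0"
        proof (rule ccontr)
          assume "l \<noteq> 0"
          then have "2 ^ (l - 1) * (\<kappa> * R i) \<le> 1000 * real n" using l(2) by (simp add: at_level_def)
          moreover have "1 * (\<kappa> * R i) \<le> 2 ^ (l - 1) * (\<kappa> * R i)" using \<kappa>1 R1 by (intro mult_right_mono) auto
          ultimately have "\<kappa> * R i \<le> 1000 * real n" by simp
          moreover have "\<kappa>' * R i \<le> \<kappa> * R i" using \<kappa>1 \<kappa>' R1 by (intro mult_right_mono) auto
          ultimately show False using False by simp
        qed
        then show ?thesis using False by (simp add: at_level_def l'_def)
      qed
      have al3: "st' i \<noteq> 3" "st' i \<noteq> 4" "st' i \<le> 2" using False e st'[OF i] by auto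
      have al2: "al' i = (3/2) ^ l'" using al'[OF i] al3 l(1) by (simp add: l'_def)
      show ?thesis
      proof (cases "\<kappa>' * R i \<le> 1000 * real n \<and> energy (alive x) i * real n \<le> 20 * (\<kappa>' * R i)")
        case True
        then have s2: "st' i = 2" using False e st' i by simp
        have l'S: "l' = Suc l" using True by (simp add: l'_def)
        have "real n \<le> 2 ^ l * (\<kappa>' * R i)" "2 ^ l * (\<kappa>' * R i) \<le> 1000 * real n" using lev' l'S by (auto simp: at_level_def)
        moreover have "R i * \<kappa>' \<le> 2800 * real n" using True nn by (simp add: mult.commute)
        ultimately have "level_inv (Suc p) \<kappa>' x l' (R i) i"
          unfolding level_inv_def using x dx True R1 l'S by (intro conjI exI[of _ x]) (auto simp: mult.assoc)
        then show ?thesis using s2 al2 lev' w'[OF i] d'[OF i] unfolding row_inv_def by auto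
      next
        case nA: False
        then have s0: "st' i = 0" using False e st' i by auto
        have "dot i x \<le> K1 * (1 - (3/4) ^ l') + real (Suc p) / (2 * real n)"
          using dx Kl(1) by (auto simp: l'_def)
        then show ?thesis using s0 al2 lev' w'[OF i] d'[OF i] unfolding row_inv_def by auto
      qed
    qed
  qed
  have potential: "potential w' st' d' \<le> 13 * real n"
  proof -
    have "potential w' st' d' = (\<Sum>i<2*n. w' i)" unfolding potential_def by (intro sum.cong refl) (auto simp: d')
    also have "\<dots> \<le> (\<Sum>i<2*n. w i / 2 + R i)"
    proof (rule sum_mono)
      fix i assume "i \<in> {..<2*n}"
      then show "w' i \<le> w i / 2 + R i" using w'[of i] f(2)[of i] R_ge[of i] by auto
    qed
    also have "\<dots> = (\<Sum>i<2*n. w i) / 2 + (\<Sum>i<2*n. R i)" by (simp add: sum.distrib sum_divide_distrib)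
    also have "\<dots> \<le> 14 * real n / 2 + 4 * real n" using f(1) sum_R by (intro add_mono divide_right_mono) auto
    finally show ?thesis using nn by simp
  qed
  have "{i. i < 2*n \<and> st' i = 0} \<subseteq> {i. i < 2*n \<and> energy (alive x) i * Lg > 20 * T\<^sup>2 \<and>
    (\<kappa>' * R i > 1000 * real n \<or> energy (alive x) i * real n > 20 * (\<kappa>' * R i))}"
    using st' by (auto split: if_splits)
  then have "real (card {i. i < 2*n \<and> st' i = 0}) \<le> real (card {i. i < 2*n \<and> energy (alive x) i * Lg > 20 * T\<^sup>2 \<and>
    (\<kappa>' * R i > 1000 * real n \<or> energy (alive x) i * real n > 20 * (\<kappa>' * R i))})"
    by (intro of_nat_mono card_mono) auto
  moreover have "real (card (alive x)) \<le> \<kappa>'" using k \<kappa>' by simp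
  then have "40 * real (card {i. i < 2*n \<and> energy (alive x) i * Lg > 20 * T\<^sup>2 \<and>
    (\<kappa>' * R i > 1000 * real n \<or> energy (alive x) i * real n > 20 * (\<kappa>' * R i))}) \<le> \<kappa>'"
    using \<kappa>1 by (intro blocked_at_start) auto
  ultimately have cnt: "40 * real (card {i. i < 2*n \<and> st' i = 0}) \<le> \<kappa>'" by linarith
  have "0 \<le> (\<Sum>j<n. (x j)\<^sup>2)" by (simp add: sum_nonneg)
  then show ?thesis unfolding walk_inv_def using \<kappa> \<kappa>' \<kappa>1 x rows potential cnt by auto
qed

lemma potential_nonneg: "(\<And>i. i < 2*n \<Longrightarrow> w i \<ge> 0) \<Longrightarrow> potential w st d \<ge> 0"
  by (auto simp: potential_def V_def intro!: sum_nonneg add_nonneg_nonneg)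

text \<open>At most \<open>\<kappa> / 40\<close> rows have been blocked since the phase began and at
  most \<open>\<kappa> / 100\<close> because of their weight. As
  \<open>\<kappa> < 2 * card (alive x)\<close>, this is less than a tenth of the alive coordinates,
  as \<open>descent\<close> requires. The newly blocked rows have drift 0, so the potential does not
  change.\<close>

lemma block_inv:
  assumes inv: "walk_inv p \<kappa> x al w st d" and k: "\<kappa> < 2 * real (card (alive x))"
    and st': "\<And>i. i < 2*n \<Longrightarrow> st' i = (if st i = 2 \<and> 1400 * real n \<le> w i * \<kappa> then 1 else st i)"
  shows "walk_inv p \<kappa> x al w st' d" "10 * card {i. i < 2*n \<and> \<not> st' i > 1} \<le> card (alive x)"
    "potential w st' d = potential w st d" "\<And>i. i < 2*n \<Longrightarrow> st' i = 2 \<Longrightarrow> w i * \<kappa> < 1400 * real n"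
proof -
  note f = walk_inv_facts[OF inv]
  have nn: "real n > 0" using n1 by simp
  have x: "\<And>j. j < n \<Longrightarrow> \<bar>x j\<bar> \<le> 1" and \<kappa>: "\<kappa> = 2 * real n / 2 ^ p" "\<kappa> > 0" using inv by (auto simp: walk_inv_def)
  have row: "row_inv p \<kappa> x (al i) (w i) (st i) (d i) i" if "i < 2*n" for i using inv that by (auto simp: walk_inv_def)
  \<comment> \<open>In phase 0 the bound \<open>\<kappa> = 2 * n\<close> is never below twice the
    number of alive coordinates.\<close>
  have "p \<ge> 1"
  proof (rule ccontr)
    assume "\<not> p \<ge> 1"
    then have p0: "p = 0" by simp
    have "\<kappa> = 2 * real n" using \<kappa>(1) by (simp add: p0)
    then have "2 * real n < 2 * real (card (alive x))" using k by simp
    then show False using card_alive[of x] by simp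
  qed
  then have c0: "40 * real (card {i. i < 2*n \<and> st i = 0}) \<le> \<kappa>" using inv by (auto simp: walk_inv_def)
  have e0: "{i. i < 2*n \<and> st' i = 0} = {i. i < 2*n \<and> st i = 0}" using st' by (auto split: if_splits)
  show potential: "potential w st' d = potential w st d"
  proof -
    have "d i = 0" if "i < 2*n" "st i = 2" for i using row[OF that(1)] that(2) by (auto simp: row_inv_def)
    then show ?thesis unfolding potential_def by (intro sum.cong refl) (simp add: st')
  qed
  have rows: "row_inv p \<kappa> x (al i) (w i) (st' i) (d i) i" if i: "i < 2*n" for i
  proof (cases "st i = 2 \<and> 1400 * real n \<le> w i * \<kappa>")
    case True
    then have s1: "st' i = 1" using st' i by simp
    obtain l where l: "al i = (3/2) ^ l" "at_level p \<kappa> i l" "d i = 0" "level_inv p \<kappa> x l (w i) i"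
      using row[OF i] True unfolding row_inv_def by auto
    have "dot i x \<le> K1 * (1 - (3/4) ^ l) + real p / (2 * real n) + d i" using level_inv_bound[OF l(4,2) \<kappa>(2) x] l(3) by simp
    then show ?thesis using s1 l True f(2)[OF i] unfolding row_inv_def by auto
  next
    case False
    then have "st' i = st i" using st' i by auto
    then show ?thesis using row[OF i] by simp
  qed
  show "walk_inv p \<kappa> x al w st' d" using inv rows potential e0 unfolding walk_inv_def by auto
  show "w i * \<kappa> < 1400 * real n" if "i < 2*n" "st' i = 2" for i using that st'[of i] by (auto split: if_splits)
  have "real (card {i. i < 2*n \<and> st' i = 1}) * (1400 * real n / \<kappa>) \<le> 14 * real n"
  proof (rule markov_card[of "{..<2*n}" _ w])
    fix i assume "i \<in> {i. i < 2*n \<and> st' i = 1}"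
    then have i: "i < 2*n" "st' i = 1" by auto
    then have "1400 * real n \<le> w i * \<kappa>" using st'[OF i(1)] row[OF i(1)] by (auto simp: row_inv_def split: if_splits)
    then show "1400 * real n / \<kappa> \<le> w i" using \<kappa> by (simp only: pos_divide_le_eq)
  qed (use f in auto)
  then have c1: "100 * real (card {i. i < 2*n \<and> st' i = 1}) \<le> \<kappa>" using \<kappa>(2) nn by (simp add: field_simps)
  have "\<not> st' i > 1 \<Longrightarrow> i < 2*n \<Longrightarrow> st' i = 0 \<or> st' i = 1" for i using row_inv_st[OF rows[of i]] by auto
  then have "card {i. i < 2*n \<and> \<not> st' i > 1} \<le> card ({i. i < 2*n \<and> st' i = 0} \<union> {i. i < 2*n \<and> st' i = 1})"
    by (intro card_mono) auto
  also have "\<dots> \<le> card {i. i < 2*n \<and> st' i = 0} + card {i. i < 2*n \<and> st' i = 1}" by (rule card_Un_le)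
  finally have h: "card {i. i < 2*n \<and> \<not> st' i > 1} \<le> card {i. i < 2*n \<and> st' i = 0} + card {i. i < 2*n \<and> st' i = 1}" .
  have "real (card {i. i < 2*n \<and> \<not> st' i > 1}) \<le> real (card {i. i < 2*n \<and> st i = 0}) + real (card {i. i < 2*n \<and> st' i = 1})"
    using of_nat_mono[OF h, where 'a = real] unfolding e0 by (simp only: of_nat_add)
  then have "real (10 * card {i. i < 2*n \<and> \<not> st' i > 1}) \<le> real (card (alive x))" using c0 c1 k by simp
  then show "10 * card {i. i < 2*n \<and> \<not> st' i > 1} \<le> card (alive x)" by (subst (asm) of_nat_le_iff)
qed

text \<open>\<open>psi\<close> changes by exactly \<open>u - 2 * c\<close>, hence by at most the
  change of \<open>ln w\<close>. The change of the potential splits exactly into a linear part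
  \<open>e\<close> and a quadratic part \<open>q\<close>, to which \<open>lin\<close> and
  \<open>quad\<close> apply. A step at most doubles a weight, which is why weights below
  \<open>1400 * n / \<kappa>\<close> before the step suffice for the cap 2800.\<close>

lemma step_inv:
  assumes inv: "walk_inv p \<kappa> x al w st d" and lt: "\<And>i. i < 2*n \<Longrightarrow> st i = 2 \<Longrightarrow> w i * \<kappa> < 1400 * real n"
    and s: "\<And>i j. i < 2*n \<Longrightarrow> j < n \<Longrightarrow> s i j = (if st i > 1 then small_part (al i) i j else 0)"
    and g: "\<And>i j. i < 2*n \<Longrightarrow> j < n \<Longrightarrow> g i j = s i j - 128 * (s i j)\<^sup>2 * x j"
    and \<delta>: "\<And>j. j < n \<Longrightarrow> j \<notin> alive x \<Longrightarrow> \<delta> j = 0" "\<And>j. j < n \<Longrightarrow> \<bar>\<delta> j\<bar> \<le> 1 / (2 * real n)"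
    and quad: "(\<Sum>i<2*n. if st i > 1 then 3 * w i * (\<Sum>j<n. g i j * \<delta> j)\<^sup>2 - 32 * w i * (\<Sum>j<n. (s i j * \<delta> j)\<^sup>2)
      else V * (\<Sum>j<n. a i j * \<delta> j)\<^sup>2) - (\<Sum>j<n. (\<delta> j)\<^sup>2) \<le> - \<epsilon>" "\<epsilon> \<ge> 0"
    and lin: "(\<Sum>j<n. \<delta> j * ((\<Sum>i<2*n. if st i > 1 then w i * g i j else 2 * V * d i * a i j) - 2 * x j)) \<le> 0"
    and w': "\<And>i. i < 2*n \<Longrightarrow> w' i = w i * (1 + (\<Sum>j<n. g i j * \<delta> j) + 3 * (\<Sum>j<n. g i j * \<delta> j)\<^sup>2 - 32 * (\<Sum>j<n. (s i j * \<delta> j)\<^sup>2))"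
    and d': "\<And>i. i < 2*n \<Longrightarrow> d' i = (if st i > 1 then d i else d i + dot i \<delta>)"
    and x': "\<And>j. j < n \<Longrightarrow> x' j = x j + \<delta> j"
  shows "walk_inv p \<kappa> x' al w' st d'" "potential w' st d' - (\<Sum>j<n. (x' j)\<^sup>2) \<le> potential w st d - (\<Sum>j<n. (x j)\<^sup>2) - \<epsilon>"
proof -
  note f = walk_inv_facts[OF inv]
  have nn: "real n > 0" using n1 by simp
  have x: "\<And>j. j < n \<Longrightarrow> \<bar>x j\<bar> \<le> 1" and \<kappa>: "\<kappa> > 0" using inv by (auto simp: walk_inv_def)
  have row: "row_inv p \<kappa> x (al i) (w i) (st i) (d i) i" if "i < 2*n" for i using inv that by (auto simp: walk_inv_def)
  define u where "u i = (\<Sum>j<n. g i j * \<delta> j)" for i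
  define c where "c i = 32 * (\<Sum>j<n. (s i j * \<delta> j)\<^sup>2)" for i
  have s128: "\<bar>s i j\<bar> \<le> 1/128" if "i < 2*n" "j < n" for i j
    using s[OF that] by (auto simp: small_part_def)
  have g64: "\<bar>g i j\<bar> \<le> 1/64" if "i < 2*n" "j < n" for i j
  proof -
    have "\<bar>128 * (s i j)\<^sup>2 * x j\<bar> \<le> 128 * (s i j)\<^sup>2 * 1"
      unfolding abs_mult using x[OF that(2)] by (intro mult_mono) auto
    moreover have "(s i j)\<^sup>2 \<le> 1/16384" using power_mono[OF s128[OF that], of 2] by (simp add: power_divide)
    ultimately show ?thesis using s128[OF that] unfolding g[OF that] by linarith
  qed
  have u: "\<bar>u i\<bar> \<le> 1/128" if i: "i < 2*n" for i
  proof -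
    have "\<bar>u i\<bar> \<le> (\<Sum>j<n. \<bar>g i j * \<delta> j\<bar>)" unfolding u_def by (rule sum_abs)
    also have "\<dots> \<le> (\<Sum>j<n. 1/64 * (1 / (2 * real n)))"
      unfolding abs_mult by (intro sum_mono mult_mono g64 \<delta>(2)) (use i in auto)
    also have "\<dots> = 1/128" using nn by simp
    finally show ?thesis .
  qed
  have c: "0 \<le> c i" "c i \<le> 1/2048" if i: "i < 2*n" for i
  proof -
    show "0 \<le> c i" by (simp add: c_def sum_nonneg)
    have "(\<Sum>j<n. (s i j * \<delta> j)\<^sup>2) \<le> (\<Sum>j<n. (1/128 * (1 / (2 * real n)))\<^sup>2)"
    proof (rule sum_mono)
      fix j assume "j \<in> {..<n}"
      then have "\<bar>s i j * \<delta> j\<bar> \<le> 1/128 * (1 / (2 * real n))"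
        unfolding abs_mult by (intro mult_mono s128 \<delta>(2)) (use i in auto)
      from power_mono[OF this, of 2] show "(s i j * \<delta> j)\<^sup>2 \<le> (1/128 * (1 / (2 * real n)))\<^sup>2" by simp
    qed
    also have "\<dots> = 1 / (65536 * real n)" using nn by (simp add: power2_eq_square)
    also have "\<dots> \<le> 1 / 65536" using n1 by (intro divide_left_mono) auto
    finally show "c i \<le> 1/2048" by (simp add: c_def)
  qed
  have w'e: "w' i = w i * (1 + u i + 3 * (u i)\<^sup>2 - c i)" if "i < 2*n" for i using w'[OF that] by (simp add: u_def c_def)
  note ub = ln_update_bound[OF u c]
  have w'pos: "w' i > 0" "w' i \<le> 2 * w i" "ln (w' i) \<ge> ln (w i) + (u i - 2 * c i)" if i: "i < 2*n" "w i > 0" for i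
  proof -
    show "w' i > 0" using w'e i ub(1)[OF i(1) i(1) i(1)] by simp
    show "w' i \<le> 2 * w i" using w'e[OF i(1)] mult_left_mono[OF ub(2)[OF i(1) i(1) i(1)], of "w i"] i(2) by simp
    have "ln (w' i) = ln (w i) + ln (1 + u i + 3 * (u i)\<^sup>2 - c i)"
      using w'e i ub(1)[OF i(1) i(1) i(1)] by (simp add: ln_mult_pos)
    then show "ln (w' i) \<ge> ln (w i) + (u i - 2 * c i)" using ub(3)[OF i(1) i(1) i(1)] by simp
  qed
  have psi: "psi (al i) i x' = psi (al i) i x + (u i - 2 * c i)" if i: "i < 2*n" "st i > 1" for i
  proof -
    have "psi (al i) i x' = (\<Sum>j<n. (small_part (al i) i j * x j - 64 * (small_part (al i) i j)\<^sup>2 * (x j)\<^sup>2) + (g i j * \<delta> j - 64 * (s i j * \<delta> j)\<^sup>2))"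
      unfolding psi_def
    proof (rule sum.cong[OF refl])
      fix j assume "j \<in> {..<n}"
      then have j: "j < n" by simp
      have se: "s i j = small_part (al i) i j" using s[OF i(1) j] i(2) by simp
      show "small_part (al i) i j * x' j - 64 * (small_part (al i) i j)\<^sup>2 * (x' j)\<^sup>2 =
        (small_part (al i) i j * x j - 64 * (small_part (al i) i j)\<^sup>2 * (x j)\<^sup>2) + (g i j * \<delta> j - 64 * (s i j * \<delta> j)\<^sup>2)"
        unfolding x'[OF j] g[OF i(1) j] se[symmetric] by (simp add: power2_eq_square algebra_simps)
    qed
    also have "\<dots> = psi (al i) i x + (u i - 2 * c i)"
      by (simp add: psi_def u_def c_def sum.distrib sum_subtractf sum_distrib_left)
    finally show ?thesis .
  qed
  \<comment> \<open>Whether a coordinate is alive depends on its value only; one that was frozen at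
    \<open>x0\<close> and has not moved since is still frozen, so it does not move now.\<close>
  have froz: "x' j = x0 j" if "j < n" "j \<notin> alive x0" "\<forall>j<n. j \<notin> alive x0 \<longrightarrow> x j = x0 j" for j x0
  proof -
    have "x j = x0 j" using that by auto
    then have "j \<notin> alive x" using that(2) by (auto simp: alive_def)
    then show ?thesis using \<delta>(1) x' that \<open>x j = x0 j\<close> by simp
  qed
  have dotx: "dot i x' = dot i x + dot i \<delta>" for i
    unfolding dot_def sum.distrib[symmetric] by (intro sum.cong refl) (simp add: x' distrib_left)
  have rows: "row_inv p \<kappa> x' (al i) (w' i) (st i) (d' i) i" if i: "i < 2*n" for i
  proof -
    consider "st i > 2" | "st i = 2" | "st i \<le> 1" using row_inv_st[OF row[OF i]] by auto
    then show ?thesis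
    proof cases
      case 1
      then have B: "final_inv p x (w i) i" "al i = Lg / T" "d i = 0" using row[OF i] by (auto simp: row_inv_def)
      then obtain x0 where x0: "0 < w i" "\<forall>j<n. \<bar>x0 j\<bar> \<le> 1" "\<forall>j<n. j \<notin> alive x0 \<longrightarrow> x j = x0 j"
        "energy (alive x0) i \<le> 20 * lam" "dot i x0 \<le> K1 + real p / (2 * real n)"
        "ln (w i) + real p * ln 2 \<ge> psi (Lg / T) i x - psi (Lg / T) i x0" by (auto simp: final_inv_def)
      have "ln (w' i) + real p * ln 2 \<ge> psi (Lg / T) i x' - psi (Lg / T) i x0"
        using x0(6) w'pos(3)[OF i x0(1)] psi[OF i] 1 B(2) by simp
      then have "final_inv p x' (w' i) i" unfolding final_inv_def using x0 w'pos(1)[OF i x0(1)] froz by (intro conjI exI[of _ x0]) auto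
      then show ?thesis using 1 B d'[OF i] by (auto simp: row_inv_def)
    next
      case 2
      then obtain l where l: "al i = (3/2) ^ l" "at_level p \<kappa> i l" "d i = 0" "level_inv p \<kappa> x l (w i) i"
        using row[OF i] unfolding row_inv_def by auto
      then obtain x0 where x0: "l \<ge> 1" "0 < w i" "\<forall>j<n. \<bar>x0 j\<bar> \<le> 1" "\<forall>j<n. j \<notin> alive x0 \<longrightarrow> x j = x0 j"
        "energy (alive x0) i * real n \<le> 20 * \<kappa> * R i" "dot i x0 \<le> K1 * (1 - (3/4) ^ (l - 1)) + real p / (2 * real n)"
        "ln (w i) - ln (R i) \<ge> psi (al i) i x - psi (al i) i x0" by (auto simp: level_inv_def)
      have "ln (w' i) - ln (R i) \<ge> psi (al i) i x' - psi (al i) i x0"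
        using x0(7) w'pos(3)[OF i x0(2)] psi[OF i] 2 by simp
      moreover have "w' i * \<kappa> \<le> 2 * w i * \<kappa>" using w'pos(2)[OF i x0(2)] \<kappa> by (intro mult_right_mono) auto
      then have "w' i * \<kappa> \<le> 2800 * real n" using lt[OF i 2] by simp
      ultimately have "level_inv p \<kappa> x' l (w' i) i"
        unfolding level_inv_def using x0 w'pos(1)[OF i x0(2)] froz l(1) by (intro conjI exI[of _ x0]) auto
      then show ?thesis using 2 l d'[OF i] unfolding row_inv_def by auto
    next
      case 3
      have "s i j = 0" if "j < n" for j using s[OF i that] 3 by simp
      then have "u i = 0" "c i = 0" using g[OF i] by (auto simp: u_def c_def)
      then have "w' i = w i" using w'e[OF i] by simp
      then show ?thesis using row[OF i] 3 d'[OF i] dotx[of i] unfolding row_inv_def by auto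
    qed
  qed
  show L: "potential w' st d' - (\<Sum>j<n. (x' j)\<^sup>2) \<le> potential w st d - (\<Sum>j<n. (x j)\<^sup>2) - \<epsilon>"
  proof -
    define q where "q i = (if st i > 1 then 3 * w i * (u i)\<^sup>2 - w i * c i else V * (dot i \<delta>)\<^sup>2)" for i
    define e where "e i = (if st i > 1 then w i * u i else 2 * V * d i * dot i \<delta>)" for i
    have "potential w' st d' = (\<Sum>i<2*n. (w i + (if st i > 1 then 0 else V * (d i)\<^sup>2)) + (e i + q i))"
      unfolding potential_def
    proof (rule sum.cong[OF refl])
      fix i assume "i \<in> {..<2*n}"
      then have i: "i < 2*n" by simp
      show "w' i + (if st i > 1 then 0 else V * (d' i)\<^sup>2) = (w i + (if st i > 1 then 0 else V * (d i)\<^sup>2)) + (e i + q i)"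
      proof (cases "st i > 1")
        case True
        then show ?thesis using w'e[OF i] by (simp add: e_def q_def algebra_simps)
      next
        case False
        have "s i j = 0" if "j < n" for j using s[OF i that] False by simp
        then have "u i = 0" "c i = 0" using g[OF i] by (auto simp: u_def c_def)
        then have "w' i = w i" using w'e[OF i] by simp
        then show ?thesis using False d'[OF i] by (simp add: e_def q_def power2_eq_square algebra_simps)
      qed
    qed
    also have "\<dots> = potential w st d + (\<Sum>i<2*n. e i) + (\<Sum>i<2*n. q i)" by (simp add: potential_def sum.distrib)
    finally have P: "potential w' st d' = potential w st d + (\<Sum>i<2*n. e i) + (\<Sum>i<2*n. q i)" .
    have X: "(\<Sum>j<n. (x' j)\<^sup>2) = (\<Sum>j<n. (x j)\<^sup>2) + (\<Sum>j<n. \<delta> j * (2 * x j)) + (\<Sum>j<n. (\<delta> j)\<^sup>2)"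
      unfolding sum.distrib[symmetric] by (intro sum.cong refl) (simp add: x' power2_eq_square algebra_simps)
    have "(\<Sum>i<2*n. e i) = (\<Sum>i<2*n. \<Sum>j<n. \<delta> j * (if st i > 1 then w i * g i j else 2 * V * d i * a i j))"
      by (intro sum.cong refl) (simp add: e_def u_def dot_def sum_distrib_left mult_ac)
    also have "\<dots> = (\<Sum>j<n. \<delta> j * (\<Sum>i<2*n. if st i > 1 then w i * g i j else 2 * V * d i * a i j))"
      unfolding sum_distrib_left by (rule sum.swap)
    finally have E: "(\<Sum>i<2*n. e i) - (\<Sum>j<n. \<delta> j * (2 * x j)) \<le> 0"
      using lin by (simp add: right_diff_distrib sum_subtractf)
    have qe: "q i = (if st i > 1 then 3 * w i * (\<Sum>j<n. g i j * \<delta> j)\<^sup>2 - 32 * w i * (\<Sum>j<n. (s i j * \<delta> j)\<^sup>2)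
      else V * (\<Sum>j<n. a i j * \<delta> j)\<^sup>2)" for i by (simp add: q_def c_def u_def dot_def)
    have "(\<Sum>i<2*n. q i) - (\<Sum>j<n. (\<delta> j)\<^sup>2) \<le> - \<epsilon>"
      unfolding qe by (rule quad(1))
    then show ?thesis using P X E by linarith
  qed
  have "\<bar>x' j\<bar> \<le> 1" if j: "j < n" for j
  proof (cases "j \<in> alive x")
    case True
    then have "\<bar>real n * x j\<bar> \<le> real n - 1" by (auto simp: alive_def)
    then have "real n * \<bar>x j\<bar> \<le> real n - 1" by (simp add: abs_mult)
    moreover have "real n * \<bar>\<delta> j\<bar> \<le> real n * (1 / (2 * real n))" using \<delta>(2)[OF j] by (intro mult_left_mono) auto
    then have "real n * \<bar>\<delta> j\<bar> \<le> 1/2" using nn by simp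
    moreover have "real n * \<bar>x' j\<bar> \<le> real n * (\<bar>x j\<bar> + \<bar>\<delta> j\<bar>)" unfolding x'[OF j] by (intro mult_left_mono) auto
    ultimately have "real n * \<bar>x' j\<bar> \<le> real n * 1" by (simp add: distrib_left)
    then show ?thesis using nn by (simp only: mult_le_cancel_left_pos)
  next
    case False
    then show ?thesis using \<delta>(1)[OF j] x'[OF j] x[OF j] by simp
  qed
  then show "walk_inv p \<kappa> x' al w' st d'"
    unfolding walk_inv_def using inv rows L quad(2) unfolding walk_inv_def by auto
qed

end

subsection \<open>Bit lengths of intermediate values\<close>

text \<open>Every division of the program is by 2, 16000 or \<open>n\<close>, so for a common multiple \<open>D\<close> of these all
  intermediate values have a power of \<open>D\<close> as denominator.\<close>

definition height_le :: "nat \<Rightarrow> nat \<Rightarrow> real \<Rightarrow> bool" where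
  "height_le D h x \<longleftrightarrow> x * real D ^ h \<in> \<int> \<and> \<bar>x\<bar> \<le> real D ^ h"

fun nsz :: "nexp \<Rightarrow> nat" where
  "nsz (NConst k) = 1"
| "nsz (NReg r) = 1"
| "nsz (NAdd d e) = nsz d + nsz e"
| "nsz (NSub d e) = nsz d + nsz e"

fun nck :: "nexp \<Rightarrow> bool" where
  "nck (NConst k) \<longleftrightarrow> k \<le> 16000"
| "nck (NReg r) \<longleftrightarrow> True"
| "nck (NAdd d e) \<longleftrightarrow> nck d \<and> nck e"
| "nck (NSub d e) \<longleftrightarrow> nck d \<and> nck e"

fun rsz :: "rexp \<Rightarrow> nat" where
  "rsz (OfNat e) = nsz e + 1"
| "rsz (Entry a i j) = nsz i + nsz j + 1"
| "rsz (Add d e) = rsz d + rsz e + 1"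
| "rsz (Sub d e) = rsz d + rsz e + 1"
| "rsz (Mul d e) = rsz d + rsz e"
| "rsz (Div d e) = rsz d + rsz e + 1"

fun rck :: "rexp \<Rightarrow> bool" where
  "rck (OfNat e) \<longleftrightarrow> nck e"
| "rck (Entry a i j) \<longleftrightarrow> nck i \<and> nck j"
| "rck (Add d e) \<longleftrightarrow> rck d \<and> rck e"
| "rck (Sub d e) \<longleftrightarrow> rck d \<and> rck e"
| "rck (Mul d e) \<longleftrightarrow> rck d \<and> rck e"
| "rck (Div d e) \<longleftrightarrow> rck d \<and> (e = OfNat (NConst 2) \<or> e = OfNat (NConst 16000) \<or> e = OfNat (NReg 0))"

fun bck :: "nat \<Rightarrow> bexp \<Rightarrow> bool" where
  "bck B (BLess d e) \<longleftrightarrow> rck d \<and> rck e \<and> rsz d \<le> B \<and> rsz e \<le> B"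
| "bck B (BNot b) \<longleftrightarrow> bck B b"
| "bck B (BAnd b c) \<longleftrightarrow> bck B b \<and> bck B c"

text \<open>\<open>lv\<close> assigns to every array an exponent: after \<open>X\<close> steps the entries of array \<open>a\<close> have
  height at most \<open>X ^ lv a\<close>. An assignment to \<open>a\<close> may read arrays of level at most \<open>lv a - 2\<close>
  freely, and arrays of level \<open>lv a\<close> at most once in each product.\<close>

fun lck :: "(nat \<Rightarrow> nat) \<Rightarrow> nat \<Rightarrow> rexp \<Rightarrow> bool" where
  "lck lv k (OfNat e) \<longleftrightarrow> True"
| "lck lv k (Entry a i j) \<longleftrightarrow> lv a = k \<or> lv a + 2 \<le> k"
| "lck lv k (Add d e) \<longleftrightarrow> lck lv k d \<and> lck lv k e"
| "lck lv k (Sub d e) \<longleftrightarrow> lck lv k d \<and> lck lv k e"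
| "lck lv k (Mul d e) \<longleftrightarrow> lck lv k d \<and> lck lv k e"
| "lck lv k (Div d e) \<longleftrightarrow> lck lv k d"

text \<open>The degree of the expression in the arrays of level \<open>k\<close>; numerical values
  of degree 0 come from lower levels only.\<close>

fun uc :: "(nat \<Rightarrow> nat) \<Rightarrow> nat \<Rightarrow> rexp \<Rightarrow> nat" where
  "uc lv k (OfNat e) = 0"
| "uc lv k (Entry a i j) = (if lv a = k then 1 else 0)"
| "uc lv k (Add d e) = max (uc lv k d) (uc lv k e)"
| "uc lv k (Sub d e) = max (uc lv k d) (uc lv k e)"
| "uc lv k (Mul d e) = uc lv k d + uc lv k e"
| "uc lv k (Div d e) = uc lv k d"

definition ack :: "(nat \<Rightarrow> nat) \<Rightarrow> nat \<Rightarrow> nat \<Rightarrow> rexp \<Rightarrow> bool" where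
  "ack lv B a e \<longleftrightarrow> rck e \<and> lck lv (lv a) e \<and> uc lv (lv a) e \<le> 1 \<and> rsz e \<le> B"

fun pck :: "(nat \<Rightarrow> nat) \<Rightarrow> nat \<Rightarrow> prog \<Rightarrow> bool" where
  "pck lv B Skip \<longleftrightarrow> True"
| "pck lv B (NAssign r e) \<longleftrightarrow> r \<noteq> 0 \<and> (e = NConst 0 \<or> e = NAdd (NReg r) (NConst 1))"
| "pck lv B (RAssign a i j e) \<longleftrightarrow> nck i \<and> nck j \<and> nsz i + nsz j \<le> B \<and> ack lv B a e"
| "pck lv B (Seq p q) \<longleftrightarrow> pck lv B p \<and> pck lv B q"
| "pck lv B (Cond b p q) \<longleftrightarrow> bck B b \<and> pck lv B p \<and> pck lv B q"
| "pck lv B (While b p) \<longleftrightarrow> bck B b \<and> pck lv B p"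

fun rht :: "(nat \<Rightarrow> nat) \<Rightarrow> nat \<Rightarrow> rexp \<Rightarrow> nat" where
  "rht lv X (OfNat e) = X + nsz e"
| "rht lv X (Entry a i j) = X ^ lv a"
| "rht lv X (Add d e) = max (rht lv X d) (rht lv X e) + 1"
| "rht lv X (Sub d e) = max (rht lv X d) (rht lv X e) + 1"
| "rht lv X (Mul d e) = rht lv X d + rht lv X e"
| "rht lv X (Div d e) = rht lv X d + 1"

lemma nsz_pos: "nsz e \<ge> 1" by (induction e) auto
text \<open>Everything but the factors of level \<open>k\<close> goes into the lower-order term. For
  registers, whose height is about \<open>X\<close>, this needs \<open>X \<le> X ^ (k - 2)\<close>,
  that is \<open>k \<ge> 3\<close>.\<close>

lemma rht_le_level:
  assumes "X \<ge> 1" "k \<ge> 3" "lck lv k e"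
  shows "rht lv X e \<le> uc lv k e * X ^ k + rsz e * X ^ (k - 2)"
  using assms(3)
proof (induction e)
  have p: "X ^ (k - 2) \<ge> X" using assms power_increasing[of 1 "k - 2" X] by simp
  { case (OfNat e)
    have "X + nsz e \<le> (nsz e + 1) * X" using assms(1) by simp
    also have "\<dots> \<le> (nsz e + 1) * X ^ (k - 2)" using p by (rule mult_left_mono) simp
    finally show ?case by simp
  next
    case (Entry a i j)
    have "X ^ lv a \<le> X ^ (k - 2)" if "lv a + 2 \<le> k" using assms(1) that by (intro power_increasing) auto
    then show ?case using Entry by (auto simp: trans_le_add1)
  next
    case (Add d e)
    have "uc lv k d * X ^ k \<le> max (uc lv k d) (uc lv k e) * X ^ k" "uc lv k e * X ^ k \<le> max (uc lv k d) (uc lv k e) * X ^ k"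
      by (intro mult_right_mono; simp)+
    moreover have "(rsz d + rsz e + 1) * X ^ (k - 2) = rsz d * X ^ (k - 2) + rsz e * X ^ (k - 2) + X ^ (k - 2)"
      by (simp only: distrib_right mult_1)
    moreover have "rht lv X d \<le> uc lv k d * X ^ k + rsz d * X ^ (k - 2)" "rht lv X e \<le> uc lv k e * X ^ k + rsz e * X ^ (k - 2)"
      using Add by simp_all
    ultimately have "max (rht lv X d) (rht lv X e) + 1 \<le> max (uc lv k d) (uc lv k e) * X ^ k + (rsz d + rsz e + 1) * X ^ (k - 2)"
      using p assms(1) by linarith
    then show ?case by simp
  next
    case (Sub d e)
    have "uc lv k d * X ^ k \<le> max (uc lv k d) (uc lv k e) * X ^ k" "uc lv k e * X ^ k \<le> max (uc lv k d) (uc lv k e) * X ^ k"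
      by (intro mult_right_mono; simp)+
    moreover have "(rsz d + rsz e + 1) * X ^ (k - 2) = rsz d * X ^ (k - 2) + rsz e * X ^ (k - 2) + X ^ (k - 2)"
      by (simp only: distrib_right mult_1)
    moreover have "rht lv X d \<le> uc lv k d * X ^ k + rsz d * X ^ (k - 2)" "rht lv X e \<le> uc lv k e * X ^ k + rsz e * X ^ (k - 2)"
      using Sub by simp_all
    ultimately have "max (rht lv X d) (rht lv X e) + 1 \<le> max (uc lv k d) (uc lv k e) * X ^ k + (rsz d + rsz e + 1) * X ^ (k - 2)"
      using p assms(1) by linarith
    then show ?case by simp
  next
    case (Mul d e)
    then show ?case by (simp add: algebra_simps)
  next
    case (Div d e)
    have "rht lv X d \<le> uc lv k d * X ^ k + rsz d * X ^ (k - 2)" using Div by simp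
    then show ?case using p assms(1) by (simp add: algebra_simps)
  }
qed

lemma rht_le:
  assumes "X \<ge> 1" "\<And>a. lv a \<le> K" "K \<ge> 1"
  shows "rht lv X e \<le> rsz e * X ^ K"
proof (induction e)
  have p: "X ^ K \<ge> X" "X ^ K \<ge> 1" using assms power_increasing[of 1 K X] by auto
  { case (OfNat e)
    have "X + nsz e \<le> (nsz e + 1) * X" using assms(1) by simp
    also have "\<dots> \<le> (nsz e + 1) * X ^ K" using p(1) by (rule mult_left_mono) simp
    finally show ?case by simp
  next
    case (Entry a i j)
    have "X ^ lv a \<le> X ^ K" using assms by (intro power_increasing) auto
    then show ?case by (simp add: trans_le_add1)
  next
    case (Add d e)
    then show ?case using p by (auto simp: algebra_simps)
  next
    case (Sub d e)
    then show ?case using p by (auto simp: algebra_simps)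
  next
    case (Mul d e)
    then show ?case by (simp add: algebra_simps)
  next
    case (Div d e)
    then show ?case using p by (auto simp: algebra_simps)
  }
qed

locale heights =
  fixes D n :: nat and lv :: "nat \<Rightarrow> nat" and K B :: nat
  assumes D: "16000 dvd D" "n dvd D" "D > 0" and n: "n \<ge> 1"
    and lv: "\<And>a. 3 \<le> lv a" "\<And>a. lv a \<le> K" and B: "B \<ge> 1"
begin

lemma D16: "D \<ge> 16000" using D by (auto dest: dvd_imp_le)
lemma D1: "real D \<ge> 1" using D16 by simp
lemma Dp: "real D ^ h \<ge> 1" using D1 by simp
lemma Dmono: "h \<le> h' \<Longrightarrow> real D ^ h \<le> real D ^ h'" using D1 by (intro power_increasing) auto

lemma height_le_mono:
  assumes "height_le D h x" "h \<le> h'" shows "height_le D h' x"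
proof -
  have e: "x * real D ^ h' = x * real D ^ h * real D ^ (h' - h)"
    using assms(2) by (simp add: power_add[symmetric])
  have "x * real D ^ h' \<in> \<int>"
    unfolding e by (rule Ints_mult) (use assms in \<open>simp_all add: height_le_def\<close>)
  then show ?thesis using assms Dmono[OF assms(2)] by (auto simp: height_le_def)
qed

lemma two_powers: "real D ^ h + real D ^ h' \<le> real D ^ (max h h' + 1)"
proof -
  have "real D ^ h + real D ^ h' \<le> 2 * real D ^ max h h'" using Dmono[of h "max h h'"] Dmono[of h' "max h h'"] by simp
  also have "\<dots> \<le> real D * real D ^ max h h'" using D16 by (intro mult_right_mono) auto
  finally show ?thesis by simp
qed

lemma height_le_add:
  assumes "height_le D h x" "height_le D h' y" shows "height_le D (max h h' + 1) (x + y)"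
proof -
  have "height_le D (max h h' + 1) x" "height_le D (max h h' + 1) y" using assms by (auto intro: height_le_mono)
  then have "(x + y) * real D ^ (max h h' + 1) \<in> \<int>" unfolding height_le_def by (simp only: distrib_right) auto
  moreover have "\<bar>x + y\<bar> \<le> real D ^ (max h h' + 1)"
    using assms two_powers[of h h'] unfolding height_le_def by linarith
  ultimately show ?thesis by (simp add: height_le_def)
qed

lemma height_le_minus: "height_le D h x \<Longrightarrow> height_le D h (- x)" by (simp add: height_le_def)

lemma height_le_diff: "height_le D h x \<Longrightarrow> height_le D h' y \<Longrightarrow> height_le D (max h h' + 1) (x - y)"
  using height_le_add[OF _ height_le_minus, of h x h' y] by simp

lemma height_le_mult:
  assumes "height_le D h x" "height_le D h' y" shows "height_le D (h + h') (x * y)"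
proof -
  have e: "x * y * real D ^ (h + h') = (x * real D ^ h) * (y * real D ^ h')" by (simp add: power_add)
  have "x * y * real D ^ (h + h') \<in> \<int>"
    unfolding e by (rule Ints_mult) (use assms in \<open>simp_all add: height_le_def\<close>)
  moreover have "\<bar>x * y\<bar> \<le> real D ^ (h + h')"
    unfolding abs_mult power_add using assms by (intro mult_mono) (auto simp: height_le_def)
  ultimately show ?thesis using assms by (auto simp: height_le_def)
qed

lemma height_le_nat: "real k \<le> real D ^ h \<Longrightarrow> height_le D h (real k)"
  by (simp add: height_le_def)

lemma height_le_div:
  assumes "height_le D h x" "k dvd D" shows "height_le D (h + 1) (x / real k)"
proof -
  obtain q where q: "D = k * q" using assms by auto
  have k: "k \<ge> 1" using q D by (cases k) auto
  have "x / real k * real D ^ (h + 1) = x * real D ^ h * real q" using q k by simp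
  moreover have "\<bar>x / real k\<bar> \<le> \<bar>x\<bar> / 1" unfolding abs_divide using k by (intro divide_left_mono) auto
  ultimately show ?thesis using assms Dmono[of h "h + 1"] unfolding height_le_def by auto
qed

text \<open>\<open>X\<close> acts as a clock, advanced by the unit cost of the run: heights are
  polynomial in the elapsed time, with an exponent given by the level.\<close>

definition hst :: "nat \<Rightarrow> ram_state \<Rightarrow> bool" where
  "hst X s \<longleftrightarrow> nreg s 0 = n \<and> (\<forall>r. real (nreg s r) \<le> real D ^ X) \<and> (\<forall>a i j. height_le D (X ^ lv a) (rarr s a i j))"

lemma hst_mono:
  assumes "hst X s" "X \<le> Y" shows "hst Y s"
proof -
  have "X ^ k \<le> Y ^ k" for k using assms(2) by (rule power_mono) simp
  then show ?thesis using assms Dmono[OF assms(2)] unfolding hst_def by (meson height_le_mono order_trans)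
qed

lemma nval_le:
  assumes "hst X s" "nck e" shows "real (nval e s) \<le> real D ^ (X + nsz e)"
  using assms(2)
proof (induction e)
  case (NConst k)
  then have "real k \<le> real D ^ 1" using D16 by simp
  also have "\<dots> \<le> real D ^ (X + 1)" by (rule Dmono) simp
  finally show ?case by simp
next
  case (NReg r)
  have "real (nreg s r) \<le> real D ^ X" using assms by (auto simp: hst_def)
  also have "\<dots> \<le> real D ^ (X + 1)" by (rule Dmono) simp
  finally show ?case by simp
next
  case (NAdd d e)
  have "real (nval d s) \<le> real D ^ (X + nsz d)" "real (nval e s) \<le> real D ^ (X + nsz e)" using NAdd by simp_all
  then have "real (nval d s) + real (nval e s) \<le> real D ^ (X + nsz d) + real D ^ (X + nsz e)" by linarith
  also have "\<dots> \<le> real D ^ (max (X + nsz d) (X + nsz e) + 1)" by (rule two_powers)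
  also have "\<dots> \<le> real D ^ (X + nsz (NAdd d e))"
    using nsz_pos[of d] nsz_pos[of e] by (intro Dmono) auto
  finally show ?case by simp
next
  case (NSub d e)
  have "real (nval d s) \<le> real D ^ (X + nsz d)" using NSub by simp
  then have "real (nval d s - nval e s) \<le> real D ^ (X + nsz d)" by linarith
  also have "\<dots> \<le> real D ^ (X + nsz (NSub d e))" by (rule Dmono) simp
  finally show ?case by simp
qed

lemma rval_ht:
  assumes "hst X s" "rck e" shows "height_le D (rht lv X e) (rval e s)"
  using assms(2)
proof (induction e)
  case (OfNat e)
  then show ?case using nval_le[OF assms(1)] by (auto intro: height_le_nat)
next
  case (Div d e)
  then have "height_le D (rht lv X d) (rval d s)" by simp
  moreover have "\<exists>k. k dvd D \<and> rval e s = real k"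
    using Div.prems D assms(1) dvd_trans[of 2 16000 D] by (auto simp: hst_def)
  ultimately show ?case using height_le_div by auto
qed (use assms(1) in \<open>auto simp: hst_def intro: height_le_add[simplified] height_le_diff[simplified] height_le_mult\<close>)

context
  fixes w :: "real \<Rightarrow> nat" and W Xm :: nat
  assumes W: "\<And>x. height_le D (Xm ^ (K + 1)) x \<Longrightarrow> w x \<le> W" "W \<ge> 1" and BX: "B \<le> Xm"
begin

lemma size_bound: "X \<ge> 1 \<Longrightarrow> X \<le> Xm \<Longrightarrow> k \<le> B \<Longrightarrow> k * X ^ K \<le> Xm ^ (K + 1)"
  using BX by (simp add: mult_mono power_mono)

lemma ncost_le:
  assumes "hst X s" "nck e" "X \<ge> 1" "X \<le> Xm" "nsz e + 1 \<le> B"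
  shows "ncost w e s \<le> W * ncost uniform_charge e s"
proof -
  have K: "K \<ge> 1" using lv[of 0] by simp
  have h: "w (real (nval e s)) \<le> W" if "nck e" "nsz e + 1 \<le> B" for e
  proof -
    have "X + nsz e \<le> (nsz e + 1) * X" using assms(3) by simp
    also have "\<dots> \<le> (nsz e + 1) * X ^ K"
      using assms(3) K power_increasing[of 1 K X] by (intro mult_left_mono) auto
    also have "\<dots> \<le> Xm ^ (K + 1)" using size_bound assms that by blast
    finally show ?thesis
      using nval_le[OF assms(1) that(1)] by (intro W(1) height_le_mono[OF height_le_nat]) auto
  qed
  show ?thesis using assms(2,5)
  proof (induction e)
    case (NAdd d e)
    then show ?case using h[of "NAdd d e"] nsz_pos[of d] nsz_pos[of e] by (auto simp: algebra_simps uniform_charge_def[abs_def])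
  next
    case (NSub d e)
    then show ?case using h[of "NSub d e"] nsz_pos[of d] nsz_pos[of e] by (auto simp: algebra_simps uniform_charge_def[abs_def])
  next
    case (NConst k)
    then show ?case using h[of "NConst k"] by (simp add: uniform_charge_def[abs_def])
  next
    case (NReg r)
    then show ?case using h[of "NReg r"] by (simp add: uniform_charge_def[abs_def])
  qed
qed

lemma rcost_le:
  assumes "hst X s" "rck e" "X \<ge> 1" "X \<le> Xm" "rsz e \<le> B"
  shows "rcost w e s \<le> W * rcost uniform_charge e s"
proof -
  have K: "K \<ge> 1" using lv[of 0] by simp
  have h: "w (rval e s) \<le> W" if "rck e" "rsz e \<le> B" for e
  proof -
    have "rht lv X e \<le> rsz e * X ^ K" by (rule rht_le) (use assms K lv in auto)
    also have "\<dots> \<le> Xm ^ (K + 1)" using size_bound assms that by blast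
    finally show ?thesis by (rule W(1)[OF height_le_mono[OF rval_ht[OF assms(1) that(1)]]])
  qed
  show ?thesis using assms(2,5)
  proof (induction e)
    case (OfNat e)
    then show ?case using h[of "OfNat e"] ncost_le[OF assms(1), of e] assms(3,4)
      by (auto simp: algebra_simps uniform_charge_def[abs_def])
  next
    case (Entry a i j)
    then show ?case using h[of "Entry a i j"] ncost_le[OF assms(1), of i] ncost_le[OF assms(1), of j] assms(3,4)
      nsz_pos[of i] nsz_pos[of j] by (auto simp: algebra_simps uniform_charge_def[abs_def])
  next
    case (Add d e)
    then show ?case using h[of "Add d e"] by (auto simp: algebra_simps uniform_charge_def[abs_def])
  next
    case (Sub d e)
    then show ?case using h[of "Sub d e"] by (auto simp: algebra_simps uniform_charge_def[abs_def])
  next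
    case (Mul d e)
    then show ?case using h[of "Mul d e"] by (auto simp: algebra_simps uniform_charge_def[abs_def])
  next
    case (Div d e)
    have "rcost w d s \<le> W * rcost uniform_charge d s" using Div by auto
    moreover have "rck e" using Div.prems by auto
    then have "rcost w e s \<le> W * rcost uniform_charge e s" using Div by auto
    ultimately show ?case using h[of "Div d e"] Div.prems by (auto simp: algebra_simps uniform_charge_def[abs_def])
  qed
qed

lemma bcost_le:
  assumes "hst X s" "bck B b" "X \<ge> 1" "X \<le> Xm"
  shows "bcost w b s \<le> W * bcost uniform_charge b s"
  using assms(2)
proof (induction b)
  case (BLess d e)
  then show ?case using rcost_le[OF assms(1), of d] rcost_le[OF assms(1), of e] W(2) assms(3,4)
    by (auto simp: algebra_simps)
qed (use W(2) in \<open>auto simp: algebra_simps\<close>)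

text \<open>One factor of the same level and at most \<open>B \<le> X\<close> contributions two
  levels below give \<open>X ^ k + X ^ (k - 1) \<le> (X + 1) ^ k\<close>: one tick of the clock pays
  for an assignment to any array.\<close>

lemma assign_height:
  assumes "hst X s" "ack lv B a e" "B \<le> X" shows "height_le D ((X + 1) ^ lv a) (rval e s)"
proof -
  define k where "k = lv a"
  have k: "k \<ge> 3" using lv by (simp add: k_def)
  have X: "X \<ge> 1" using assms(3) B by simp
  have "k = Suc (Suc (k - 2))" using k by simp
  then obtain k' where k': "k = Suc (Suc k')" by blast
  have pw: "X ^ Suc m + X ^ m \<le> (X + 1) ^ Suc m" for m
  proof -
    have "X ^ Suc m + X ^ m = (X + 1) * X ^ m" by simp
    also have "\<dots> \<le> (X + 1) * (X + 1) ^ m" by (intro mult_left_mono power_mono) auto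
    finally show ?thesis by simp
  qed
  have "rht lv X e \<le> uc lv k e * X ^ k + rsz e * X ^ (k - 2)"
    by (rule rht_le_level) (use assms X k in \<open>auto simp: ack_def k_def\<close>)
  also have "\<dots> \<le> 1 * X ^ k + X * X ^ (k - 2)"
    using assms by (intro add_mono mult_right_mono) (auto simp: ack_def k_def)
  also have "\<dots> = X ^ Suc (Suc k') + X ^ Suc k'" by (simp add: k')
  also have "\<dots> \<le> (X + 1) ^ k" unfolding k' by (rule pw)
  finally show ?thesis using rval_ht[OF assms(1)] assms(2) by (auto simp: ack_def k_def intro: height_le_mono)
qed

text \<open>The unit-cost run supplies the clock for the heights, and these bound the charge of
  every number met by \<open>W\<close>. So the bit cost is at most \<open>W\<close> times the unit
  cost.\<close>

lemma exec_heights: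
  assumes "exec uniform_charge p s t s'" "pck lv B p" "hst X s" "B \<le> X" "X + t \<le> Xm"
  shows "hst (X + t) s' \<and> (\<exists>t'. exec w p s t' s' \<and> t' \<le> W * t)"
  using assms
proof (induction arbitrary: X rule: exec.induct)
  case (Skip s)
  then show ?case using W(2) exec.Skip[of w s] by (auto intro: hst_mono)
next
  case (NAssign r e s)
  have X: "X \<ge> 1" using NAssign B by simp
  have n: "nck e" using NAssign.prems(1) by auto
  have s': "hst (X + 1) (s\<lparr>nreg := (nreg s)(r := nval e s)\<rparr>)"
  proof -
    have "hst (X + 1) s" using NAssign.prems(2) by (rule hst_mono) simp
    moreover have "real (nval e s) \<le> real D ^ (X + 1)"
    proof -
      have "real (nreg s r) \<le> real D ^ X" using NAssign.prems by (auto simp: hst_def)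
      moreover have "real D ^ X + 1 \<le> real D ^ (X + 1)" using two_powers[of X 0] by simp
      moreover have "real (nval e s) \<le> real (nreg s r) + 1" using NAssign.prems(1) by auto
      ultimately show ?thesis by linarith
    qed
    ultimately show ?thesis using NAssign.prems(1) by (auto simp: hst_def)
  qed
  have "ncost w e s \<le> W * ncost uniform_charge e s"
  proof (cases "B \<ge> 3")
    case True
    then show ?thesis using NAssign.prems X n by (intro ncost_le[OF NAssign.prems(2)]) auto
  next
    case False
    have small_part: "w (real k) \<le> W" if "real k \<le> real D ^ (X + 1)" for k
    proof -
      have "X + 1 \<le> Xm" using NAssign.prems(4) by simp
      also have "Xm \<le> Xm ^ (K + 1)" using X NAssign.prems(4) power_increasing[of 1 "K + 1" Xm] by simp
      finally show ?thesis using that by (intro W(1) height_le_mono[OF height_le_nat])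
    qed
    have r: "real (nreg s r) \<le> real D ^ X" using NAssign.prems by (auto simp: hst_def)
    have "real D ^ X + 1 \<le> real D ^ (X + 1)" using two_powers[of X 0] by simp
    then have "real (nreg s r) \<le> real D ^ (X + 1)" "real (nreg s r + 1) \<le> real D ^ (X + 1)"
      "real 0 \<le> real D ^ (X + 1)" "real 1 \<le> real D ^ (X + 1)"
      using r Dp[of "X + 1"] by linarith+
    from this[THEN small_part] show ?thesis using NAssign.prems(1) by (auto simp: uniform_charge_def[abs_def] algebra_simps)
  qed
  then have "ncost w e s + 1 \<le> W * (ncost uniform_charge e s + 1)" using W(2) by (simp add: algebra_simps)
  moreover have "hst (X + (ncost uniform_charge e s + 1)) (s\<lparr>nreg := (nreg s)(r := nval e s)\<rparr>)"
    using s' by (rule hst_mono) simp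
  ultimately show ?case using exec.NAssign by blast
next
  case (RAssign a i j e s)
  have X: "X \<ge> 1" "X \<le> Xm" using RAssign.prems B by auto
  let ?s' = "s\<lparr>rarr := (rarr s)(a := (rarr s a)(nval i s := (rarr s a (nval i s))(nval j s := rval e s)))\<rparr>"
  let ?t = "ncost uniform_charge i s + ncost uniform_charge j s + rcost uniform_charge e s + 1"
  have "hst (X + 1) s" using RAssign.prems(2) by (rule hst_mono) simp
  then have "hst (X + 1) ?s'"
    using assign_height[of X s a e] RAssign.prems by (auto simp: hst_def)
  then have "hst (X + ?t) ?s'" by (rule hst_mono) simp
  moreover have "ncost w i s \<le> W * ncost uniform_charge i s" "ncost w j s \<le> W * ncost uniform_charge j s"
    "rcost w e s \<le> W * rcost uniform_charge e s"
    using RAssign.prems X nsz_pos[of i] nsz_pos[of j]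
    by (auto simp: ack_def intro!: ncost_le[where X = X] rcost_le[where X = X])
  then have "ncost w i s + ncost w j s + rcost w e s + 1 \<le> W * ?t" using W(2) by (simp add: algebra_simps)
  ultimately show ?case using exec.RAssign by blast
next
  case (Seq p s t s' q t' s'')
  from Seq.IH(1)[of X] Seq.prems obtain u where u: "hst (X + t) s'" "exec w p s u s'" "u \<le> W * t" by auto
  from Seq.IH(2)[of "X + t"] Seq.prems u obtain u' where u': "hst (X + t + t') s''" "exec w q s' u' s''" "u' \<le> W * t'"
    by auto
  show ?case using u u' exec.Seq[OF u(2) u'(2)] by (auto simp: algebra_simps intro!: exI[of _ "u + u'"])
next
  case (CondTrue b s p t s' q)
  from CondTrue.IH[of X] CondTrue.prems obtain u where u: "hst (X + t) s'" "exec w p s u s'" "u \<le> W * t" by auto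
  have "bcost w b s \<le> W * bcost uniform_charge b s" using CondTrue.prems B by (intro bcost_le[of X]) auto
  moreover have "hst (X + (bcost uniform_charge b s + t)) s'" using u(1) by (rule hst_mono) simp
  ultimately show ?case using u exec.CondTrue[OF CondTrue.hyps(1) u(2)]
    by (intro conjI exI[of _ "bcost w b s + u"]) (auto simp: algebra_simps)
next
  case (CondFalse b s q t s' p)
  from CondFalse.IH[of X] CondFalse.prems obtain u where u: "hst (X + t) s'" "exec w q s u s'" "u \<le> W * t" by auto
  have "bcost w b s \<le> W * bcost uniform_charge b s" using CondFalse.prems B by (intro bcost_le[of X]) auto
  moreover have "hst (X + (bcost uniform_charge b s + t)) s'" using u(1) by (rule hst_mono) simp
  ultimately show ?case using u exec.CondFalse[OF CondFalse.hyps(1) u(2)]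
    by (intro conjI exI[of _ "bcost w b s + u"]) (auto simp: algebra_simps)
next
  case (WhileFalse b s p)
  have "bcost w b s \<le> W * bcost uniform_charge b s" using WhileFalse.prems B by (intro bcost_le[of X]) auto
  then show ?case using exec.WhileFalse[OF WhileFalse.hyps] WhileFalse.prems hst_mono by (meson le_add1)
next
  case (WhileTrue b s p t s' t' s'')
  have b: "bcost w b s \<le> W * bcost uniform_charge b s" using WhileTrue.prems B by (intro bcost_le[of X]) auto
  from WhileTrue.IH(1)[of X] WhileTrue.prems obtain u where u: "hst (X + t) s'" "exec w p s u s'" "u \<le> W * t" by auto
  from WhileTrue.IH(2)[of "X + t"] WhileTrue.prems u obtain u' where
    u': "hst (X + t + t') s''" "exec w (While b p) s' u' s''" "u' \<le> W * t'" by auto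
  have "hst (X + (bcost uniform_charge b s + t + t')) s''" using u'(1) by (rule hst_mono) simp
  then show ?case using b u u' exec.WhileTrue[OF WhileTrue.hyps(1) u(2) u'(2)]
    by (intro conjI exI[of _ "bcost w b s + u + u'"]) (auto simp: algebra_simps)
qed

end

end

text \<open>In lowest terms the denominator divides \<open>D ^ h\<close>, and then the numerator is
  at most \<open>D ^ (2 * h)\<close>; together \<open>3 * h * b\<close> bits.\<close>

lemma bit_length_le:
  assumes "height_le D h x" "real D < 2 ^ b" "h \<ge> 1" "D \<ge> 1"
  shows "bit_length x \<le> 3 * h * b"
proof -
  obtain z where z: "x * real D ^ h = of_int z" using assms(1) by (auto simp: height_le_def elim: Ints_cases)
  define y where "y = Fract z (int D ^ h)"
  have D: "real D ^ h > 0" using assms by simp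
  have x: "x = of_rat y"
    using z D assms(4) by (simp add: y_def of_rat_rat field_simps)
  have inv: "the_inv (of_rat :: rat \<Rightarrow> real) x = y"
    unfolding x by (rule the_inv_f_f) (simp add: inj_on_def)
  obtain p q where pq: "quotient_of y = (p, q)" by (cases "quotient_of y")
  have q: "q > 0" using pq by (rule quotient_of_denom_pos)
  have cop: "coprime p q" using pq by (rule quotient_of_coprime)
  have yd: "y = of_int p / of_int q" using pq by (rule quotient_of_div)
  have cross: "p * int D ^ h = z * q"
  proof -
    have "of_int p * real D ^ h = of_int z * (of_int q :: real)"
      using z q D by (simp add: x yd of_rat_divide field_simps)
    then have "(of_int (p * int D ^ h) :: real) = of_int (z * q)" by simp
    then show ?thesis by (simp only: of_int_eq_iff)
  qed
  have Dh: "real D ^ h < 2 ^ (h * b)"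
    using power_strict_mono[OF assms(2), of h] assms(3) by (simp add: power_mult[symmetric] mult.commute)
  have "q dvd p * int D ^ h" using cross by simp
  then have "q dvd int D ^ h" using cop by (simp add: coprime_commute coprime_dvd_mult_right_iff)
  then have "q \<le> int D ^ h" using assms(4) by (intro zdvd_imp_le) auto
  then have ql: "real_of_int q \<le> real D ^ h"
    by (metis of_int_le_iff of_int_of_nat_eq of_int_power)
  have pl: "\<bar>real_of_int p\<bar> \<le> real D ^ h * real D ^ h"
  proof -
    have "\<bar>real_of_int p\<bar> = \<bar>x\<bar> * real_of_int q" using q by (simp add: x yd of_rat_divide)
    also have "\<dots> \<le> real D ^ h * real D ^ h" using assms(1) ql q by (intro mult_mono) (auto simp: height_le_def)
    finally show ?thesis .
  qed
  have "q < 2 ^ (h * b)"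
  proof -
    have "real_of_int q < 2 ^ (h * b)" using ql Dh by linarith
    then show ?thesis by (metis of_int_less_iff of_int_numeral of_int_power)
  qed
  then have bq: "bitlen q \<le> int (h * b)" using q by (simp add: bitlen_le_iff_power del: of_nat_mult)
  have "\<bar>p\<bar> < 2 ^ (2 * h * b)"
  proof -
    have "real D ^ h * real D ^ h < 2 ^ (h * b) * 2 ^ (h * b)" using Dh D by (intro mult_strict_mono) auto
    moreover have "(2::real) ^ (2 * h * b) = 2 ^ (h * b) * 2 ^ (h * b)" by (simp add: power_add[symmetric] mult_2 distrib_right)
    ultimately have "\<bar>real_of_int p\<bar> < 2 ^ (2 * h * b)" using pl by linarith
    then have "real_of_int \<bar>p\<bar> < 2 ^ (2 * h * b)" by simp
    then show ?thesis by (metis of_int_less_iff of_int_numeral of_int_power)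
  qed
  then have bp: "bitlen \<bar>p\<bar> \<le> int (2 * h * b)" by (simp add: bitlen_le_iff_power del: of_nat_mult)
  have "bit_length x = nat (bitlen \<bar>p\<bar> + bitlen q)" by (simp add: bit_length_def inv pq)
  then show ?thesis using bp bq by (simp add: nat_le_iff algebra_simps)
qed

subsection \<open>Programs built from array assignments\<close>

datatype cexp = CR rexp | CI bexp cexp cexp

text \<open>\<open>Fill a I J L x\<close> simultaneously assigns the sum of \<open>x\<close> over register 3 to all entries of
  array \<open>a\<close> indexed by registers 1 and 2; a bound \<open>(c, k)\<close> stands for \<open>c * n ^ k\<close>. The sums are
  accumulated in array \<open>a + 50\<close>.\<close>

datatype gprog =
    GSkip
  | Fill nat "nat \<times> nat" "nat \<times> nat" "nat \<times> nat" cexp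
  | GSeq gprog gprog
  | GIf bexp gprog gprog
  | GRep nat "nat \<times> nat" gprog

type_synonym store = "nat \<Rightarrow> nat \<Rightarrow> nat \<Rightarrow> real"

section \<open>Denotational semantics and compilation of the array programs\<close>

definition cst :: "nat \<Rightarrow> nat \<Rightarrow> nat \<Rightarrow> nat \<Rightarrow> store \<Rightarrow> ram_state" where
  "cst n i j l M = \<lparr>nreg = (\<lambda>r. if r = 0 then n else if r = 1 then i else if r = 2 then j else if r = 3 then l else 0),
     rarr = M\<rparr>"

fun cval :: "cexp \<Rightarrow> ram_state \<Rightarrow> real" where
  "cval (CR e) s = rval e s"
| "cval (CI b x y) s = (if bval b s then cval x s else cval y s)"

definition bnd :: "nat \<times> nat \<Rightarrow> nat \<Rightarrow> nat" where "bnd L n = fst L * n ^ snd L"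

definition fillv :: "nat \<Rightarrow> nat \<times> nat \<Rightarrow> cexp \<Rightarrow> store \<Rightarrow> nat \<Rightarrow> nat \<Rightarrow> real" where
  "fillv n L x M i j = (\<Sum>l<bnd L n. cval x (cst n i j l M))"

definition upd :: "nat \<Rightarrow> nat \<Rightarrow> (nat \<Rightarrow> nat \<Rightarrow> real) \<Rightarrow> (nat \<Rightarrow> nat \<Rightarrow> real) \<Rightarrow> nat \<Rightarrow> nat \<Rightarrow> real" where
  "upd I J f h i j = (if i < I \<and> j < J then f i j else h i j)"

fun sem :: "nat \<Rightarrow> gprog \<Rightarrow> store \<Rightarrow> store" where
  "sem n GSkip M = M"
| "sem n (Fill a I J L x) M = M(a + 50 := upd (bnd I n) (bnd J n) (fillv n L x M) (M (a + 50)),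
     a := upd (bnd I n) (bnd J n) (fillv n L x M) (M a))"
| "sem n (GSeq p q) M = sem n q (sem n p M)"
| "sem n (GIf b p q) M = (if bval b (cst n 0 0 0 M) then sem n p M else sem n q M)"
| "sem n (GRep r L p) M = (sem n p ^^ bnd L n) M"

fun nrg :: "nexp \<Rightarrow> nat set" where
  "nrg (NConst k) = {}"
| "nrg (NReg r) = {r}"
| "nrg (NAdd d e) = nrg d \<union> nrg e"
| "nrg (NSub d e) = nrg d \<union> nrg e"

fun rrg :: "rexp \<Rightarrow> nat set" where
  "rrg (OfNat e) = nrg e"
| "rrg (Entry a i j) = nrg i \<union> nrg j"
| "rrg (Add d e) = rrg d \<union> rrg e"
| "rrg (Sub d e) = rrg d \<union> rrg e"
| "rrg (Mul d e) = rrg d \<union> rrg e"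
| "rrg (Div d e) = rrg d \<union> rrg e"

fun rar :: "rexp \<Rightarrow> nat set" where
  "rar (OfNat e) = {}"
| "rar (Entry a i j) = {a}"
| "rar (Add d e) = rar d \<union> rar e"
| "rar (Sub d e) = rar d \<union> rar e"
| "rar (Mul d e) = rar d \<union> rar e"
| "rar (Div d e) = rar d \<union> rar e"

fun brg :: "bexp \<Rightarrow> nat set" where
  "brg (BLess d e) = rrg d \<union> rrg e"
| "brg (BNot b) = brg b"
| "brg (BAnd b c) = brg b \<union> brg c"

fun bar :: "bexp \<Rightarrow> nat set" where
  "bar (BLess d e) = rar d \<union> rar e"
| "bar (BNot b) = bar b"
| "bar (BAnd b c) = bar b \<union> bar c"

fun crg :: "cexp \<Rightarrow> nat set" where
  "crg (CR e) = rrg e"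
| "crg (CI b x y) = brg b \<union> crg x \<union> crg y"

fun car :: "cexp \<Rightarrow> nat set" where
  "car (CR e) = rar e"
| "car (CI b x y) = bar b \<union> car x \<union> car y"

fun gregs :: "gprog \<Rightarrow> nat set" where
  "gregs GSkip = {}"
| "gregs (Fill a I J L x) = {1, 2, 3}"
| "gregs (GSeq p q) = gregs p \<union> gregs q"
| "gregs (GIf b p q) = gregs p \<union> gregs q"
| "gregs (GRep r L p) = insert r (gregs p)"

fun well_formed :: "gprog \<Rightarrow> bool" where
  "well_formed GSkip \<longleftrightarrow> True"
| "well_formed (Fill a I J L x) \<longleftrightarrow> a < 50 \<and> crg x \<subseteq> {0, 1, 2, 3} \<and> a + 50 \<notin> car x"
| "well_formed (GSeq p q) \<longleftrightarrow> well_formed p \<and> well_formed q"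
| "well_formed (GIf b p q) \<longleftrightarrow> brg b \<subseteq> {0} \<and> well_formed p \<and> well_formed q"
| "well_formed (GRep r L p) \<longleftrightarrow> r \<ge> 4 \<and> r \<notin> gregs p \<and> well_formed p"

text \<open>Natural numbers have no product on this machine, so loop bounds \<open>c * n ^ k\<close>
  are formed and compared as reals.\<close>

fun npow :: "nat \<Rightarrow> rexp" where
  "npow 0 = OfNat (NConst 1)"
| "npow (Suc k) = Mul (OfNat (NReg 0)) (npow k)"

definition guard :: "nat \<Rightarrow> nat \<times> nat \<Rightarrow> bexp" where
  "guard r L = BLess (OfNat (NReg r)) (Mul (OfNat (NConst (fst L))) (npow (snd L)))"

definition for_loop :: "nat \<Rightarrow> nat \<times> nat \<Rightarrow> prog \<Rightarrow> prog" where
  "for_loop r L b = Seq (NAssign r (NConst 0)) (While (guard r L) (Seq b (NAssign r (NAdd (NReg r) (NConst 1)))))"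

text \<open>Expressions of the machine contain no case distinction, so each branch performs its own
  assignment.\<close>

fun cmp :: "nat \<Rightarrow> cexp \<Rightarrow> prog" where
  "cmp a (CR e) = RAssign (a + 50) (NReg 1) (NReg 2) (Add (Entry (a + 50) (NReg 1) (NReg 2)) e)"
| "cmp a (CI b x y) = Cond b (cmp a x) (cmp a y)"

fun gcomp :: "gprog \<Rightarrow> prog" where
  "gcomp GSkip = Skip"
| "gcomp (Fill a I J L x) = Seq
     (for_loop 1 I (for_loop 2 J (Seq (RAssign (a + 50) (NReg 1) (NReg 2) (OfNat (NConst 0))) (for_loop 3 L (cmp a x)))))
     (for_loop 1 I (for_loop 2 J (RAssign a (NReg 1) (NReg 2) (Entry (a + 50) (NReg 1) (NReg 2)))))"
| "gcomp (GSeq p q) = Seq (gcomp p) (gcomp q)"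
| "gcomp (GIf b p q) = Cond b (gcomp p) (gcomp q)"
| "gcomp (GRep r L p) = for_loop r L (gcomp p)"

lemma nval_cong: "(\<And>r. r \<in> nrg e \<Longrightarrow> nreg s r = nreg s' r) \<Longrightarrow> nval e s = nval e s'"
  by (induction e) auto

lemma rval_cong:
  "(\<And>r. r \<in> rrg e \<Longrightarrow> nreg s r = nreg s' r) \<Longrightarrow> (\<And>a. a \<in> rar e \<Longrightarrow> rarr s a = rarr s' a) \<Longrightarrow> rval e s = rval e s'"
  by (induction e) (auto cong: nval_cong)

lemma bval_cong:
  "(\<And>r. r \<in> brg b \<Longrightarrow> nreg s r = nreg s' r) \<Longrightarrow> (\<And>a. a \<in> bar b \<Longrightarrow> rarr s a = rarr s' a) \<Longrightarrow> bval b s = bval b s'"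
proof (induction b)
  case (BLess d e)
  have "rval d s = rval d s'" "rval e s = rval e s'" by (rule rval_cong; use BLess in auto)+
  then show ?case by simp
qed auto

text \<open>Unit costs depend on the expression only and can therefore be evaluated in the arbitrary
  state \<open>st0\<close>.\<close>

lemma ncost_const: "ncost uniform_charge e s = ncost uniform_charge e s'"
  by (induction e) (auto simp: uniform_charge_def)

lemma rcost_const: "rcost uniform_charge e s = rcost uniform_charge e s'"
proof (induction e)
  case (OfNat e)
  then show ?case using ncost_const[of e s s'] by (simp add: uniform_charge_def[abs_def])
next
  case (Entry a i j)
  then show ?case using ncost_const[of i s s'] ncost_const[of j s s'] by (simp add: uniform_charge_def[abs_def])
qed (simp_all add: uniform_charge_def)

lemma bcost_const: "bcost uniform_charge b s = bcost uniform_charge b s'"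
  by (induction b) (auto simp: rcost_const[of _ s s'])

definition st0 :: ram_state where "st0 = cst 0 0 0 0 (\<lambda>_ _ _. 0)"

fun cmptime :: "cexp \<Rightarrow> nat" where
  "cmptime (CR e) = rcost uniform_charge e st0 + 7"
| "cmptime (CI b x y) = bcost uniform_charge b st0 + cmptime x + cmptime y"

definition looptime :: "nat \<times> nat \<Rightarrow> nat \<Rightarrow> nat \<Rightarrow> nat" where
  "looptime L n T = bnd L n * (T + 12 + 3 * snd L) + 10 + 3 * snd L"

fun gtime :: "nat \<Rightarrow> gprog \<Rightarrow> nat" where
  "gtime n GSkip = 1"
| "gtime n (Fill a I J L x) = looptime I n (looptime J n (5 + looptime L n (cmptime x))) + looptime I n (looptime J n 6)"
| "gtime n (GSeq p q) = gtime n p + gtime n q"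
| "gtime n (GIf b p q) = bcost uniform_charge b st0 + gtime n p + gtime n q"
| "gtime n (GRep r L p) = looptime L n (gtime n p)"

section \<open>Correctness and running time of compiled programs\<close>

definition runs :: "nat set \<Rightarrow> prog \<Rightarrow> ram_state \<Rightarrow> nat \<Rightarrow> store \<Rightarrow> bool" where
  "runs Rg p s T M \<longleftrightarrow> (\<exists>t s'. exec uniform_charge p s t s' \<and> t \<le> T \<and> rarr s' = M \<and> (\<forall>q. q \<notin> Rg \<longrightarrow> nreg s' q = nreg s q))"

lemma runs_Seq:
  assumes "runs R1 p s T1 M1"
    and "\<And>s'. rarr s' = M1 \<Longrightarrow> (\<forall>q. q \<notin> R1 \<longrightarrow> nreg s' q = nreg s q) \<Longrightarrow> runs R2 q s' T2 M2"
  shows "runs (R1 \<union> R2) (Seq p q) s (T1 + T2) M2"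
proof -
  obtain t s' where 1: "exec uniform_charge p s t s'" "t \<le> T1" "rarr s' = M1" "\<forall>q. q \<notin> R1 \<longrightarrow> nreg s' q = nreg s q"
    using assms(1) by (auto simp: runs_def)
  obtain t' s'' where 2: "exec uniform_charge q s' t' s''" "t' \<le> T2" "rarr s'' = M2" "\<forall>q. q \<notin> R2 \<longrightarrow> nreg s'' q = nreg s' q"
    using assms(2)[OF 1(3,4)] by (auto simp: runs_def)
  show ?thesis unfolding runs_def
    by (intro exI[of _ "t + t'"] exI[of _ s'']) (use 1 2 exec.Seq[OF 1(1) 2(1)] in auto)
qed

lemma rval_npow: "rval (npow k) s = real (nreg s 0 ^ k)" by (induction k) auto

lemma rcost_npow: "rcost uniform_charge (npow k) s = 2 + 3 * k"
  by (induction k) (auto simp: uniform_charge_def)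

lemma bval_guard: "nreg s 0 = n \<Longrightarrow> bval (guard r L) s \<longleftrightarrow> nreg s r < bnd L n"
proof -
  assume n: "nreg s 0 = n"
  have "bval (guard r L) s \<longleftrightarrow> real (nreg s r) < real (fst L * n ^ snd L)"
    by (simp add: guard_def rval_npow n)
  then show ?thesis by (simp only: of_nat_less_iff bnd_def)
qed

lemma bcost_guard: "bcost uniform_charge (guard r L) s = 8 + 3 * snd L"
  by (simp add: guard_def rcost_npow uniform_charge_def)

text \<open>Prescribing the memory \<open>F i\<close> after \<open>i\<close> rounds takes the place
  of a loop invariant. As \<open>r\<close> is not in \<open>Rg\<close>, the body leaves the counter
  alone.\<close>

lemma runs_for:
  assumes s: "nreg s 0 = n" and r: "r \<noteq> 0" "r \<notin> Rg" "0 \<notin> Rg" and F0: "F 0 = rarr s"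
    and body: "\<And>i s'. i < bnd L n \<Longrightarrow> rarr s' = F i \<Longrightarrow> nreg s' r = i \<Longrightarrow>
       (\<forall>q. q \<notin> insert r Rg \<longrightarrow> nreg s' q = nreg s q) \<Longrightarrow> runs Rg b s' T (F (Suc i))"
  shows "runs (insert r Rg) (for_loop r L b) s (looptime L n T) (F (bnd L n))"
proof -
  define W where "W = While (guard r L) (Seq b (NAssign r (NAdd (NReg r) (NConst 1))))"
  have main: "\<exists>t s'. exec uniform_charge W s1 t s' \<and> t \<le> k * (T + 12 + 3 * snd L) + 8 + 3 * snd L \<and> rarr s' = F (bnd L n) \<and>
      (\<forall>q. q \<notin> insert r Rg \<longrightarrow> nreg s' q = nreg s q)"
    if "rarr s1 = F i" "nreg s1 r = i" "\<forall>q. q \<notin> insert r Rg \<longrightarrow> nreg s1 q = nreg s q" "i + k = bnd L n" for k i s1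
    using that
  proof (induction k arbitrary: i s1)
    case 0
    have n: "nreg s1 0 = n" using 0 r s by simp
    have "\<not> bval (guard r L) s1" using bval_guard[OF n] 0 by simp
    then have "exec uniform_charge W s1 (8 + 3 * snd L) s1"
      unfolding W_def using exec.WhileFalse[of "guard r L" s1 uniform_charge] by (simp add: bcost_guard)
    then show ?case using 0 by (intro exI[of _ "8 + 3 * snd L"] exI[of _ s1]) auto
  next
    case (Suc k)
    have n: "nreg s1 0 = n" using Suc r s by simp
    have i: "i < bnd L n" using Suc by simp
    have g: "bval (guard r L) s1" using bval_guard[OF n] Suc by simp
    obtain t s2 where b: "exec uniform_charge b s1 t s2" "t \<le> T" "rarr s2 = F (Suc i)" "\<forall>q. q \<notin> Rg \<longrightarrow> nreg s2 q = nreg s1 q"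
      using body[OF i Suc.prems(1-3)] by (auto simp: runs_def)
    define s3 where "s3 = s2\<lparr>nreg := (nreg s2)(r := nval (NAdd (NReg r) (NConst 1)) s2)\<rparr>"
    have inc: "exec uniform_charge (NAssign r (NAdd (NReg r) (NConst 1))) s2 4 s3"
      using exec.NAssign[of uniform_charge r "NAdd (NReg r) (NConst 1)" s2] by (simp add: s3_def uniform_charge_def eval_nat_numeral)
    have s3: "rarr s3 = F (Suc i)" "nreg s3 r = Suc i" "\<forall>q. q \<notin> insert r Rg \<longrightarrow> nreg s3 q = nreg s q"
      using b r Suc.prems by (auto simp: s3_def)
    obtain t' s' where w: "exec uniform_charge W s3 t' s'" "t' \<le> k * (T + 12 + 3 * snd L) + 8 + 3 * snd L" "rarr s' = F (bnd L n)"
      "\<forall>q. q \<notin> insert r Rg \<longrightarrow> nreg s' q = nreg s q"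
      using Suc.IH[OF s3] Suc.prems by auto
    have "exec uniform_charge W s1 (8 + 3 * snd L + (t + 4) + t') s'"
      unfolding W_def using exec.WhileTrue[OF g exec.Seq[OF b(1) inc] w(1)[unfolded W_def]] by (simp add: bcost_guard)
    then show ?case using w b(2) by (intro exI[of _ "8 + 3 * snd L + (t + 4) + t'"] exI[of _ s']) auto
  qed
  define s1 where "s1 = s\<lparr>nreg := (nreg s)(r := 0)\<rparr>"
  have init: "exec uniform_charge (NAssign r (NConst 0)) s 2 s1"
    using exec.NAssign[of uniform_charge r "NConst 0" s] by (simp add: s1_def uniform_charge_def eval_nat_numeral)
  have "rarr s1 = F 0" "nreg s1 r = 0" "\<forall>q. q \<notin> insert r Rg \<longrightarrow> nreg s1 q = nreg s q" "0 + bnd L n = bnd L n"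
    by (auto simp: s1_def F0)
  from main[OF this] obtain t s' where w: "exec uniform_charge W s1 t s'" "t \<le> bnd L n * (T + 12 + 3 * snd L) + 8 + 3 * snd L"
    "rarr s' = F (bnd L n)" "\<forall>q. q \<notin> insert r Rg \<longrightarrow> nreg s' q = nreg s q" by blast
  show ?thesis unfolding runs_def for_loop_def W_def[symmetric] looptime_def
    by (intro exI[of _ "2 + t"] exI[of _ s']) (use exec.Seq[OF init w(1)] w in auto)
qed

definition setc :: "store \<Rightarrow> nat \<Rightarrow> nat \<Rightarrow> nat \<Rightarrow> real \<Rightarrow> store" where
  "setc M a i j v = M(a := (M a)(i := (M a i)(j := v)))"

lemma runs_assign:
  assumes "nreg s 1 = i" "nreg s 2 = j" "rcost uniform_charge e s + 3 \<le> T" "rval e s = v" "M' = setc (rarr s) a i j v"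
  shows "runs {} (RAssign a (NReg 1) (NReg 2) e) s T M'"
proof -
  have "exec uniform_charge (RAssign a (NReg 1) (NReg 2) e) s (rcost uniform_charge e s + 3) (s\<lparr>rarr := setc (rarr s) a i j v\<rparr>)"
    using exec.RAssign[of uniform_charge a "NReg 1" "NReg 2" e s] assms
    by (simp add: setc_def uniform_charge_def eval_nat_numeral)
  then show ?thesis unfolding runs_def using assms
    by (intro exI[of _ "rcost uniform_charge e s + 3"] exI[of _ "s\<lparr>rarr := setc (rarr s) a i j v\<rparr>"]) auto
qed

lemma runs_cmp:
  assumes "crg x \<subseteq> {0, 1, 2, 3}" "a + 50 \<notin> car x"
    and "nreg s 0 = n" "nreg s 1 = i" "nreg s 2 = j" "nreg s 3 = l" "\<And>b. b \<noteq> a + 50 \<Longrightarrow> rarr s b = M b"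
  shows "runs {} (cmp a x) s (cmptime x) (setc (rarr s) (a + 50) i j (rarr s (a + 50) i j + cval x (cst n i j l M)))"
  using assms(1,2)
proof (induction x)
  case (CR e)
  have "rarr s b = M b" if "b \<in> rar e" for b using that CR.prems assms(7)[of b] by auto
  then have "rval e s = rval e (cst n i j l M)"
    by (intro rval_cong) (use CR assms(3-6) in \<open>auto simp: cst_def\<close>)
  then show ?case unfolding cmp.simps
    by (intro runs_assign) (use assms in \<open>auto simp: uniform_charge_def rcost_const[of e s st0]\<close>)
next
  case (CI b x y)
  have "rarr s b' = M b'" if "b' \<in> bar b" for b' using that CI.prems assms(7)[of b'] by auto
  then have b: "bval b s = bval b (cst n i j l M)"
    by (intro bval_cong) (use CI.prems assms(3-6) in \<open>auto simp: cst_def\<close>)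
  show ?case
  proof (cases "bval b s")
    case True
    obtain t s' where "exec uniform_charge (cmp a x) s t s'" "t \<le> cmptime x"
      "rarr s' = setc (rarr s) (a + 50) i j (rarr s (a + 50) i j + cval x (cst n i j l M))" "\<forall>q. nreg s' q = nreg s q"
      using CI by (auto simp: runs_def)
    moreover from exec.CondTrue[OF True this(1)] have "exec uniform_charge (Cond b (cmp a x) (cmp a y)) s (bcost uniform_charge b s + t) s'" .
    ultimately show ?thesis using True b unfolding runs_def
      by (intro exI[of _ "bcost uniform_charge b s + t"] exI[of _ s']) (auto simp: bcost_const[of b s st0])
  next
    case False
    obtain t s' where "exec uniform_charge (cmp a y) s t s'" "t \<le> cmptime y"
      "rarr s' = setc (rarr s) (a + 50) i j (rarr s (a + 50) i j + cval y (cst n i j l M))" "\<forall>q. nreg s' q = nreg s q"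
      using CI by (auto simp: runs_def)
    moreover from exec.CondFalse[OF False this(1)] have "exec uniform_charge (Cond b (cmp a x) (cmp a y)) s (bcost uniform_charge b s + t) s'" .
    ultimately show ?thesis using False b unfolding runs_def
      by (intro exI[of _ "bcost uniform_charge b s + t"] exI[of _ s']) (auto simp: bcost_const[of b s st0])
  qed
qed

lemma runs_fill:
  assumes s: "nreg s 0 = n" "rarr s = M" and ok: "a < 50" "crg x \<subseteq> {0, 1, 2, 3}" "a + 50 \<notin> car x"
  shows "runs {1, 2, 3} (gcomp (Fill a I J L x)) s (gtime n (Fill a I J L x)) (sem n (Fill a I J L x) M)"
proof -
  define t where "t = a + 50"
  have ta: "t \<noteq> a" by (simp add: t_def)
  define S where "S = fillv n L x M"
  \<comment> \<open>\<open>F\<close>, \<open>G\<close> and \<open>H\<close> are the memories with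
    \<open>i\<close> finished rows, with \<open>j\<close> finished entries of row \<open>i\<close>,
    and with a partial sum of \<open>l\<close> terms. The values refer to the original
    \<open>M\<close>, because the first pass writes only the buffer, which \<open>x\<close> does not
    read.\<close>
  define F where "F i = M(t := upd i (bnd J n) S (M t))" for i
  define G where "G i j = (F i)(t := (F i t)(i := (\<lambda>j'. if j' < j then S i j' else F i t i j')))" for i j
  define H where "H i j l = setc (G i j) t i j (\<Sum>l'<l. cval x (cst n i j l' M))" for i j l
  have off: "H i j l b = M b" "G i j b = M b" if "b \<noteq> t" for i j l b using that by (auto simp: H_def G_def F_def setc_def)
  have 1: "runs {1, 2, 3} (for_loop 1 I (for_loop 2 J (Seq (RAssign t (NReg 1) (NReg 2) (OfNat (NConst 0))) (for_loop 3 L (cmp a x)))))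
     s (looptime I n (looptime J n (5 + looptime L n (cmptime x)))) (F (bnd I n))"
  proof (rule runs_for[where F = F and Rg = "{2, 3}" and r = 1 and s = s and n = n, OF s(1)])
    show "F 0 = rarr s" by (simp add: F_def s upd_def fun_upd_def fun_eq_iff)
    fix i and s1 :: ram_state assume i: "rarr s1 = F i" "nreg s1 1 = i" "\<forall>q. q \<notin> {1, 2, 3} \<longrightarrow> nreg s1 q = nreg s q"
    have Fs: "F (Suc i) = G i (bnd J n)" by (auto simp: F_def G_def upd_def fun_eq_iff less_Suc_eq)
    have n1: "nreg s1 0 = n" using i s by simp
    show "runs {2, 3} (for_loop 2 J (Seq (RAssign t (NReg 1) (NReg 2) (OfNat (NConst 0))) (for_loop 3 L (cmp a x))))
     s1 (looptime J n (5 + looptime L n (cmptime x))) (F (Suc i))"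
      unfolding Fs
    proof (rule runs_for[where F = "G i" and Rg = "{3}" and r = 2 and s = s1 and n = n, OF n1])
      show "G i 0 = rarr s1" by (simp add: G_def i fun_upd_def fun_eq_iff)
      fix j and s2 :: ram_state assume j: "rarr s2 = G i j" "nreg s2 2 = j" "\<forall>q. q \<notin> {2, 3} \<longrightarrow> nreg s2 q = nreg s1 q"
      have n2: "nreg s2 0 = n" "nreg s2 1 = i" using j n1 i by auto
      have Gs: "G i (Suc j) = H i j (bnd L n)"
        by (auto simp: G_def H_def setc_def fun_eq_iff less_Suc_eq S_def fillv_def)
      have "runs ({} \<union> {3}) (Seq (RAssign t (NReg 1) (NReg 2) (OfNat (NConst 0))) (for_loop 3 L (cmp a x))) s2
        (5 + looptime L n (cmptime x)) (H i j (bnd L n))"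
      proof (rule runs_Seq)
        show "runs {} (RAssign t (NReg 1) (NReg 2) (OfNat (NConst 0))) s2 5 (H i j 0)"
          by (rule runs_assign) (use n2 j in \<open>auto simp: H_def uniform_charge_def\<close>)
        fix s3 :: ram_state assume k: "rarr s3 = H i j 0" "\<forall>q. q \<notin> {} \<longrightarrow> nreg s3 q = nreg s2 q"
        have n3: "nreg s3 0 = n" "nreg s3 1 = i" "nreg s3 2 = j" using k n2 j by auto
        show "runs {3} (for_loop 3 L (cmp a x)) s3 (looptime L n (cmptime x)) (H i j (bnd L n))"
        proof (rule runs_for[where F = "H i j" and Rg = "{}" and r = 3 and s = s3 and n = n, OF n3(1)])
          show "H i j 0 = rarr s3" using k by simp
          fix l and s4 :: ram_state assume l: "rarr s4 = H i j l" "nreg s4 3 = l" "\<forall>q. q \<notin> {3} \<longrightarrow> nreg s4 q = nreg s3 q"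
          have e: "setc (rarr s4) (a + 50) i j (rarr s4 (a + 50) i j + cval x (cst n i j l M)) = H i j (Suc l)"
            by (auto simp: l H_def setc_def t_def)
          show "runs {} (cmp a x) s4 (cmptime x) (H i j (Suc l))"
            unfolding e[symmetric]
            by (rule runs_cmp) (use ok n3 l off in \<open>auto simp: t_def\<close>)
        qed auto
      qed
      then show "runs {3} (Seq (RAssign t (NReg 1) (NReg 2) (OfNat (NConst 0))) (for_loop 3 L (cmp a x))) s2
        (5 + looptime L n (cmptime x)) (G i (Suc j))" unfolding Gs by simp
    qed auto
  qed auto
  define M1 where "M1 = F (bnd I n)"
  define F' where "F' i = M1(a := upd i (bnd J n) S (M a))" for i
  define G' where "G' i j = (F' i)(a := (F' i a)(i := (\<lambda>j'. if j' < j then S i j' else F' i a i j')))" for i j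
  have 2: "runs {1, 2} (for_loop 1 I (for_loop 2 J (RAssign a (NReg 1) (NReg 2) (Entry t (NReg 1) (NReg 2))))) s'
      (looptime I n (looptime J n 6)) (F' (bnd I n))" if s': "rarr s' = M1" "\<forall>q. q \<notin> {1, 2, 3} \<longrightarrow> nreg s' q = nreg s q" for s' :: ram_state
  proof (rule runs_for[where F = F' and Rg = "{2}" and r = 1 and s = s' and n = n])
    show "nreg s' 0 = n" using s' s by simp
    show "F' 0 = rarr s'" using ta by (auto simp: F'_def s' M1_def F_def upd_def fun_upd_def fun_eq_iff)
    fix i and s1 :: ram_state assume i: "i < bnd I n" "rarr s1 = F' i" "nreg s1 1 = i" "\<forall>q. q \<notin> {1, 2} \<longrightarrow> nreg s1 q = nreg s' q"
    have Fs: "F' (Suc i) = G' i (bnd J n)" by (auto simp: F'_def G'_def upd_def fun_eq_iff less_Suc_eq)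
    have n1: "nreg s1 0 = n" using i s s' by simp
    show "runs {2} (for_loop 2 J (RAssign a (NReg 1) (NReg 2) (Entry t (NReg 1) (NReg 2)))) s1 (looptime J n 6) (F' (Suc i))"
      unfolding Fs
    proof (rule runs_for[where F = "G' i" and Rg = "{}" and r = 2 and s = s1 and n = n, OF n1])
      show "G' i 0 = rarr s1" by (simp add: G'_def i fun_upd_def fun_eq_iff)
      fix j and s2 :: ram_state assume j: "j < bnd J n" "rarr s2 = G' i j" "nreg s2 2 = j" "\<forall>q. q \<notin> {2} \<longrightarrow> nreg s2 q = nreg s1 q"
      have v: "rarr s2 t i j = S i j" using ta i(1) j(1) by (simp add: j(2) G'_def F'_def M1_def F_def upd_def)
      show "runs {} (RAssign a (NReg 1) (NReg 2) (Entry t (NReg 1) (NReg 2))) s2 6 (G' i (Suc j))"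
      proof (rule runs_assign)
        show "nreg s2 1 = i" "nreg s2 2 = j" using i j by auto
        show "rval (Entry t (NReg 1) (NReg 2)) s2 = S i j" using i j v by simp
        show "G' i (Suc j) = setc (rarr s2) a i j (S i j)"
          unfolding j(2) by (auto simp: G'_def setc_def fun_eq_iff less_Suc_eq)
      qed (simp add: uniform_charge_def)
    qed auto
  qed auto
  have "runs ({1, 2, 3} \<union> {1, 2}) (gcomp (Fill a I J L x)) s (gtime n (Fill a I J L x)) (F' (bnd I n))"
    unfolding gcomp.simps gtime.simps t_def[symmetric]
    by (rule runs_Seq[OF 1]) (rule 2, auto simp: M1_def)
  moreover have "F' (bnd I n) = sem n (Fill a I J L x) M"
    by (simp add: F'_def M1_def F_def S_def t_def)
  moreover have "{1, 2, 3} \<union> {1, 2} = {1, 2, 3::nat}" by auto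
  ultimately show ?thesis by simp
qed

lemma gregs_0: "well_formed p \<Longrightarrow> 0 \<notin> gregs p" by (induction p) auto

lemma runs_gcomp:
  assumes "well_formed p" "nreg s 0 = n"
  shows "runs (gregs p) (gcomp p) s (gtime n p) (sem n p (rarr s))"
  using assms
proof (induction p arbitrary: s)
  case GSkip
  then show ?case using exec.Skip[of uniform_charge s] by (auto simp: runs_def)
next
  case (Fill a I J L x)
  show ?case unfolding gregs.simps by (rule runs_fill) (use Fill in auto)
next
  case (GSeq p q)
  have "0 \<notin> gregs p" using GSeq gregs_0 by simp
  then show ?case unfolding gregs.simps gcomp.simps gtime.simps
    by (intro runs_Seq[where ?M1.0 = "sem n p (rarr s)"]) (use GSeq in \<open>force simp del: gregs.simps\<close>)+
next
  case (GIf b p q)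
  have b: "bval b s = bval b (cst n 0 0 0 (rarr s))"
    by (rule bval_cong) (use GIf.prems in \<open>auto simp: cst_def\<close>)
  show ?case
  proof (cases "bval b s")
    case True
    obtain t s' where "exec uniform_charge (gcomp p) s t s'" "t \<le> gtime n p"
      "rarr s' = sem n p (rarr s)" "\<forall>r. r \<notin> gregs p \<longrightarrow> nreg s' r = nreg s r"
      using GIf.IH(1)[of s] GIf.prems by (auto simp: runs_def)
    moreover from exec.CondTrue[OF True this(1)] have "exec uniform_charge (Cond b (gcomp p) (gcomp q)) s (bcost uniform_charge b s + t) s'" .
    ultimately show ?thesis using True b unfolding runs_def
      by (intro exI[of _ "bcost uniform_charge b s + t"] exI[of _ s']) (auto simp: bcost_const[of b s st0])
  next
    case False
    obtain t s' where "exec uniform_charge (gcomp q) s t s'" "t \<le> gtime n q"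
      "rarr s' = sem n q (rarr s)" "\<forall>r. r \<notin> gregs q \<longrightarrow> nreg s' r = nreg s r"
      using GIf.IH(2)[of s] GIf.prems by (auto simp: runs_def)
    moreover from exec.CondFalse[OF False this(1)] have "exec uniform_charge (Cond b (gcomp p) (gcomp q)) s (bcost uniform_charge b s + t) s'" .
    ultimately show ?thesis using False b unfolding runs_def
      by (intro exI[of _ "bcost uniform_charge b s + t"] exI[of _ s']) (auto simp: bcost_const[of b s st0])
  qed
next
  case (GRep r L p)
  have z: "0 \<notin> gregs p" using GRep.prems gregs_0 by simp
  show ?case unfolding gregs.simps gcomp.simps gtime.simps sem.simps
  proof (rule runs_for[where F = "\<lambda>i. (sem n p ^^ i) (rarr s)" and s = s, OF GRep.prems(2)])
    fix i and s' :: ram_state assume "rarr s' = (sem n p ^^ i) (rarr s)" "\<forall>q. q \<notin> insert r (gregs p) \<longrightarrow> nreg s' q = nreg s q"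
    then show "runs (gregs p) (gcomp p) s' (gtime n p) ((sem n p ^^ Suc i) (rarr s))"
      using GRep.IH[of s'] GRep.prems z by auto
  qed (use GRep.prems z in auto)
qed

section \<open>Closure properties of polynomial bounds\<close>

definition poly_bounded :: "(nat \<Rightarrow> nat) \<Rightarrow> bool" where
  "poly_bounded f \<longleftrightarrow> (\<exists>p :: nat poly. \<forall>n. f n \<le> poly p n)"

lemma poly_bounded_const: "poly_bounded (\<lambda>_. c)"
  unfolding poly_bounded_def by (intro exI[of _ "[:c:]"]) simp

lemma poly_bounded_id: "poly_bounded (\<lambda>n. n)"
  unfolding poly_bounded_def by (intro exI[of _ "[:0, 1:]"]) simp

lemma poly_bounded_add: "poly_bounded f \<Longrightarrow> poly_bounded g \<Longrightarrow> poly_bounded (\<lambda>n. f n + g n)"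
  unfolding poly_bounded_def by (elim exE, rule_tac x = "p + pa" in exI) (simp add: add_mono)

lemma poly_bounded_mult: "poly_bounded f \<Longrightarrow> poly_bounded g \<Longrightarrow> poly_bounded (\<lambda>n. f n * g n)"
  unfolding poly_bounded_def by (elim exE, rule_tac x = "p * pa" in exI) (simp add: mult_mono)

lemma poly_bounded_power: "poly_bounded f \<Longrightarrow> poly_bounded (\<lambda>n. f n ^ k)"
  by (induction k) (auto intro: poly_bounded_const poly_bounded_mult)

lemma poly_bounded_looptime: "poly_bounded T \<Longrightarrow> poly_bounded (\<lambda>n. looptime L n (T n))"
  unfolding looptime_def bnd_def
  by (intro poly_bounded_add poly_bounded_mult poly_bounded_power poly_bounded_const poly_bounded_id)

lemma poly_bounded_gtime: "poly_bounded (\<lambda>n. gtime n p)"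
  by (induction p) (auto intro!: poly_bounded_add poly_bounded_looptime poly_bounded_const)

subsection \<open>The algorithm\<close>

abbreviation "rI \<equiv> NReg 1"
abbreviation "rJ \<equiv> NReg 2"
abbreviation "rL \<equiv> NReg 3"
abbreviation "rN \<equiv> OfNat (NReg 0)"
abbreviation cn :: "nat \<Rightarrow> rexp" where "cn k \<equiv> OfNat (NConst k)"
abbreviation sc :: "nat \<Rightarrow> rexp" where "sc a \<equiv> Entry a (NConst 0) (NConst 0)"
abbreviation v1 :: "nat \<Rightarrow> rexp" where "v1 a \<equiv> Entry a (NReg 1) (NConst 0)"
abbreviation v2 :: "nat \<Rightarrow> rexp" where "v2 a \<equiv> Entry a (NReg 2) (NConst 0)"
abbreviation v3 :: "nat \<Rightarrow> rexp" where "v3 a \<equiv> Entry a (NReg 3) (NConst 0)"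
abbreviation ble :: "rexp \<Rightarrow> rexp \<Rightarrow> bexp" where "ble d e \<equiv> BNot (BLess e d)"
abbreviation beq :: "rexp \<Rightarrow> rexp \<Rightarrow> bexp" where "beq d e \<equiv> BAnd (BNot (BLess e d)) (BNot (BLess d e))"
abbreviation neg :: "rexp \<Rightarrow> rexp" where "neg e \<equiv> Sub (cn 0) e"
abbreviation "o1 \<equiv> (1::nat, 0::nat)"
abbreviation "nn \<equiv> (1::nat, 1::nat)"
abbreviation "n2 \<equiv> (2::nat, 1::nat)"
abbreviation "eR \<equiv> Add (cn 1) (v1 3)"
abbreviation "eV \<equiv> Mul (cn 100) (npow 3)"
abbreviation "ec \<equiv> Mul (cn 300) (npow 4)"
abbreviation "em \<equiv> Mul (cn 8000) (npow 6)"

fun seqs :: "gprog list \<Rightarrow> gprog" where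
  "seqs [] = GSkip"
| "seqs (p # ps) = GSeq p (seqs ps)"

fun divn :: "nat \<Rightarrow> rexp \<Rightarrow> rexp" where
  "divn 0 e = e"
| "divn (Suc k) e = Div (divn k e) rN"

text \<open>Arrays: 0 input, 1 output, 2 signed rows, 3 their squared norms, 4 \<open>\<kappa>\<close>, 5 \<open>Lg\<close>, 6 \<open>T\<close>,
  7 \<open>1 / T\<close>, 8 \<open>x\<close>, 9 \<open>al\<close>, 10 \<open>w\<close>, 11 \<open>st\<close>, 13 \<open>d\<close>, 14 indicator of \<open>alive x\<close>, 15 its sum,
  16 \<open>energy\<close>, 17 \<open>s\<close>, 18 \<open>g\<close>, 19 \<open>Qm\<close>, 20 \<open>P\<close>, 21 powers of \<open>P\<close>, 22 rank of a diagonal entry,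
  23 and 32 the selected row and its diagonal entry, 24 its rounding, 25 \<open>\<delta>\<close>, 26 and 27 the linear
  part, 28, 30, 31 increments, 29 the candidate, 33 to 36 its comparison with the output.\<close>

definition "p_live = Fill 14 nn o1 o1 (CI (BAnd (BLess (neg (Sub rN (cn 1))) (Mul rN (v1 8))) (BLess (Mul rN (v1 8)) (Sub rN (cn 1)))) (CR (cn 1)) (CR (cn 0)))"
definition "p_cnt = Fill 15 o1 o1 nn (CR (v3 14))"

text \<open>The final rate \<open>Lg / T\<close> is formed with the stored value of
  \<open>1 / T\<close>, because \<open>T\<close> is not among the divisors that \<open>rck\<close>
  admits.\<close>

definition "p_newphase = seqs
  [Fill 4 o1 o1 o1 (CR (Div (sc 4) (cn 2))),
   Fill 16 n2 o1 nn (CR (Mul (v3 14) (Mul (Entry 2 rI rL) (Entry 2 rI rL)))),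
   Fill 11 n2 o1 o1 (CI (BLess (cn 2) (v1 11)) (CR (cn 4))
     (CI (ble (Mul (v1 16) (sc 5)) (Mul (cn 20) (Mul (sc 6) (sc 6)))) (CR (cn 3))
       (CI (BAnd (ble (Mul (sc 4) eR) (Mul (cn 1000) rN)) (ble (Mul (v1 16) rN) (Mul (cn 20) (Mul (sc 4) eR))))
         (CR (cn 2)) (CR (cn 0))))),
   Fill 9 n2 o1 o1 (CI (beq (v1 11) (cn 3)) (CR (Mul (sc 5) (sc 7)))
     (CI (beq (v1 11) (cn 4)) (CR (v1 9))
       (CI (ble (Mul (sc 4) eR) (Mul (cn 1000) rN)) (CR (Mul (v1 9) (Div (cn 3) (cn 2)))) (CR (v1 9))))),
   Fill 10 n2 o1 o1 (CI (beq (v1 11) (cn 4)) (CR (Div (v1 10) (cn 2)))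
     (CI (beq (v1 11) (cn 3)) (CR (cn 1)) (CI (beq (v1 11) (cn 2)) (CR eR) (CR (cn 0))))),
   Fill 13 n2 o1 o1 (CR (cn 0))]"

definition "p_matrix = seqs
  [Fill 11 n2 o1 o1 (CI (BAnd (beq (v1 11) (cn 2)) (ble (Mul (cn 1400) rN) (Mul (v1 10) (sc 4)))) (CR (cn 1)) (CR (v1 11))),
   Fill 17 n2 nn o1 (CI (BAnd (BLess (cn 1) (v1 11)) (BAnd (ble (Mul (cn 128) (Mul (v1 9) (Entry 2 rI rJ))) (cn 1))
     (ble (neg (cn 1)) (Mul (cn 128) (Mul (v1 9) (Entry 2 rI rJ)))))) (CR (Mul (v1 9) (Entry 2 rI rJ))) (CR (cn 0))),
   Fill 18 n2 nn o1 (CR (Sub (Entry 17 rI rJ) (Mul (Mul (cn 128) (Mul (Entry 17 rI rJ) (Entry 17 rI rJ))) (v2 8)))),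
   Fill 19 nn nn n2 (CI (BLess (cn 1) (v3 11))
     (CI (beq (OfNat rI) (OfNat rJ))
       (CR (Sub (Mul (Mul (Mul (cn 32) (v3 10)) (Entry 17 rL rI)) (Entry 17 rL rI)) (Mul (Mul (Mul (cn 3) (v3 10)) (Entry 18 rL rI)) (Entry 18 rL rJ))))
       (CR (neg (Mul (Mul (Mul (cn 3) (v3 10)) (Entry 18 rL rI)) (Entry 18 rL rJ)))))
     (CR (neg (Mul (Mul eV (Entry 2 rL rI)) (Entry 2 rL rJ))))),
   Fill 20 nn nn o1 (CI (BAnd (BLess (cn 0) (v1 14)) (BLess (cn 0) (v2 14)))
     (CI (beq (OfNat rI) (OfNat rJ)) (CR (Add (Entry 19 rI rJ) (Add ec (cn 1)))) (CR (Entry 19 rI rJ))) (CR (cn 0)))]"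

text \<open>Iterated multiplication instead of repeated squaring: a product with two factors from
  array 21 would have degree 2 in its own level, which \<open>ack\<close> excludes.\<close>

definition "p_power = seqs
  [Fill 21 nn nn o1 (CI (beq (OfNat rI) (OfNat rJ)) (CR (cn 1)) (CR (cn 0))),
   GRep 4 (4000, 5) (Fill 21 nn nn nn (CR (Mul (Entry 21 rI rL) (Entry 20 rL rJ))))]"

text \<open>Argmax and rounding are both done by counting: an entry of rank 0 is the first largest
  one, and the grid point is the number of thresholds below the value. This avoids a floor function
  and a division by the diagonal entry.\<close>

definition "p_select = seqs
  [Fill 22 nn o1 nn (CI (BLess (Entry 21 rI rI) (Entry 21 rL rL)) (CR (cn 1))
     (CI (BAnd (beq (Entry 21 rL rL) (Entry 21 rI rI)) (BLess (OfNat rL) (OfNat rI))) (CR (cn 1)) (CR (cn 0)))),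
   Fill 23 nn o1 nn (CI (BLess (v3 22) (cn 1)) (CR (Entry 21 rL rI)) (CR (cn 0))),
   Fill 32 o1 o1 nn (CI (BLess (v3 22) (cn 1)) (CR (Entry 21 rL rL)) (CR (cn 0))),
   Fill 24 nn o1 (16000, 6) (CI (ble (Mul (sc 32) (Sub (Add (OfNat rL) (cn 1)) em)) (Mul em (v1 23))) (CR (cn 1)) (CR (cn 0))),
   Fill 25 nn o1 o1 (CR (divn 7 (Div (Sub (v1 24) em) (cn 16000))))]"

text \<open>\<open>\<delta>\<close> and its negative have the same second-order effect, so the sign
  is chosen to make the linear part nonpositive.\<close>

definition "p_move = seqs
  [Fill 26 nn o1 n2 (CI (BLess (cn 1) (v3 11)) (CR (Mul (v3 10) (Entry 18 rL rI))) (CR (Mul (Mul (Mul (cn 2) eV) (v3 13)) (Entry 2 rL rI)))),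
   Fill 27 o1 o1 nn (CR (Mul (v3 25) (Sub (v3 26) (Mul (cn 2) (v3 8))))),
   Fill 25 nn o1 o1 (CI (BLess (cn 0) (sc 27)) (CR (neg (v1 25))) (CR (v1 25))),
   Fill 28 n2 o1 nn (CR (Mul (Entry 18 rI rL) (v3 25))),
   Fill 30 n2 o1 nn (CR (Mul (Mul (Entry 17 rI rL) (v3 25)) (Mul (Entry 17 rI rL) (v3 25)))),
   Fill 10 n2 o1 o1 (CR (Mul (v1 10) (Sub (Add (Add (cn 1) (v1 28)) (Mul (cn 3) (Mul (v1 28) (v1 28)))) (Mul (cn 32) (v1 30))))),
   Fill 31 n2 o1 nn (CR (Mul (Entry 2 rI rL) (v3 25))),
   Fill 13 n2 o1 o1 (CI (BLess (cn 1) (v1 11)) (CR (v1 13)) (CR (Add (v1 13) (v1 31)))),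
   Fill 8 nn o1 o1 (CR (Add (v1 8) (v1 25)))]"

definition "p_step = seqs [p_matrix, p_power, p_select, p_move]"

definition "p_body = seqs [p_live, p_cnt,
  GIf (BLess (cn 0) (sc 15)) (GIf (BLess (sc 4) (Mul (cn 2) (sc 15))) p_step p_newphase) GSkip]"

definition "p_init = seqs
  [Fill 4 o1 o1 o1 (CR (Mul (cn 2) rN)), Fill 8 nn o1 o1 (CR (cn 0)), Fill 9 n2 o1 o1 (CR (cn 1)),
   Fill 10 n2 o1 o1 (CR (cn 0)), Fill 11 n2 o1 o1 (CR (cn 0)), Fill 13 n2 o1 o1 (CR (cn 0))]"

text \<open>Array 36 counts the rows in which the old output exceeds every row of the candidate.
  Since the rows come with both signs, this compares maximum norms.\<close>

definition "p_keep = seqs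
  [Fill 29 nn o1 o1 (CI (BLess (v1 8) (cn 0)) (CR (neg (cn 1))) (CR (cn 1))),
   Fill 33 n2 o1 nn (CR (Mul (Entry 2 rI rL) (v3 29))),
   Fill 34 n2 o1 nn (CR (Mul (Entry 2 rI rL) (v3 1))),
   Fill 35 n2 o1 n2 (CI (ble (v1 34) (v3 33)) (CR (cn 1)) (CR (cn 0))),
   Fill 36 o1 o1 n2 (CI (BLess (v3 35) (cn 1)) (CR (cn 1)) (CR (cn 0))),
   Fill 1 nn o1 o1 (CI (BLess (cn 0) (sc 36)) (CR (v1 29)) (CR (v1 1)))]"

definition "p_try = seqs [p_init, GRep 5 (2000, 4) p_body, p_keep]"

definition "p_scale = seqs [p_try, Fill 6 o1 o1 o1 (CR (Mul (cn 2) (sc 6))), Fill 7 o1 o1 o1 (CR (Div (sc 7) (cn 2)))]"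

definition "p_log = seqs
  [Fill 5 o1 o1 o1 (CR (Add (sc 5) (cn 1))), Fill 6 o1 o1 o1 (CR (cn 1)), Fill 7 o1 o1 o1 (CR (cn 1)), GRep 6 nn p_scale]"

definition "p_main = seqs
  [Fill 2 n2 nn o1 (CI (BLess (OfNat rI) rN) (CR (Entry 0 rI rJ)) (CR (neg (Entry 0 (NSub rI (NReg 0)) rJ)))),
   Fill 3 n2 o1 nn (CR (Mul (Entry 2 rI rL) (Entry 2 rI rL))),
   Fill 1 nn o1 o1 (CR (cn 1)), Fill 5 o1 o1 o1 (CR (cn 0)),
   GRep 7 nn p_log]"

lemmas prog_defs = p_live_def p_cnt_def p_newphase_def p_matrix_def p_power_def p_select_def p_move_def p_step_def
  p_body_def p_init_def p_keep_def p_try_def p_scale_def p_log_def p_main_def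

lemma npow_numeral: "npow (numeral k) = Mul (OfNat (NReg 0)) (npow (pred_numeral k))"
  by (simp add: numeral_eq_Suc)

lemma divn_numeral: "divn (numeral k) e = Div (divn (pred_numeral k) e) rN"
  by (simp add: numeral_eq_Suc)

lemma well_formed_main: "well_formed p_main"
  unfolding prog_defs seqs.simps
  by (simp add: npow_numeral divn_numeral)

text \<open>The data flow of a step is cyclic: \<open>x\<close> determines \<open>P\<close>, its
  powers determine \<open>\<delta>\<close>, and \<open>\<delta>\<close> changes \<open>x\<close>.
  The rounding cuts the cycle: array 24 only counts ones, and the high-level arrays 23 and 32 enter
  in conditions, which are not subject to levels. So \<open>\<delta>\<close> gets level 6 although
  the powers have level 20.\<close>

definition lv :: "nat \<Rightarrow> nat" where
  "lv a = (let b = (if a < 50 then a else a - 50) in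
     if b \<in> {0, 4, 5, 6, 7, 11, 14, 22, 24, 29, 35, 36} then 4
     else if b \<in> {1, 2, 9, 15, 25} then 6
     else if b \<in> {3, 8, 16, 17, 31, 33, 34} then 8
     else if b \<in> {13, 18} then 10
     else if b \<in> {28, 30} then 12
     else if b = 10 then 14
     else if b \<in> {19, 26} then 16
     else if b \<in> {20, 27} then 18
     else if b = 21 then 20 else 22)"

lemma lv_bounds: "3 \<le> lv a" "lv a \<le> 22"
  by (auto simp: lv_def Let_def)

lemma pck_main: "pck lv 200 (gcomp p_main)"
  unfolding prog_defs seqs.simps gcomp.simps cmp.simps for_loop_def guard_def
  by (simp add: ack_def lv_def npow_numeral divn_numeral)

subsection \<open>Polynomial running time\<close>

lemma poly_nat_mono: "n \<le> m \<Longrightarrow> poly (f :: nat poly) n \<le> poly f m"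
  by (induction f) (auto intro: add_mono mult_mono)

lemma poly_bounded_poly: "poly_bounded (poly f)" by (auto simp: poly_bounded_def)

lemma bit_length_rational:
  assumes "x \<in> \<rat>"
  obtains p q where "x = of_int p / of_int q" "q > 0" "q < 2 ^ bit_length x" "bit_length x \<ge> 1"
proof -
  obtain y where x: "x = of_rat y" using assms by (auto elim: Rats_cases)
  have inv: "the_inv (of_rat :: rat \<Rightarrow> real) x = y"
    unfolding x by (rule the_inv_f_f) (simp add: inj_on_def)
  obtain p q where pq: "quotient_of y = (p, q)" by (cases "quotient_of y")
  have q: "q > 0" using pq by (rule quotient_of_denom_pos)
  have yd: "y = of_int p / of_int q" using pq by (rule quotient_of_div)
  have b: "bit_length x = nat (bitlen \<bar>p\<bar> + bitlen q)" by (simp add: bit_length_def inv pq)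
  have nonneg: "bitlen \<bar>p\<bar> \<ge> 0" by (rule bitlen_nonneg)
  have "bitlen q \<ge> 1" using q by (simp add: bitlen_ge_iff_power)
  have "bitlen q \<le> int (bit_length x)" using b nonneg \<open>bitlen q \<ge> 1\<close> by simp
  then have "q < 2 ^ bit_length x" using q by (simp add: bitlen_le_iff_power)
  moreover have "bit_length x \<ge> 1" using b nonneg \<open>bitlen q \<ge> 1\<close> by simp
  ultimately show ?thesis using that q by (simp add: x yd of_rat_divide)
qed

lemma admissible_entry:
  assumes "admissible A" "i < dim_row A" "j < dim_col A"
  shows "\<bar>A $$ (i, j)\<bar> \<le> 1"
proof -
  have "\<bar>A $$ (i, j)\<bar> = \<bar>col A j $ i\<bar>" using assms by simp
  also have "\<dots> \<le> L2_set (\<lambda>i. \<bar>col A j $ i\<bar>) {..<dim_row A}"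
    by (rule member_le_L2_set) (use assms in auto)
  also have "\<dots> = l2_norm (col A j)" by (simp add: l2_norm_def L2_set_def)
  also have "\<dots> \<le> 1" using assms by (auto simp: admissible_def)
  finally show ?thesis .
qed

lemma exec_main:
  assumes "dim_row A = n"
  shows "\<exists>t s. exec uniform_charge (gcomp p_main) (input_state A) t s \<and> t \<le> gtime n p_main \<and>
    rarr s = sem n p_main (rarr (input_state A))"
proof -
  have "nreg (input_state A) 0 = n" using assms by (simp add: input_state_def)
  from runs_gcomp[OF well_formed_main this] show ?thesis by (auto simp: runs_def)
qed

lemma exec_main_bits:
  assumes "admissible A" "elements_mat A \<subseteq> \<rat>" "dim_row A = n"
  shows "\<exists>t s. exec bit_length (gcomp p_main) (input_state A) t s \<and>
    t \<le> 3 * (200 + gtime n p_main) ^ 23 * (14 + 2 * input_length A) * gtime n p_main \<and> n \<le> input_length A"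
proof -
  have nA: "n \<ge> 1" "dim_col A = n" using assms by (auto simp: admissible_def)
  define L where "L = input_length A"
  have car: "A \<in> carrier_mat n n" by (rule carrier_matI[OF assms(3) nA(2)])
  have rat: "A $$ (i, j) \<in> \<rat>" if "i < n" "j < n" for i j
    by (rule subsetD[OF assms(2) elements_matI[OF car that refl]])
  have "\<exists>q. \<forall>ij \<in> {..<n} \<times> {..<n}. (\<exists>p. A $$ ij = of_int p / of_int (q ij)) \<and> q ij > 0 \<and> q ij < 2 ^ bit_length (A $$ ij)"
  proof (rule bchoice, rule ballI)
    fix ij assume "ij \<in> {..<n} \<times> {..<n}"
    then have "A $$ ij \<in> \<rat>" using rat by auto
    then show "\<exists>q. (\<exists>p. A $$ ij = of_int p / of_int q) \<and> q > 0 \<and> q < 2 ^ bit_length (A $$ ij)"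
      by (elim bit_length_rational) blast
  qed
  then obtain q where q: "\<And>i j. i < n \<Longrightarrow> j < n \<Longrightarrow> (\<exists>p. A $$ (i, j) = of_int p / of_int (q (i, j))) \<and> q (i, j) > 0 \<and> q (i, j) < 2 ^ bit_length (A $$ (i, j))"
    by auto
  have bl: "bit_length (A $$ (i, j)) \<ge> 1" if "i < n" "j < n" for i j
    using bit_length_rational[OF rat[OF that]] by metis
  have Le: "L = (\<Sum>i<n. \<Sum>j<n. bit_length (A $$ (i, j)))" using assms nA by (simp add: L_def input_length_def)
  have "(\<Sum>i<n. \<Sum>j<n. 1) \<le> L" unfolding Le by (intro sum_mono) (use bl in auto)
  then have "n * n \<le> L" by simp
  then have nL: "n \<le> L" using nA(1) le_square le_trans by blast
  define Qp where "Qp = (\<Prod>i<n. \<Prod>j<n. nat (q (i, j)))"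
  have "Qp \<le> (\<Prod>i<n. \<Prod>j<n. 2 ^ bit_length (A $$ (i, j)))"
    unfolding Qp_def
  proof (intro prod_mono conjI)
    fix i j assume "i \<in> {..<n}" "j \<in> {..<n}"
    then show "nat (q (i, j)) \<le> 2 ^ bit_length (A $$ (i, j))" using q[of i j] by (simp add: nat_le_iff less_imp_le)
  qed auto
  also have "\<dots> = 2 ^ L" by (simp add: Le power_sum)
  finally have Qp: "Qp \<le> 2 ^ L" .
  have Qp0: "Qp > 0" unfolding Qp_def by (intro prod_pos) (use q in auto)
  have Qpd: "nat (q (i, j)) dvd Qp" if "i < n" "j < n" for i j
  proof -
    have "nat (q (i, j)) dvd (\<Prod>j<n. nat (q (i, j)))" using that by (intro dvd_prodI) auto
    also have "\<dots> dvd Qp" unfolding Qp_def using that by (intro dvd_prodI[where f = "\<lambda>i. \<Prod>j<n. nat (q (i, j))"]) auto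
    finally show ?thesis .
  qed
  \<comment> \<open>A common multiple of the divisors in the program and of all denominators of the
    input. Its length is linear in that of the input: 14 bits for 16000, at most
    \<open>n \<le> L\<close> for \<open>n\<close>, and \<open>L\<close> for the
    denominators.\<close>
  define D where "D = 16000 * n * Qp"
  have D0: "D > 0" using Qp0 nA by (simp add: D_def)
  interpret heights D n lv 22 200
    by unfold_locales (use D0 nA(1) lv_bounds in \<open>auto simp: D_def\<close>)
  define Xm where "Xm = 200 + gtime n p_main"
  define b where "b = 14 + 2 * L"
  have Db: "real D < 2 ^ b"
  proof -
    have "n < 2 ^ n" by (rule less_exp)
    then have "D < 2 ^ 14 * 2 ^ n * 2 ^ L"
      unfolding D_def using Qp Qp0 nA by (intro mult_less_le_imp_less mult_le_less_imp_less) auto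
    also have "\<dots> = 2 ^ (14 + n + L)" by (simp only: power_add)
    also have "\<dots> \<le> 2 ^ b" unfolding b_def using nL by (intro power_increasing) auto
    finally have "D < 2 ^ b" .
    then have "real D < real (2 ^ b)" by (simp only: of_nat_less_iff)
    then show ?thesis by simp
  qed
  define W where "W = 3 * Xm ^ (22 + 1) * b"
  have Xm1: "Xm \<ge> 1" by (simp add: Xm_def)
  have W: "bit_length x \<le> W" if "height_le D (Xm ^ (22 + 1)) x" for x
    unfolding W_def using that Db by (rule bit_length_le) (use Xm1 D0 in auto)
  have W1: "W \<ge> 1" using Xm1 by (simp add: W_def b_def)
  have hst: "hst 200 (input_state A)"
    unfolding hst_def
  proof (intro conjI allI)
    show "nreg (input_state A) 0 = n" using assms by (simp add: input_state_def)
    fix r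
    have "n dvd D" by (simp add: D_def)
    then have "n \<le> D" using D0 by (rule dvd_imp_le)
    then have "real n \<le> real D ^ 1" by simp
    also have "\<dots> \<le> real D ^ 200" by (rule Dmono) simp
    finally show "real (nreg (input_state A) r) \<le> real D ^ 200" using assms by (simp add: input_state_def)
  next
    fix a i j
    have "height_le D 1 (rarr (input_state A) a i j)"
    proof (cases "a = 0 \<and> i < n \<and> j < n")
      case True
      obtain p where p: "A $$ (i, j) = of_int p / of_int (q (i, j))" "q (i, j) > 0" using q True by blast
      have "nat (q (i, j)) dvd D" unfolding D_def using Qpd[of i j] True by (simp add: dvd_mult)
      then obtain k where k: "D = nat (q (i, j)) * k" by auto
      have "real D = of_int (q (i, j)) * real k" unfolding k using p(2) by simp
      then have "A $$ (i, j) * real D = of_int p * of_int (int k)" using p by simp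
      moreover have "(of_int p * of_int (int k) :: real) \<in> \<int>" by (simp only: of_int_mult[symmetric] Ints_of_int)
      ultimately have "A $$ (i, j) * real D \<in> \<int>" by simp
      moreover have "\<bar>A $$ (i, j)\<bar> \<le> 1" using True by (intro admissible_entry[OF assms(1)]) (simp_all add: assms(3) nA(2))
      ultimately show ?thesis using True D1 by (auto simp: height_le_def input_state_def assms(3) nA(2))
    next
      case False
      then show ?thesis by (auto simp: height_le_def input_state_def assms(3) nA(2))
    qed
    then show "height_le D (200 ^ lv a) (rarr (input_state A) a i j)" by (rule height_le_mono) simp
  qed
  obtain t s where ts: "exec uniform_charge (gcomp p_main) (input_state A) t s" "t \<le> gtime n p_main"
    using exec_main[OF assms(3)] by blast
  have "\<exists>t'. exec bit_length (gcomp p_main) (input_state A) t' s \<and> t' \<le> W * t"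
    using exec_heights[where w = bit_length and W = W and Xm = Xm, OF W W1 _ ts(1) pck_main hst] ts(2)
    by (simp add: Xm_def)
  then obtain t' where t': "exec bit_length (gcomp p_main) (input_state A) t' s" "t' \<le> W * t" by blast
  have "t' \<le> W * gtime n p_main" using t'(2) ts(2) by (meson le_trans mult_le_mono2)
  then show ?thesis using t'(1) nL unfolding W_def Xm_def b_def L_def by (intro exI[of _ t'] exI[of _ s]) simp
qed

lemma polynomial_time_main: "polynomial_time admissible (gcomp p_main)"
proof -
  obtain f :: "nat poly" where f: "\<And>n. gtime n p_main \<le> poly f n"
    using poly_bounded_gtime[of p_main] by (auto simp: poly_bounded_def)
  have "poly_bounded (\<lambda>L. 3 * (200 + poly f L) ^ 23 * (14 + 2 * L) * poly f L)"
    by (intro poly_bounded_mult poly_bounded_power poly_bounded_add poly_bounded_const poly_bounded_id poly_bounded_poly)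
  then obtain g :: "nat poly" where g: "\<And>L. 3 * (200 + poly f L) ^ 23 * (14 + 2 * L) * poly f L \<le> poly g L"
    by (auto simp: poly_bounded_def)
  show ?thesis unfolding polynomial_time_def
  proof (rule conjI[OF exI[of _ f] exI[of _ g]]; rule allI; rule impI)
    fix A :: "real mat" assume "admissible A"
    show "\<exists>t s. exec uniform_charge (gcomp p_main) (input_state A) t s \<and> t \<le> poly f (dim_row A)"
      using exec_main[OF refl, of A] f le_trans by blast
  next
    fix A :: "real mat" assume A: "admissible A \<and> elements_mat A \<subseteq> \<rat>"
    define n where "n = dim_row A"
    define L where "L = input_length A"
    obtain t s where t: "exec bit_length (gcomp p_main) (input_state A) t s"
      "t \<le> 3 * (200 + gtime n p_main) ^ 23 * (14 + 2 * L) * gtime n p_main" "n \<le> L"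
      using exec_main_bits[of A n] A unfolding n_def L_def by blast
    have gl: "gtime n p_main \<le> poly f L" using f[of n] poly_nat_mono[OF t(3), of f] by simp
    have "t \<le> 3 * (200 + poly f L) ^ 23 * (14 + 2 * L) * poly f L"
      using t(2) by (rule order_trans) (intro mult_mono power_mono add_mono gl order_refl; simp)
    then show "\<exists>t s. exec bit_length (gcomp p_main) (input_state A) t s \<and> t \<le> poly g (input_length A)"
      using t(1) g[of L] unfolding L_def by (meson order_trans)
  qed
qed

subsection \<open>Meaning of the program\<close>

lemma sem_same [simp]: "i < bnd I n \<Longrightarrow> j < bnd J n \<Longrightarrow> sem n (Fill a I J L x) M a i j = fillv n L x M i j"
  by (simp add: upd_def)

lemma sem_other [simp]: "b \<noteq> a \<Longrightarrow> b \<noteq> a + 50 \<Longrightarrow> sem n (Fill a I J L x) M b = M b"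
  by simp

declare sem.simps(2) [simp del]

lemma bnd_simps [simp]: "bnd (c, 0) n = c" "bnd (c, 1) n = c * n" "bnd (c, Suc 0) n = c * n"
  by (simp_all add: bnd_def)

lemma fillv_one [simp]: "fillv n (1, 0) x M i j = cval x (cst n i j 0 M)" "fillv n (Suc 0, 0) x M i j = cval x (cst n i j 0 M)"
  by (simp_all add: fillv_def)

lemma cst_simps [simp]: "nreg (cst n i j l M) 0 = n" "nreg (cst n i j l M) 1 = i" "nreg (cst n i j l M) (Suc 0) = i"
  "nreg (cst n i j l M) 2 = j" "nreg (cst n i j l M) 3 = l" "rarr (cst n i j l M) = M"
  by (simp_all add: cst_def)

fun arrays_written :: "gprog \<Rightarrow> nat set" where
  "arrays_written GSkip = {}"
| "arrays_written (Fill a I J L x) = {a, a + 50}"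
| "arrays_written (GSeq p q) = arrays_written p \<union> arrays_written q"
| "arrays_written (GIf b p q) = arrays_written p \<union> arrays_written q"
| "arrays_written (GRep r L p) = arrays_written p"

lemma sem_frame: "b \<notin> arrays_written p \<Longrightarrow> sem n p M b = M b"
proof (induction p arbitrary: M)
  case (GRep r L p)
  have "(sem n p ^^ k) M b = M b" for k by (induction k) (use GRep in auto)
  then show ?case by simp
qed auto

text \<open>The loop multiplies by \<open>P\<close> from the right, so it acts on rows; symmetry
  turns row \<open>j\<close> into the iterates of \<open>unitv j\<close>.\<close>

lemma sem_power:
  assumes sym: "\<And>j l. j < n \<Longrightarrow> l < n \<Longrightarrow> M 20 j l = M 20 l j" and "j < n" "l < n"
  shows "sem n p_power M 21 j l = (app n (M 20) ^^ (4000 * n ^ 5)) (unitv j) l"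
proof -
  define f0 where "f0 = Fill 21 nn nn o1 (CI (beq (OfNat rI) (OfNat rJ)) (CR (cn 1)) (CR (cn 0)))"
  define f where "f = Fill 21 nn nn nn (CR (Mul (Entry 21 rI rL) (Entry 20 rL rJ)))"
  have e: "sem n p_power M = (sem n f ^^ (4000 * n ^ 5)) (sem n f0 M)"
    by (simp add: p_power_def f_def f0_def bnd_def)
  have "(sem n f ^^ t) (sem n f0 M) 20 = M 20 \<and>
    (\<forall>j<n. \<forall>l<n. (sem n f ^^ t) (sem n f0 M) 21 j l = (app n (M 20) ^^ t) (unitv j) l)" for t
  proof (induction t)
    case 0
    then show ?case by (auto simp: f0_def unitv_def)
  next
    case (Suc t)
    then show ?case
      by (auto simp: f_def fillv_def app_def[of n "M 20"] mult.commute sym intro!: sum.cong)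
  qed
  then show ?thesis unfolding e using assms(2,3) by auto
qed

text \<open>\<open>C\<close> is the floor of \<open>m + m * y / Y\<close>. The third claim keeps
  frozen coordinates exactly at rest.\<close>

lemma rounding_count:
  fixes y Y :: real and m :: nat
  assumes "Y > 0" "\<bar>y\<bar> \<le> Y"
  defines "C \<equiv> (\<Sum>t<2*m. if Y * (real t + 1 - real m) \<le> real m * y then 1 else (0::real))"
  shows "\<bar>C - real m - real m * y / Y\<bar> \<le> 1" "\<bar>C - real m\<bar> \<le> real m" "y = 0 \<Longrightarrow> C = real m"
proof -
  define z where "z = real m + real m * y / Y"
  have "\<bar>real m * y / Y\<bar> \<le> real m"
  proof -
    have "real m * \<bar>y\<bar> \<le> real m * Y" using assms by (intro mult_left_mono) auto
    then show ?thesis using assms by (simp add: abs_mult pos_divide_le_eq)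
  qed
  then have z: "0 \<le> z" "z \<le> 2 * real m" unfolding z_def abs_le_iff by auto
  define k where "k = nat \<lfloor>z\<rfloor>"
  have k: "real k \<le> z" "z < real k + 1" using z by (auto simp: k_def)
  have c: "Y * (real t + 1 - real m) \<le> real m * y \<longleftrightarrow> t < k" for t
  proof -
    have "Y * (real t + 1 - real m) \<le> real m * y \<longleftrightarrow> real t + 1 - real m \<le> real m * y / Y"
      using assms(1) by (simp add: pos_le_divide_eq mult.commute)
    also have "\<dots> \<longleftrightarrow> real (Suc t) \<le> z" by (auto simp: z_def)
    also have "\<dots> \<longleftrightarrow> Suc t \<le> k"
    proof
      assume "real (Suc t) \<le> z"
      then have "real (Suc t) < real (k + 1)" using k by simp
      then have "Suc t < k + 1" by (simp only: of_nat_less_iff)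
      then show "Suc t \<le> k" by simp
    next
      assume "Suc t \<le> k"
      then have "real (Suc t) \<le> real k" by (simp only: of_nat_le_iff)
      then show "real (Suc t) \<le> z" using k by linarith
    qed
    finally show ?thesis by (simp add: Suc_le_eq)
  qed
  have "k \<le> 2 * m"
  proof -
    have "real k \<le> real (2 * m)" using k z by simp
    then show ?thesis by (simp only: of_nat_le_iff)
  qed
  then have "{..<2*m} \<inter> {t. t < k} = {..<k}" by auto
  then have C: "C = real k" unfolding C_def c by (simp add: sum.If_cases)
  show "\<bar>C - real m - real m * y / Y\<bar> \<le> 1" using k unfolding C z_def by linarith
  show "\<bar>C - real m\<bar> \<le> real m" using k z unfolding C by linarith
  show "C = real m" if "y = 0" using that unfolding C k_def z_def by simp
qed

text \<open>Ties are broken by the index, so exactly one entry has rank 0 and the sums over entries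
  of rank 0 select a single row.\<close>

lemma first_argmax:
  fixes f :: "nat \<Rightarrow> real"
  assumes "n \<ge> 1"
  obtains js where "js < n" "\<And>j. j < n \<Longrightarrow> f j \<le> f js"
    "\<And>j. j < n \<Longrightarrow> (\<Sum>l<n. if f j < f l then 1 else if f l = f j \<and> l < j then 1 else (0::real)) < 1 \<longleftrightarrow> j = js"
proof -
  define js where "js = (LEAST j. j < n \<and> (\<forall>l<n. f l \<le> f j))"
  have "\<exists>j. j < n \<and> (\<forall>l<n. f l \<le> f j)"
  proof -
    have "Max (f ` {..<n}) \<in> f ` {..<n}" using assms by (intro Max_in) (auto simp: lessThan_empty_iff)
    then obtain j where "j < n" "f j = Max (f ` {..<n})" by auto
    then show ?thesis by (intro exI[of _ j]) auto
  qed
  then have js: "js < n \<and> (\<forall>l<n. f l \<le> f js)" unfolding js_def by (rule LeastI_ex)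
  have least: "js \<le> j" if "j < n" "\<forall>l<n. f l \<le> f j" for j unfolding js_def by (rule Least_le) (use that in auto)
  have "(\<Sum>l<n. if f j < f l then 1 else if f l = f j \<and> l < j then 1 else (0::real)) < 1 \<longleftrightarrow> j = js" if j: "j < n" for j
  proof
    assume a: "(\<Sum>l<n. if f j < f l then 1 else if f l = f j \<and> l < j then 1 else (0::real)) < 1"
    have z: "\<not> f j < f l \<and> \<not> (f l = f j \<and> l < j)" if "l < n" for l
    proof (rule ccontr)
      assume "\<not> ?thesis"
      then have "1 = (if f j < f l then 1 else if f l = f j \<and> l < j then 1 else (0::real))" by auto
      also have "\<dots> \<le> (\<Sum>l<n. if f j < f l then 1 else if f l = f j \<and> l < j then 1 else (0::real))"
        by (rule member_le_sum[of l "{..<n}" "\<lambda>l. if f j < f l then 1 else if f l = f j \<and> l < j then 1 else (0::real)"])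
          (use that in auto)
      finally show False using a by simp
    qed
    have "js \<le> j" using least[OF j] z by (auto simp: not_less)
    moreover have "f js = f j" using z[of js] js j by (auto simp: not_less intro: antisym)
    ultimately show "j = js" using z[of js] js by auto
  next
    assume e: "j = js"
    have "(\<Sum>l<n. if f j < f l then 1 else if f l = f j \<and> l < j then 1 else (0::real)) = 0"
    proof (rule sum.neutral, rule ballI)
      fix l assume "l \<in> {..<n}"
      then have l: "l < n" by simp
      have "\<not> (f l = f js \<and> l < js)" using least[OF l] js by auto
      then show "(if f j < f l then 1 else if f l = f j \<and> l < j then 1 else (0::real)) = 0"
        using js l e by auto
    qed
    then show "(\<Sum>l<n. if f j < f l then 1 else if f l = f j \<and> l < j then 1 else (0::real)) < 1" by simp
  qed
  then show ?thesis using that js by blast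
qed

lemma rval_npow' [simp]: "rval (npow k) (cst n i j l M) = real n ^ k" by (induction k) auto

lemma rval_divn: "rval (divn k e) (cst n i j l M) = rval e (cst n i j l M) / real n ^ k" by (induction k) auto

lemma sem_select:
  assumes n: "n \<ge> 1"
  obtains js where "js < n" "\<And>j. j < n \<Longrightarrow> M 21 j j \<le> M 21 js js"
    "\<And>l. l < n \<Longrightarrow> sem n p_select M 25 l 0 =
      ((\<Sum>t<2*(8000*n^6). if M 21 js js * (real t + 1 - real (8000*n^6)) \<le> real (8000*n^6) * M 21 js l then 1 else 0) - real (8000*n^6))
      / (16000 * real n ^ 7)"
proof -
  obtain js where js: "js < n" "\<And>j. j < n \<Longrightarrow> M 21 j j \<le> M 21 js js"
    "\<And>j. j < n \<Longrightarrow> (\<Sum>l<n. if M 21 j j < M 21 l l then 1 else if M 21 l l = M 21 j j \<and> l < j then 1 else (0::real)) < 1 \<longleftrightarrow> j = js"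
    using first_argmax[OF n, of "\<lambda>j. M 21 j j"] by blast
  define M1 where "M1 = sem n (Fill 22 nn o1 nn (CI (BLess (Entry 21 rI rI) (Entry 21 rL rL)) (CR (cn 1))
     (CI (BAnd (beq (Entry 21 rL rL) (Entry 21 rI rI)) (BLess (OfNat rL) (OfNat rI))) (CR (cn 1)) (CR (cn 0))))) M"
  have "M1 22 j 0 = (\<Sum>l<n. if M 21 j j < M 21 l l then 1 else if M 21 l l = M 21 j j \<and> l < j then 1 else (0::real))" if "j < n" for j
    using that unfolding M1_def by (auto simp: fillv_def intro!: sum.cong)
  then have rk: "M1 22 j 0 < 1 \<longleftrightarrow> j = js" if "j < n" for j using js(3) that by simp
  have M1: "M1 21 = M 21" by (simp add: M1_def)
  define M2 where "M2 = sem n (Fill 32 o1 o1 nn (CI (BLess (v3 22) (cn 1)) (CR (Entry 21 rL rL)) (CR (cn 0))))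
     (sem n (Fill 23 nn o1 nn (CI (BLess (v3 22) (cn 1)) (CR (Entry 21 rL rI)) (CR (cn 0)))) M1)"
  have dl: "(\<Sum>j<n. if M1 22 j 0 < 1 then h j else 0) = h js" for h :: "nat \<Rightarrow> real"
  proof -
    have "(\<Sum>j<n. if M1 22 j 0 < 1 then h j else 0) = (\<Sum>j<n. if j = js then h j else 0)"
      by (intro sum.cong) (auto simp: rk)
    then show ?thesis using js(1) by simp
  qed
  have a: "M2 23 l 0 = M 21 js l" if "l < n" for l
    using that dl[of "\<lambda>j. M 21 j l"] by (simp add: M2_def fillv_def M1 cong: if_cong)
  have b: "M2 32 0 0 = M 21 js js" using dl[of "\<lambda>j. M 21 j j"] by (simp add: M2_def fillv_def M1 cong: if_cong)
  have e: "sem n p_select M = sem n (Fill 25 nn o1 o1 (CR (divn 7 (Div (Sub (v1 24) em) (cn 16000)))))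
    (sem n (Fill 24 nn o1 (16000, 6) (CI (ble (Mul (sc 32) (Sub (Add (OfNat rL) (cn 1)) em)) (Mul em (v1 23))) (CR (cn 1)) (CR (cn 0)))) M2)"
    unfolding p_select_def M2_def M1_def by simp
  have l16: "bnd (16000, 6) n = 2 * (8000 * n ^ 6)" by (simp add: bnd_def)
  have "sem n p_select M 25 l 0 =
      ((\<Sum>t<2*(8000*n^6). if M 21 js js * (real t + 1 - real (8000*n^6)) \<le> real (8000*n^6) * M 21 js l then 1 else 0) - real (8000*n^6))
      / (16000 * real n ^ 7)" if "l < n" for l
    unfolding e using that by (simp add: rval_divn fillv_def l16 a b not_less cong: if_cong)
  then show ?thesis using that js by blast
qed

lemma app_pow_cong:
  assumes "\<And>j l. j < n \<Longrightarrow> l < n \<Longrightarrow> P j l = P' j l" "j < n"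
  shows "(app n P ^^ t) v j = (app n P' ^^ t) v j"
  using assms(2)
proof (induction t arbitrary: j)
  case (Suc t)
  then show ?case by (simp add: app_def[of n P "(app n P ^^ t) v"] app_def[of n P' "(app n P' ^^ t) v"] assms(1))
qed simp

context discrepancy
begin

definition env :: "store \<Rightarrow> bool" where
  "env M \<longleftrightarrow> (\<forall>i<2*n. \<forall>j<n. M 2 i j = a i j) \<and> (\<forall>i<2*n. M 3 i 0 = (\<Sum>j<n. (a i j)\<^sup>2)) \<and>
     M 5 0 0 = Lg \<and> M 6 0 0 = T \<and> M 7 0 0 = 1 / T"

definition xv :: "store \<Rightarrow> nat \<Rightarrow> real" where "xv M j = M 8 j 0"

definition state_inv :: "nat \<Rightarrow> store \<Rightarrow> bool" where
  "state_inv p M \<longleftrightarrow> walk_inv p (M 4 0 0) (xv M) (\<lambda>i. M 9 i 0) (\<lambda>i. M 10 i 0) (\<lambda>i. M 11 i 0) (\<lambda>i. M 13 i 0)"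

definition live :: "store \<Rightarrow> bool" where
  "live M \<longleftrightarrow> (\<forall>j<n. M 14 j 0 = (if j \<in> alive (xv M) then 1 else 0))"

definition L where
  "L M = potential (\<lambda>i. M 10 i 0) (\<lambda>i. M 11 i 0) (\<lambda>i. M 13 i 0) - (\<Sum>j<n. (xv M j)\<^sup>2)"

lemma env_frame: "env M \<Longrightarrow> {2, 3, 5, 6, 7} \<inter> arrays_written p = {} \<Longrightarrow> env (sem n p M)"
  using sem_frame[of 2 p n M] sem_frame[of 3 p n M] sem_frame[of 5 p n M] sem_frame[of 6 p n M] sem_frame[of 7 p n M]
  unfolding env_def by simp

lemma live_sem: "live (sem n p_live M)" "xv (sem n p_live M) = xv M"
  by (auto simp: live_def p_live_def alive_def xv_def)

lemma cnt_sem: "live M \<Longrightarrow> sem n p_cnt M 15 0 0 = real (card (alive (xv M)))"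
proof -
  assume "live M"
  then have "sem n p_cnt M 15 0 0 = (\<Sum>j<n. if j \<in> alive (xv M) then 1 else 0)"
    by (simp add: p_cnt_def fillv_def live_def)
  also have "\<dots> = real (card (alive (xv M)))"
    using alive_sub by (simp add: sum.If_cases Int_absorb1 flip: Collect_mem_eq)
  finally show ?thesis .
qed

lemma newphase_sem:
  assumes env: "env M" and inv: "state_inv p M" and lv: "live M" and ne: "alive (xv M) \<noteq> {}"
    and k: "2 * real (card (alive (xv M))) \<le> M 4 0 0"
  shows "state_inv (Suc p) (sem n p_newphase M)" "xv (sem n p_newphase M) = xv M"
proof -
  show xv: "xv (sem n p_newphase M) = xv M"
    by (simp add: xv_def fun_eq_iff sem_frame p_newphase_def del: sem.simps)
  have e: "(\<Sum>l<n. M 14 l 0 * (M 2 i l * M 2 i l)) = energy (alive (xv M)) i" if "i < 2*n" for i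
  proof -
    have "(\<Sum>l<n. M 14 l 0 * (M 2 i l * M 2 i l)) = (\<Sum>l<n. if l \<in> alive (xv M) then (a i l)\<^sup>2 else 0)"
      using lv env that by (intro sum.cong) (auto simp: live_def env_def power2_eq_square)
    also have "\<dots> = energy (alive (xv M)) i"
      unfolding energy_def using alive_sub by (subst sum.inter_restrict[symmetric]) (auto simp: Int_absorb1)
    finally show ?thesis .
  qed
  have R: "1 + M 3 i 0 = R i" if "i < 2*n" for i using env that by (simp add: env_def R_def)
  have c: "M 5 0 0 = Lg" "M 6 0 0 = T" "M 7 0 0 = 1 / T" using env by (auto simp: env_def)
  show "state_inv (Suc p) (sem n p_newphase M)"
    unfolding state_inv_def xv
  proof (rule newphase_inv[OF inv[unfolded state_inv_def] ne k])
    show "sem n p_newphase M 4 0 0 = M 4 0 0 / 2" by (simp add: p_newphase_def)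
    fix i assume i: "i < 2*n"
    show "sem n p_newphase M 11 i 0 = (if M 11 i 0 > 2 then 4 else if energy (alive (xv M)) i * Lg \<le> 20 * T\<^sup>2 then 3
        else if sem n p_newphase M 4 0 0 * R i \<le> 1000 * real n \<and> energy (alive (xv M)) i * real n \<le> 20 * (sem n p_newphase M 4 0 0 * R i) then 2 else 0)"
      using i e[OF i] R[OF i] by (simp add: p_newphase_def fillv_def c not_less power2_eq_square cong: if_cong)
    show "sem n p_newphase M 9 i 0 = (if sem n p_newphase M 11 i 0 = 3 then Lg / T else if sem n p_newphase M 11 i 0 = 4 then M 9 i 0
        else if sem n p_newphase M 4 0 0 * R i \<le> 1000 * real n then M 9 i 0 * (3/2) else M 9 i 0)"
      using i R[OF i] by (simp add: p_newphase_def c not_less order.eq_iff[symmetric] cong: if_cong)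
    show "sem n p_newphase M 10 i 0 = (if sem n p_newphase M 11 i 0 = 4 then M 10 i 0 / 2 else if sem n p_newphase M 11 i 0 = 3 then 1
        else if sem n p_newphase M 11 i 0 = 2 then R i else 0)"
      using i R[OF i] by (simp add: p_newphase_def not_less order.eq_iff[symmetric] cong: if_cong)
    show "sem n p_newphase M 13 i 0 = 0" using i by (simp add: p_newphase_def)
  qed
qed

lemma step_sem:
  assumes env: "env M" and inv: "state_inv p M" and lv: "live M" and k: "M 4 0 0 < 2 * real (card (alive (xv M)))"
  shows "state_inv p (sem n p_step M)" "L (sem n p_step M) \<le> L M - 1 / (32 * (real n)\<^sup>2)"
proof -
  define S where "S = alive (xv M)"
  define M1 where "M1 = sem n p_matrix M"
  define M2 where "M2 = sem n p_power M1"
  define M3 where "M3 = sem n p_select M2"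
  define M4 where "M4 = sem n p_move M3"
  have M4: "sem n p_step M = M4" by (simp add: p_step_def M4_def M3_def M2_def M1_def)
  have nn: "real n > 0" using n1 by simp
  have ind: "0 < M 14 j 0 \<longleftrightarrow> j \<in> S" if "j < n" for j using lv that by (simp add: live_def S_def)
  have aM: "M 2 i j = a i j" if "i < 2*n" "j < n" for i j using env that by (simp add: env_def)
  have f1: "M1 b = M b" if "b \<notin> {11, 17, 18, 19, 20, 61, 67, 68, 69, 70}" for b
    unfolding M1_def by (rule sem_frame) (use that in \<open>simp add: p_matrix_def\<close>)
  have f2: "M2 b = M1 b" if "b \<notin> {21, 71}" for b
    unfolding M2_def by (rule sem_frame) (use that in \<open>simp add: p_power_def\<close>)
  have f3: "M3 b = M2 b" if "b \<notin> {22, 23, 32, 24, 25, 72, 73, 82, 74, 75}" for b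
    unfolding M3_def by (rule sem_frame) (use that in \<open>simp add: p_select_def\<close>)
  have st: "M1 11 i 0 = (if M 11 i 0 = 2 \<and> 1400 * real n \<le> M 10 i 0 * M 4 0 0 then 1 else M 11 i 0)" if "i < 2*n" for i
    using that by (auto simp: M1_def p_matrix_def not_less)
  note blk = block_inv[OF inv[unfolded state_inv_def] k st]
  have inv1: "walk_inv p (M 4 0 0) (xv M) (\<lambda>i. M 9 i 0) (\<lambda>i. M 10 i 0) (\<lambda>i. M1 11 i 0) (\<lambda>i. M 13 i 0)" by (rule blk(1))
  note f = walk_inv_facts[OF inv1]
  have x: "\<bar>xv M j\<bar> \<le> 1" if "j < n" for j using inv1 that by (auto simp: walk_inv_def)
  have s: "M1 17 i j = (if M1 11 i 0 > 1 then small_part (M 9 i 0) i j else 0)" if "i < 2*n" "j < n" for i j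
    using that aM[OF that] by (auto simp: M1_def p_matrix_def not_less small_part_def abs_le_iff)
  have g: "M1 18 i j = M1 17 i j - 128 * (M1 17 i j)\<^sup>2 * xv M j" if "i < 2*n" "j < n" for i j
    using that by (simp add: M1_def p_matrix_def power2_eq_square xv_def)
  have s128: "\<bar>M1 17 i j\<bar> \<le> 1/128" if "i < 2*n" "j < n" for i j
    using s[OF that] by (auto simp: small_part_def)
  interpret D: descent n a "M1 17" "M1 18" "\<lambda>i. M 10 i 0" "\<lambda>i. M1 11 i 0 > 1" S
  proof
    show "n \<ge> 1" by (rule n)
    show "S \<subseteq> {..<n}" by (simp add: S_def alive_sub)
    show "S \<noteq> {}"
    proof
      assume "S = {}"
      then have "M 4 0 0 < 0" using k by (simp add: S_def)
      then show False using inv1 by (auto simp: walk_inv_def)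
    qed
    fix i j assume ij: "i < 2*n" "j < n"
    show "\<bar>M1 17 i j\<bar> \<le> 1/128" by (rule s128[OF ij])
    have "\<bar>128 * (M1 17 i j)\<^sup>2 * xv M j\<bar> \<le> 128 * (M1 17 i j)\<^sup>2 * 1"
      unfolding abs_mult using x[OF ij(2)] by (intro mult_mono) auto
    moreover have "\<bar>M1 17 i j\<bar> * \<bar>M1 17 i j\<bar> \<le> 1/128 * \<bar>M1 17 i j\<bar>" using s128[OF ij] by (intro mult_right_mono) auto
    then have "128 * (M1 17 i j)\<^sup>2 \<le> \<bar>M1 17 i j\<bar>" by (simp add: power2_eq_square abs_mult[symmetric])
    ultimately show "\<bar>M1 18 i j\<bar> \<le> 2 * \<bar>M1 17 i j\<bar>" unfolding g[OF ij] by linarith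
  next
    show "10 * card {i. i < 2 * n \<and> \<not> 1 < M1 11 i 0} \<le> card S" unfolding S_def by (rule blk(2))
  qed (use col f in auto)
  have PM: "M1 20 j l = D.P j l" if "j < n" "l < n" for j l
  proof -
    have w: "M1 10 = M 10" by (rule f1) simp
    have Q: "M1 19 j l = D.Qm j l"
    proof -
      have "M1 19 j l = (\<Sum>i<2*n. if M1 11 i 0 > 1 then (if j = l then 32 * M1 10 i 0 * M1 17 i j * M1 17 i j - 3 * M1 10 i 0 * M1 18 i j * M1 18 i l
          else - (3 * M1 10 i 0 * M1 18 i j * M1 18 i l)) else - (100 * real n ^ 3 * M1 2 i j * M1 2 i l))"
        using that by (simp add: M1_def p_matrix_def fillv_def not_less order.eq_iff[symmetric] cong: if_cong)
      also have "\<dots> = D.Qm j l"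
        unfolding D.Qm_def D.V_def w using that aM by (intro sum.cong refl) (simp add: f1)
      finally show ?thesis .
    qed
    have "M1 20 j l = (if 0 < M 14 j 0 \<and> 0 < M 14 l 0 then (if j = l then M1 19 j l + (300 * real n ^ 4 + 1) else M1 19 j l) else 0)"
      using that by (simp add: M1_def p_matrix_def not_less order.eq_iff[symmetric] cong: if_cong)
    then show ?thesis unfolding D.P_def D.c_def Q[symmetric] using ind[OF that(1)] ind[OF that(2)] by simp
  qed
  have Y: "M2 21 j l = (app n D.P ^^ (4000 * n ^ 5)) (unitv j) l" if "j < n" "l < n" for j l
  proof -
    have "M2 21 j l = (app n (M1 20) ^^ (4000 * n ^ 5)) (unitv j) l"
      unfolding M2_def by (rule sem_power) (use that PM D.P_sym in auto)
    also have "\<dots> = (app n D.P ^^ (4000 * n ^ 5)) (unitv j) l" by (rule app_pow_cong) (use that PM in auto)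
    finally show ?thesis .
  qed
  obtain js where js: "js < n" "\<And>j. j < n \<Longrightarrow> M2 21 j j \<le> M2 21 js js"
    and d0: "\<And>l. l < n \<Longrightarrow> M3 25 l 0 =
      ((\<Sum>t<2*(8000*n^6). if M2 21 js js * (real t + 1 - real (8000*n^6)) \<le> real (8000*n^6) * M2 21 js l then 1 else 0) - real (8000*n^6))
      / (16000 * real n ^ 7)"
    unfolding M3_def using sem_select[OF n, of M2] by blast
  have js': "(app n D.P ^^ (4000 * n ^ 5)) (unitv j) j \<le> (app n D.P ^^ (4000 * n ^ 5)) (unitv js) js" if "j < n" for j
    using js(2)[OF that] Y that js(1) by simp
  have yp: "M2 21 js js > 0" "\<And>l. l < n \<Longrightarrow> \<bar>M2 21 js l\<bar> \<le> M2 21 js js"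
    using D.power_vector(1,2)[OF js(1) js'] Y js(1) by auto
  define \<delta>0 where "\<delta>0 l = (if l < n then M3 25 l 0 else 0)" for l
  have G: "16000 * real n ^ 7 * M3 25 l 0 = (\<Sum>t<2*(8000*n^6). if M2 21 js js * (real t + 1 - real (8000*n^6)) \<le> real (8000*n^6) * M2 21 js l then 1 else 0) - real (8000*n^6)"
    if "l < n" for l unfolding d0[OF that] using nn by simp
  have \<delta>S: "\<delta>0 l = 0" if "l \<notin> S" for l
  proof (cases "l < n")
    case True
    \<comment> \<open>At least one factor \<open>P\<close> is split off: its rows outside
      \<open>S\<close> vanish, whereas a unit vector alone could be supported there.\<close>
    have "4000 * n ^ 5 \<noteq> 0" using n by simp
    then obtain K where K: "4000 * n ^ 5 = Suc K" using not0_implies_Suc by blast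
    have "M2 21 js l = app n D.P ((app n D.P ^^ K) (unitv js)) l"
      unfolding Y[OF js(1) True, unfolded K] by simp
    also have "\<dots> = 0" unfolding app_def using that by (simp add: D.P_def)
    finally have "16000 * real n ^ 7 * M3 25 l 0 = 0"
      unfolding G[OF True] using rounding_count(3)[OF yp(1) yp(2)[OF True], of "8000 * n ^ 6"] by simp
    then show ?thesis using nn True by (simp add: \<delta>0_def)
  qed (simp add: \<delta>0_def)
  have quad0: "(\<Sum>i<2*n. if M1 11 i 0 > 1 then 3 * M 10 i 0 * (\<Sum>j<n. M1 18 i j * \<delta>0 j)\<^sup>2 - 32 * M 10 i 0 * (\<Sum>j<n. (M1 17 i j * \<delta>0 j)\<^sup>2)
      else D.V * (\<Sum>j<n. a i j * \<delta>0 j)\<^sup>2) - (\<Sum>j<n. (\<delta>0 j)\<^sup>2) \<le> - 1 / (32 * (real n)\<^sup>2)"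
  proof (rule D.descent_step[OF js(1) js' _ \<delta>S])
    fix l assume l: "l < n"
    show "\<bar>16000 * real n ^ 7 * \<delta>0 l - 8000 * real n ^ 6 * (app n D.P ^^ (4000 * n ^ 5)) (unitv js) l / (app n D.P ^^ (4000 * n ^ 5)) (unitv js) js\<bar> \<le> 1"
      using rounding_count(1)[OF yp(1) yp(2)[OF l], of "8000 * n ^ 6"] G[OF l] l
      by (simp add: \<delta>0_def Y[OF js(1) l, symmetric] Y[OF js(1) js(1), symmetric])
  qed
  have \<delta>b: "\<bar>\<delta>0 l\<bar> \<le> 1 / (2 * real n)" if "l < n" for l
  proof -
    have "\<bar>16000 * real n ^ 7 * M3 25 l 0\<bar> \<le> real (8000*n^6)"
      unfolding G[OF that] by (rule rounding_count(2)[OF yp(1) yp(2)[OF that]])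
    moreover have "real n ^ 7 = real n ^ 6 * real n" using power_Suc2[of "real n" 6] by simp
    then have "\<bar>16000 * real n ^ 7 * M3 25 l 0\<bar> = 8000 * real n ^ 6 * (2 * (real n * \<bar>\<delta>0 l\<bar>))"
      using that by (simp add: abs_mult \<delta>0_def)
    ultimately have "8000 * real n ^ 6 * (2 * (real n * \<bar>\<delta>0 l\<bar>)) \<le> 8000 * real n ^ 6 * 1" by simp
    then have "2 * (real n * \<bar>\<delta>0 l\<bar>) \<le> 1" using nn by (subst (asm) mult_le_cancel_left_pos) auto
    then show ?thesis using nn by (simp add: field_simps)
  qed
  define lin where "lin = (\<Sum>j<n. \<delta>0 j * ((\<Sum>i<2*n. if M1 11 i 0 > 1 then M 10 i 0 * M1 18 i j else 2 * V * M 13 i 0 * a i j) - 2 * xv M j))"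
  define \<delta> where "\<delta> j = (if 0 < lin then - \<delta>0 j else \<delta>0 j)" for j
  have VD: "D.V = V" by (simp add: D.V_def V_def)
  have m3: "M3 10 = M 10" "M3 11 = M1 11" "M3 13 = M 13" "M3 8 = M 8" "M3 17 = M1 17" "M3 18 = M1 18" "M3 2 = M 2"
    "M3 4 = M 4" "M3 9 = M 9"
    by (simp_all add: f1 f2 f3)
  define Na where "Na = sem n (Fill 26 nn o1 n2 (CI (BLess (cn 1) (v3 11)) (CR (Mul (v3 10) (Entry 18 rL rI))) (CR (Mul (Mul (Mul (cn 2) eV) (v3 13)) (Entry 2 rL rI))))) M3"
  have Naf: "Na b = M3 b" if "b \<notin> {26, 76}" for b using that by (simp add: Na_def)
  define N1 where "N1 = sem n (Fill 25 nn o1 o1 (CI (BLess (cn 0) (sc 27)) (CR (neg (v1 25))) (CR (v1 25))))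
    (sem n (Fill 27 o1 o1 nn (CR (Mul (v3 25) (Sub (v3 26) (Mul (cn 2) (v3 8))))))
    Na)"
  have N1f: "N1 b = M3 b" if "b \<notin> {25, 26, 27, 75, 76, 77}" for b using that by (simp add: N1_def Naf)
  have N1d: "N1 25 j 0 = \<delta> j" if "j < n" for j
  proof -
    have h: "Na 26 j 0
      = (\<Sum>i<2*n. if M1 11 i 0 > 1 then M 10 i 0 * M1 18 i j else 2 * V * M 13 i 0 * a i j)" if "j < n" for j
      using that aM by (auto simp: Na_def fillv_def m3 V_def intro!: sum.cong)
    have "lin = sem n (Fill 27 o1 o1 nn (CR (Mul (v3 25) (Sub (v3 26) (Mul (cn 2) (v3 8))))))
      Na 27 0 0"
      unfolding lin_def by (simp add: fillv_def Naf m3 xv_def \<delta>0_def h)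
    then show ?thesis using that by (simp add: N1_def Naf \<delta>_def \<delta>0_def)
  qed
  have M4e: "M4 = sem n (seqs [
   Fill 28 n2 o1 nn (CR (Mul (Entry 18 rI rL) (v3 25))),
   Fill 30 n2 o1 nn (CR (Mul (Mul (Entry 17 rI rL) (v3 25)) (Mul (Entry 17 rI rL) (v3 25)))),
   Fill 10 n2 o1 o1 (CR (Mul (v1 10) (Sub (Add (Add (cn 1) (v1 28)) (Mul (cn 3) (Mul (v1 28) (v1 28)))) (Mul (cn 32) (v1 30))))),
   Fill 31 n2 o1 nn (CR (Mul (Entry 2 rI rL) (v3 25))),
   Fill 13 n2 o1 o1 (CI (BLess (cn 1) (v1 11)) (CR (v1 13)) (CR (Add (v1 13) (v1 31)))),
   Fill 8 nn o1 o1 (CR (Add (v1 8) (v1 25)))]) N1"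
    unfolding M4_def N1_def Na_def p_move_def by simp
  have n1f: "N1 10 = M 10" "N1 11 = M1 11" "N1 13 = M 13" "N1 8 = M 8" "N1 17 = M1 17" "N1 18 = M1 18" "N1 2 = M 2"
    "N1 4 = M 4" "N1 9 = M 9"
    by (simp_all add: N1f m3)
  have w': "M4 10 i 0 = M 10 i 0 * (1 + (\<Sum>j<n. M1 18 i j * \<delta> j) + 3 * (\<Sum>j<n. M1 18 i j * \<delta> j)\<^sup>2 - 32 * (\<Sum>j<n. (M1 17 i j * \<delta> j)\<^sup>2))"
    if "i < 2*n" for i
    using that by (simp add: M4e fillv_def n1f N1d power2_eq_square)
  have d': "M4 13 i 0 = (if M1 11 i 0 > 1 then M 13 i 0 else M 13 i 0 + dot i \<delta>)" if "i < 2*n" for i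
    using that by (simp add: M4e fillv_def n1f N1d dot_def aM cong: if_cong)
  have x': "xv M4 j = xv M j + \<delta> j" if "j < n" for j
    using that by (simp add: xv_def M4e fillv_def n1f N1d)
  have fin: "M4 11 = M1 11" "M4 4 = M 4" "M4 9 = M 9" by (simp_all add: M4e n1f)
  have sq: "(\<Sum>j<n. b j * \<delta> j)\<^sup>2 = (\<Sum>j<n. b j * \<delta>0 j)\<^sup>2" "(\<Sum>j<n. (b j * \<delta> j)\<^sup>2) = (\<Sum>j<n. (b j * \<delta>0 j)\<^sup>2)"
    "(\<Sum>j<n. (\<delta> j)\<^sup>2) = (\<Sum>j<n. (\<delta>0 j)\<^sup>2)" for b :: "nat \<Rightarrow> real"
    by (cases "0 < lin"; simp add: \<delta>_def sum_negf)+
  have "walk_inv p (M 4 0 0) (xv M4) (\<lambda>i. M 9 i 0) (\<lambda>i. M4 10 i 0) (\<lambda>i. M1 11 i 0) (\<lambda>i. M4 13 i 0) \<and>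
    potential (\<lambda>i. M4 10 i 0) (\<lambda>i. M1 11 i 0) (\<lambda>i. M4 13 i 0) - (\<Sum>j<n. (xv M4 j)\<^sup>2) \<le>
    potential (\<lambda>i. M 10 i 0) (\<lambda>i. M1 11 i 0) (\<lambda>i. M 13 i 0) - (\<Sum>j<n. (xv M j)\<^sup>2) - 1 / (32 * (real n)\<^sup>2)"
  proof (rule conjI; rule step_inv[OF inv1 blk(4) s g _ _ _ _ _ w' d' x'])
    show "(\<Sum>i<2*n. if M1 11 i 0 > 1 then 3 * M 10 i 0 * (\<Sum>j<n. M1 18 i j * \<delta> j)\<^sup>2 - 32 * M 10 i 0 * (\<Sum>j<n. (M1 17 i j * \<delta> j)\<^sup>2)
      else V * (\<Sum>j<n. a i j * \<delta> j)\<^sup>2) - (\<Sum>j<n. (\<delta> j)\<^sup>2) \<le> - (1 / (32 * (real n)\<^sup>2))"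
      using quad0 by (simp only: sq VD minus_divide_left)
    then show "(\<Sum>i<2*n. if M1 11 i 0 > 1 then 3 * M 10 i 0 * (\<Sum>j<n. M1 18 i j * \<delta> j)\<^sup>2 - 32 * M 10 i 0 * (\<Sum>j<n. (M1 17 i j * \<delta> j)\<^sup>2)
      else V * (\<Sum>j<n. a i j * \<delta> j)\<^sup>2) - (\<Sum>j<n. (\<delta> j)\<^sup>2) \<le> - (1 / (32 * (real n)\<^sup>2))" .
    have "(\<Sum>j<n. \<delta> j * ((\<Sum>i<2*n. if M1 11 i 0 > 1 then M 10 i 0 * M1 18 i j else 2 * V * M 13 i 0 * a i j) - 2 * xv M j))
      = (if 0 < lin then - lin else lin)"
      by (simp add: \<delta>_def lin_def sum_negf)
    then show "(\<Sum>j<n. \<delta> j * ((\<Sum>i<2*n. if M1 11 i 0 > 1 then M 10 i 0 * M1 18 i j else 2 * V * M 13 i 0 * a i j) - 2 * xv M j)) \<le> 0"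
      by simp
    then show "(\<Sum>j<n. \<delta> j * ((\<Sum>i<2*n. if M1 11 i 0 > 1 then M 10 i 0 * M1 18 i j else 2 * V * M 13 i 0 * a i j) - 2 * xv M j)) \<le> 0" .
  qed (use \<delta>b \<delta>S in \<open>auto simp: \<delta>_def S_def\<close>)
  moreover have "potential (\<lambda>i. M 10 i 0) (\<lambda>i. M1 11 i 0) (\<lambda>i. M 13 i 0) = potential (\<lambda>i. M 10 i 0) (\<lambda>i. M 11 i 0) (\<lambda>i. M 13 i 0)"
    by (rule blk(3))
  ultimately show "state_inv p (sem n p_step M)" "L (sem n p_step M) \<le> L M - 1 / (32 * (real n)\<^sup>2)"
    unfolding M4 state_inv_def L_def fin by simp_all
qed

end

section \<open>Termination of the walk\<close>

context discrepancy
begin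

lemma arrays_written_body: "{2, 3, 5, 6, 7} \<inter> arrays_written p_body = {}" "{1, 2, 3, 5, 6, 7} \<inter> arrays_written p_init = {}" "1 \<notin> arrays_written p_body"
  by (simp_all add: p_body_def p_live_def p_cnt_def p_step_def p_newphase_def p_matrix_def p_power_def p_select_def p_move_def
    p_init_def)

text \<open>A new phase can raise \<open>L\<close>, but by at most \<open>14 n\<close> since \<open>- n \<le> L \<le> 13 n\<close>; the second term pays for this.\<close>

definition total_potential where "total_potential p M = L M + 16 * real n * (2 * real n - real p)"

lemma L_bounds: "state_inv p M \<Longrightarrow> - real n \<le> L M" "state_inv p M \<Longrightarrow> L M \<le> 13 * real n"
proof -
  assume "state_inv p M"
  then have i: "walk_inv p (M 4 0 0) (xv M) (\<lambda>i. M 9 i 0) (\<lambda>i. M 10 i 0) (\<lambda>i. M 11 i 0) (\<lambda>i. M 13 i 0)" by (simp add: state_inv_def)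
  have "potential (\<lambda>i. M 10 i 0) (\<lambda>i. M 11 i 0) (\<lambda>i. M 13 i 0) \<ge> 0"
    using walk_inv_facts(2)[OF i] by (rule potential_nonneg)
  moreover have "(\<Sum>j<n. (xv M j)\<^sup>2) \<le> real n" by (rule sum_x_le) (use i in \<open>auto simp: walk_inv_def\<close>)
  ultimately show "- real n \<le> L M" unfolding L_def by linarith
  show "L M \<le> 13 * real n" using i by (auto simp: walk_inv_def L_def)
qed

lemma body_sem:
  assumes "env M" "state_inv p M"
  shows "env (sem n p_body M) \<and> (\<exists>p'. state_inv p' (sem n p_body M) \<and>
    (if alive (xv M) = {} then xv (sem n p_body M) = xv M
     else total_potential p' (sem n p_body M) \<le> total_potential p M - 1 / (32 * (real n)\<^sup>2)))"
proof -
  define M1 where "M1 = sem n p_live M"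
  define M2 where "M2 = sem n p_cnt M1"
  have f1: "M1 b = M b" if "b \<notin> {14, 64}" for b unfolding M1_def by (rule sem_frame) (use that in \<open>simp add: p_live_def\<close>)
  have f2: "M2 b = M1 b" if "b \<notin> {15, 65}" for b unfolding M2_def by (rule sem_frame) (use that in \<open>simp add: p_cnt_def\<close>)
  have xv: "xv M2 = xv M" by (simp add: xv_def fun_eq_iff f1 f2)
  have env2: "env M2" using assms(1) by (simp add: env_def f1 f2)
  have inv2: "state_inv p M2" using assms(2) unfolding state_inv_def xv by (simp add: f1 f2)
  have L2: "L M2 = L M" unfolding L_def xv by (simp add: f1 f2)
  have live1: "live M1" "xv M1 = xv M" unfolding M1_def by (rule live_sem)+
  then have live2: "live M2" unfolding live_def xv by (simp add: f2)
  have cnt: "M2 15 0 0 = real (card (alive (xv M)))" unfolding M2_def using cnt_sem[OF live1(1)] live1(2) by simp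
  have envB: "env (sem n p_body M)" using assms(1) arrays_written_body(1) by (rule env_frame)
  have B: "sem n p_body M = (if 0 < M2 15 0 0 then if M2 4 0 0 < 2 * M2 15 0 0 then sem n p_step M2 else sem n p_newphase M2 else M2)"
    by (simp add: p_body_def M1_def M2_def)
  have eps: "1 / (32 * (real n)\<^sup>2) \<le> real n"
  proof -
    have "1 \<le> (real n)\<^sup>2" using n1 by (rule one_le_power)
    then have "1 / (32 * (real n)\<^sup>2) \<le> 1" by (subst pos_divide_le_eq) linarith+
    then show ?thesis using n1 by linarith
  qed
  show ?thesis
  proof (cases "alive (xv M) = {}")
    case True
    then have "sem n p_body M = M2" using B cnt by simp
    then show ?thesis using envB inv2 True xv by auto
  next
    case False
    then have pos: "0 < card (alive (xv M))" using fin_alive by (simp add: card_gt_0_iff)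
    show ?thesis
    proof (cases "M2 4 0 0 < 2 * M2 15 0 0")
      case True
      then have e: "sem n p_body M = sem n p_step M2" using B cnt pos by simp
      note st = step_sem[OF env2 inv2 live2]
      have k: "M2 4 0 0 < 2 * real (card (alive (xv M2)))" using True cnt xv by simp
      show ?thesis using envB st(1)[OF k] st(2)[OF k] False L2 unfolding e total_potential_def by (intro conjI exI[of _ p]) auto
    next
      case F: False
      then have e: "sem n p_body M = sem n p_newphase M2" using B cnt pos by simp
      have ne: "alive (xv M2) \<noteq> {}" using False xv by simp
      have k: "2 * real (card (alive (xv M2))) \<le> M2 4 0 0" using F cnt xv by simp
      note nw = newphase_sem[OF env2 inv2 live2 ne k]
      have "L (sem n p_newphase M2) \<le> 13 * real n" using L_bounds(2)[OF nw(1)] .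
      moreover have "- real n \<le> L M" using L_bounds(1)[OF inv2] L2 by simp
      moreover have "16 * real n * (2 * real n - real (Suc p)) = 16 * real n * (2 * real n - real p) - 16 * real n"
        by (simp add: algebra_simps)
      ultimately have "total_potential (Suc p) (sem n p_newphase M2) \<le> total_potential p M - 1 / (32 * (real n)\<^sup>2)"
        using eps unfolding total_potential_def by linarith
      then show ?thesis using envB nw(1) False unfolding e by (intro conjI exI[of _ "Suc p"]) auto
    qed
  qed
qed

text \<open>While coordinates are alive, each round lowers the total potential by
  \<open>1 / (32 * n\<^sup>2)\<close>. Over \<open>2000 * n ^ 4\<close> rounds this would be
  \<open>62.5 * n\<^sup>2\<close>, more than its range of at most
  \<open>32 * n\<^sup>2 + n\<close>.\<close>

lemma iterate_sem:
  assumes "env M" "state_inv 0 M" "L M \<le> 0"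
  shows "\<exists>p. state_inv p ((sem n p_body ^^ (2000 * n ^ 4)) M)" "alive (xv ((sem n p_body ^^ (2000 * n ^ 4)) M)) = {}"
    "env ((sem n p_body ^^ (2000 * n ^ 4)) M)"
proof -
  define F where "F t = (sem n p_body ^^ t) M" for t
  define \<epsilon> where "\<epsilon> = 1 / (32 * (real n)\<^sup>2)"
  have main: "env (F t) \<and> (\<exists>p. state_inv p (F t) \<and> (alive (xv (F t)) = {} \<or> total_potential p (F t) \<le> total_potential 0 M - real t * \<epsilon>))" for t
  proof (induction t)
    case 0
    then show ?case using assms by (auto simp: F_def)
  next
    case (Suc t)
    then obtain p where p: "env (F t)" "state_inv p (F t)" "alive (xv (F t)) = {} \<or> total_potential p (F t) \<le> total_potential 0 M - real t * \<epsilon>" by auto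
    have FS: "F (Suc t) = sem n p_body (F t)" by (simp add: F_def)
    obtain p' where p': "env (F (Suc t))" "state_inv p' (F (Suc t))"
      "if alive (xv (F t)) = {} then xv (F (Suc t)) = xv (F t) else total_potential p' (F (Suc t)) \<le> total_potential p (F t) - \<epsilon>"
      using body_sem[OF p(1,2)] unfolding FS \<epsilon>_def by blast
    have "real (Suc t) * \<epsilon> = real t * \<epsilon> + \<epsilon>" by (simp add: algebra_simps)
    then have "alive (xv (F (Suc t))) = {} \<or> total_potential p' (F (Suc t)) \<le> total_potential 0 M - real (Suc t) * \<epsilon>"
      using p'(3) p(3) by (auto split: if_splits)
    then show ?case using p' by auto
  qed
  obtain p where p: "env (F (2000 * n ^ 4))" "state_inv p (F (2000 * n ^ 4))"
    "alive (xv (F (2000 * n ^ 4))) = {} \<or> total_potential p (F (2000 * n ^ 4)) \<le> total_potential 0 M - real (2000 * n ^ 4) * \<epsilon>"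
    using main[of "2000 * n ^ 4"] by auto
  have "alive (xv (F (2000 * n ^ 4))) = {}"
  proof (rule ccontr)
    assume "\<not> ?thesis"
    then have l: "total_potential p (F (2000 * n ^ 4)) \<le> total_potential 0 M - real (2000 * n ^ 4) * \<epsilon>" using p(3) by simp
    have "p \<le> 2 * n" using walk_inv_facts(5) p(2) unfolding state_inv_def by blast
    then have "real p \<le> 2 * real n" by linarith
    then have "0 \<le> 16 * real n * (2 * real n - real p)" by simp
    then have "- real n \<le> total_potential p (F (2000 * n ^ 4))" using L_bounds(1)[OF p(2)] unfolding total_potential_def by linarith
    moreover have "total_potential 0 M \<le> 32 * (real n)\<^sup>2" using assms(3) by (simp add: total_potential_def power2_eq_square)
    moreover have "real (2000 * n ^ 4) * \<epsilon> = 125 / 2 * (real n)\<^sup>2"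
    proof -
      define q where "q = (real n)\<^sup>2"
      have "q > 0" using n1 by (simp add: q_def)
      moreover have "real (2000 * n ^ 4) = 2000 * (q * q)" by (simp add: q_def power_add[symmetric])
      ultimately show ?thesis unfolding \<epsilon>_def q_def[symmetric] by simp
    qed
    moreover have "real n \<le> (real n)\<^sup>2" using n1 by (simp add: power2_eq_square)
    ultimately show False using l n1 by linarith
  qed
  then show "alive (xv ((sem n p_body ^^ (2000 * n ^ 4)) M)) = {}" "env ((sem n p_body ^^ (2000 * n ^ 4)) M)"
    "\<exists>p. state_inv p ((sem n p_body ^^ (2000 * n ^ 4)) M)" using p unfolding F_def by auto
qed

lemma init_sem:
  assumes "env M"
  shows "env (sem n p_init M)" "state_inv 0 (sem n p_init M)" "L (sem n p_init M) \<le> 0"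
proof -
  show "env (sem n p_init M)" by (rule env_frame[OF assms]) (use arrays_written_body(2) in auto)
  have v: "sem n p_init M 4 0 0 = 2 * real n" "\<And>j. j < n \<Longrightarrow> xv (sem n p_init M) j = 0"
    "\<And>i. i < 2*n \<Longrightarrow> sem n p_init M 9 i 0 = 1" "\<And>i. i < 2*n \<Longrightarrow> sem n p_init M 10 i 0 = 0"
    "\<And>i. i < 2*n \<Longrightarrow> sem n p_init M 11 i 0 = 0" "\<And>i. i < 2*n \<Longrightarrow> sem n p_init M 13 i 0 = 0"
    by (simp_all add: p_init_def xv_def)
  have potential: "potential (\<lambda>i. sem n p_init M 10 i 0) (\<lambda>i. sem n p_init M 11 i 0) (\<lambda>i. sem n p_init M 13 i 0) = 0"
    unfolding potential_def by (intro sum.neutral) (simp add: v)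
  show "state_inv 0 (sem n p_init M)"
    unfolding state_inv_def walk_inv_def potential using n1
    by (auto simp: v row_inv_def at_level_def dot_def K1_def intro!: exI[of _ 0])
  show "L (sem n p_init M) \<le> 0" unfolding L_def potential by (simp add: sum_nonneg)
qed

section \<open>Rounding to signs and keeping the best vector\<close>

definition signs_stored :: "store \<Rightarrow> bool" where "signs_stored M \<longleftrightarrow> (\<forall>j<n. M 1 j 0 = 1 \<or> M 1 j 0 = -1)"
definition output_bounded :: "real \<Rightarrow> store \<Rightarrow> bool" where
  "output_bounded B M \<longleftrightarrow> signs_stored M \<and> (\<forall>i<2*n. dot i (\<lambda>j. M 1 j 0) \<le> B)"

lemma candidate_bound:
  assumes "state_inv p M" "alive (xv M) = {}" "i < 2*n"
  shows "dot i (\<lambda>j. if xv M j < 0 then -1 else 1) \<le> (K1 + 6002) * T"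
proof -
  define cd where "cd j = (if xv M j < 0 then -1 else (1::real))" for j
  have i: "walk_inv p (M 4 0 0) (xv M) (\<lambda>i. M 9 i 0) (\<lambda>i. M 10 i 0) (\<lambda>i. M 11 i 0) (\<lambda>i. M 13 i 0)" using assms by (simp add: state_inv_def)
  have x: "\<bar>xv M j\<bar> \<le> 1" if "j < n" for j using i that by (auto simp: walk_inv_def)
  have cl: "\<bar>cd j - xv M j\<bar> \<le> 1 / real n" if j: "j < n" for j
  proof -
    have "j \<notin> alive (xv M)" using assms(2) by simp
    then have "real n * xv M j \<le> - (real n - 1) \<or> real n * xv M j \<ge> real n - 1" using j by (auto simp: alive_def)
    then have "real n * \<bar>cd j - xv M j\<bar> \<le> 1"
    proof
      assume h: "real n * xv M j \<le> - (real n - 1)"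
      show ?thesis
      proof (cases "xv M j < 0")
        case True
        then have "\<bar>cd j - xv M j\<bar> = 1 + xv M j" using x[OF j] by (simp add: cd_def)
        then show ?thesis using h by (simp add: distrib_left)
      next
        case False
        \<comment> \<open>For \<open>n = 1\<close> the two frozen regions meet at 0, which is
          rounded to 1 at distance exactly \<open>1 / n\<close>.\<close>
        then have "real n * xv M j \<ge> 0" by simp
        then have "real n = 1" using h n1 by linarith
        then show ?thesis using False x[OF j] h by (simp add: cd_def)
      qed
    next
      assume h: "real n * xv M j \<ge> real n - 1"
      show ?thesis
      proof (cases "xv M j < 0")
        case True
        then have "real n * xv M j < 0" using n1 by (simp add: mult_pos_neg)
        then show ?thesis using h n1 by linarith
      next
        case False
        then have "\<bar>cd j - xv M j\<bar> = 1 - xv M j" using x[OF j] by (simp add: cd_def)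
        then show ?thesis using h by (simp add: right_diff_distrib)
      qed
    qed
    then show ?thesis using n1 by (simp add: pos_le_divide_eq mult.commute)
  qed
  have ab: "\<bar>a i j\<bar> \<le> 2" if j: "j < n" for j
  proof -
    have "(a i j)\<^sup>2 \<le> (\<Sum>i<2*n. (a i j)\<^sup>2)" by (rule member_le_sum) (use assms(3) in auto)
    also have "\<dots> \<le> 2\<^sup>2" using col[OF j] by simp
    finally show ?thesis using abs_le_square_iff[of "a i j" 2] by simp
  qed
  have "dot i cd - dot i (xv M) = (\<Sum>j<n. a i j * (cd j - xv M j))"
    by (simp add: dot_def sum_subtractf right_diff_distrib)
  also have "\<dots> \<le> (\<Sum>j<n. 2 * (1 / real n))"
  proof (rule sum_mono)
    fix j assume "j \<in> {..<n}"
    then have "\<bar>a i j\<bar> * \<bar>cd j - xv M j\<bar> \<le> 2 * (1 / real n)" using ab cl by (intro mult_mono) auto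
    then show "a i j * (cd j - xv M j) \<le> 2 * (1 / real n)" by (simp only: abs_mult[symmetric] abs_le_iff)
  qed
  also have "\<dots> = 2" using n1 by simp
  finally have "dot i cd \<le> (K1 + 6000) * T + 2" using walk_inv_bound[OF i assms(3)] by linarith
  also have "\<dots> \<le> (K1 + 6002) * T" using T by (simp add: algebra_simps)
  finally have "dot i cd \<le> (K1 + 6002) * T" .
  moreover have "cd = (\<lambda>j. if xv M j < 0 then -1 else 1)" by (auto simp: cd_def)
  ultimately show ?thesis by simp
qed

definition rows_stored :: "store \<Rightarrow> bool" where
  "rows_stored M \<longleftrightarrow> (\<forall>i<2*n. \<forall>j<n. M 2 i j = a i j) \<and> (\<forall>i<2*n. M 3 i 0 = (\<Sum>j<n. (a i j)\<^sup>2))"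

text \<open>\<open>B\<close> is arbitrary: the maximum over the signed rows never increases and does
  not exceed that of the candidate.\<close>

lemma keep_sem:
  assumes "rows_stored M" "signs_stored M"
  shows "output_bounded B M \<Longrightarrow> output_bounded B (sem n p_keep M)" "signs_stored (sem n p_keep M)"
    "(\<And>i. i < 2*n \<Longrightarrow> dot i (\<lambda>j. if xv M j < 0 then -1 else 1) \<le> B) \<Longrightarrow> output_bounded B (sem n p_keep M)"
proof -
  note [simp del] = One_nat_def
  have s1: "(\<Sum>l<1. f l) = f 0" for f :: "nat \<Rightarrow> real" by (simp add: One_nat_def)
  define cd where "cd j = (if xv M j < 0 then -1 else (1::real))" for j
  define ou where "ou j = M 1 j 0" for j
  define M1 where "M1 = sem n (seqs [Fill 29 nn o1 o1 (CI (BLess (v1 8) (cn 0)) (CR (neg (cn 1))) (CR (cn 1))),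
   Fill 33 n2 o1 nn (CR (Mul (Entry 2 rI rL) (v3 29))),
   Fill 34 n2 o1 nn (CR (Mul (Entry 2 rI rL) (v3 1)))]) M"
  have aM: "M 2 i j = a i j" if "i < 2*n" "j < n" for i j using assms(1) that by (simp add: rows_stored_def)
  have c: "M1 29 j 0 = cd j" if "j < n" for j using that by (simp add: M1_def cd_def xv_def)
  have vc: "M1 33 i 0 = dot i cd" if "i < 2*n" for i
    using that by (simp add: M1_def fillv_def dot_def cd_def xv_def aM s1 cong: if_cong)
  have vo: "M1 34 i 0 = dot i ou" if "i < 2*n" for i
    using that by (simp add: M1_def fillv_def dot_def ou_def aM)
  have f1: "M1 1 = M 1" by (simp add: M1_def)
  define M2 where "M2 = sem n (Fill 35 n2 o1 n2 (CI (ble (v1 34) (v3 33)) (CR (cn 1)) (CR (cn 0)))) M1"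
  define cnt where "cnt i = (\<Sum>i'<2*n. if dot i ou \<le> dot i' cd then 1 else (0::real))" for i
  have ct: "M2 35 i 0 = cnt i" if "i < 2*n" for i
    using that unfolding M2_def cnt_def by (auto simp: fillv_def vo vc not_less intro!: sum.cong)
  define bt where "bt = (\<Sum>i<2*n. if cnt i < 1 then 1 else (0::real))"
  have ke: "sem n p_keep M = sem n (Fill 1 nn o1 o1 (CI (BLess (cn 0) (sc 36)) (CR (v1 29)) (CR (v1 1))))
    (sem n (Fill 36 o1 o1 n2 (CI (BLess (v3 35) (cn 1)) (CR (cn 1)) (CR (cn 0)))) M2)"
    by (simp add: p_keep_def M2_def M1_def)
  have b36: "sem n (Fill 36 o1 o1 n2 (CI (BLess (v3 35) (cn 1)) (CR (cn 1)) (CR (cn 0)))) M2 36 0 0 = bt"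
    unfolding bt_def by (auto simp: fillv_def ct intro!: sum.cong)
  have M2f: "M2 29 = M1 29" "M2 1 = M 1" by (simp_all add: M2_def f1)
  have out: "sem n p_keep M 1 j 0 = (if 0 < bt then cd j else ou j)" if "j < n" for j
    using that b36 unfolding ke by (simp add: M2f c ou_def)
  have cnt_pos: "cnt i < 1 \<longleftrightarrow> (\<forall>i'<2*n. dot i' cd < dot i ou)" for i
  proof
    assume h: "cnt i < 1"
    show "\<forall>i'<2*n. dot i' cd < dot i ou"
    proof (intro allI impI, rule ccontr)
      fix i' assume i': "i' < 2*n" "\<not> dot i' cd < dot i ou"
      then have "1 = (if dot i ou \<le> dot i' cd then 1 else (0::real))" by auto
      also have "\<dots> \<le> cnt i" unfolding cnt_def
        by (rule member_le_sum[of i' "{..<2*n}" "\<lambda>i'. if dot i ou \<le> dot i' cd then 1 else (0::real)"]) (use i' in auto)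
      finally show False using h by simp
    qed
  next
    assume h: "\<forall>i'<2*n. dot i' cd < dot i ou"
    have "cnt i = 0" unfolding cnt_def by (rule sum.neutral) (use h in \<open>auto simp: not_le\<close>)
    then show "cnt i < 1" by simp
  qed
  have bt_pos: "0 < bt \<longleftrightarrow> (\<exists>i<2*n. \<forall>i'<2*n. dot i' cd < dot i ou)"
  proof
    assume h: "0 < bt"
    show "\<exists>i<2*n. \<forall>i'<2*n. dot i' cd < dot i ou"
    proof (rule ccontr)
      assume "\<not> ?thesis"
      then have "bt = 0" unfolding bt_def by (intro sum.neutral) (auto simp: cnt_pos)
      then show False using h by simp
    qed
  next
    assume "\<exists>i<2*n. \<forall>i'<2*n. dot i' cd < dot i ou"
    then obtain i where i: "i < 2*n" "cnt i < 1" using cnt_pos by auto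
    have "1 = (if cnt i < 1 then 1 else (0::real))" using i by simp
    also have "\<dots> \<le> bt" unfolding bt_def
      by (rule member_le_sum[of i "{..<2*n}" "\<lambda>i. if cnt i < 1 then 1 else (0::real)"]) (use i in auto)
    finally show "0 < bt" by simp
  qed
  show sg: "signs_stored (sem n p_keep M)" using assms(2) by (auto simp: signs_stored_def out ou_def cd_def)
  have de: "dot i (\<lambda>j. sem n p_keep M 1 j 0) = (if 0 < bt then dot i cd else dot i ou)" for i
    by (auto simp: dot_def out intro!: sum.cong)
  show "output_bounded B (sem n p_keep M)" if "output_bounded B M"
  proof -
    have ob: "dot i ou \<le> B" if "i < 2*n" for i using \<open>output_bounded B M\<close> that unfolding output_bounded_def ou_def by blast
    have "dot i cd \<le> B" if "0 < bt" "i < 2*n" for i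
      using that bt_pos ob by (meson less_imp_le order_trans)
    then show ?thesis using sg ob by (auto simp: output_bounded_def de)
  qed
  show "output_bounded B (sem n p_keep M)" if H: "\<And>i. i < 2*n \<Longrightarrow> dot i (\<lambda>j. if xv M j < 0 then -1 else 1) \<le> B"
  proof -
    have cb: "dot i cd \<le> B" if "i < 2*n" for i
    proof -
      have "dot i (\<lambda>j. if xv M j < 0 then -1 else 1) \<le> B" by (rule H[OF that])
      moreover have "cd = (\<lambda>j. if xv M j < 0 then -1 else 1)" by (auto simp: cd_def)
      ultimately show ?thesis by simp
    qed
    have "dot i ou \<le> B" if "\<not> 0 < bt" "i < 2*n" for i
      using that bt_pos cb by (meson not_less order_trans)
    then show ?thesis using sg cb by (auto simp: output_bounded_def de)
  qed
qed

end

lemma arrays_written_try: "{2, 3} \<inter> arrays_written p_try = {}" "{5, 6, 7} \<inter> arrays_written p_try = {}" "1 \<notin> arrays_written p_init"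
  by (simp_all add: p_try_def p_body_def p_live_def p_cnt_def p_step_def p_newphase_def p_matrix_def
    p_power_def p_select_def p_move_def p_init_def p_keep_def)

context discrepancy
begin

lemma rows_stored_frame: "rows_stored M \<Longrightarrow> {2, 3} \<inter> arrays_written p = {} \<Longrightarrow> rows_stored (sem n p M)"
  using sem_frame[of 2 p n M] sem_frame[of 3 p n M] unfolding rows_stored_def by simp

text \<open>A wrong guess gives no control over the walk, but the result is still a sign vector and
  replaces the output only if it is better. The bound by \<open>T\<close> needs \<open>env\<close>,
  that is, the guess of this locale.\<close>

lemma try_sem:
  assumes "rows_stored M" "signs_stored M"
  shows "rows_stored (sem n p_try M)" "signs_stored (sem n p_try M)" "output_bounded B M \<Longrightarrow> output_bounded B (sem n p_try M)"
    "sem n p_try M 5 = M 5" "sem n p_try M 6 = M 6" "sem n p_try M 7 = M 7"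
    "env M \<Longrightarrow> output_bounded ((K1 + 6002) * T) (sem n p_try M)"
proof -
  define M1 where "M1 = sem n p_init M"
  define M2 where "M2 = (sem n p_body ^^ (2000 * n ^ 4)) M1"
  have e: "sem n p_try M = sem n p_keep M2" by (simp add: p_try_def M2_def M1_def bnd_def)
  have M2e: "M2 = sem n (GRep 5 (2000, 4) p_body) M1" by (simp add: M2_def bnd_def)
  have "M2 1 = M1 1" unfolding M2e by (rule sem_frame) (use arrays_written_body(3) in simp)
  moreover have "M1 1 = M 1" unfolding M1_def by (rule sem_frame) (rule arrays_written_try(3))
  ultimately have M21: "M2 1 = M 1" by simp
  then have sg: "signs_stored M2" and gd: "output_bounded B M \<Longrightarrow> output_bounded B M2" using assms(2) by (simp_all add: signs_stored_def output_bounded_def)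
  have r1: "rows_stored M1" unfolding M1_def by (rule rows_stored_frame[OF assms(1)]) (use arrays_written_body(2) in auto)
  have r2: "rows_stored M2" unfolding M2e by (rule rows_stored_frame[OF r1]) (use arrays_written_body(1) in auto)
  show "rows_stored (sem n p_try M)" by (rule rows_stored_frame[OF assms(1) arrays_written_try(1)])
  show "signs_stored (sem n p_try M)" unfolding e by (rule keep_sem(2)[OF r2 sg])
  show "output_bounded B M \<Longrightarrow> output_bounded B (sem n p_try M)" unfolding e by (rule keep_sem(1)[OF r2 sg gd])
  show "sem n p_try M 5 = M 5" "sem n p_try M 6 = M 6" "sem n p_try M 7 = M 7"
    using arrays_written_try(2) by (auto intro!: sem_frame)
  assume "env M"
  note i = init_sem[OF \<open>env M\<close>, folded M1_def]
  note it = iterate_sem[OF i, folded M2_def]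
  obtain p where p: "state_inv p M2" using it(1) by blast
  show "output_bounded ((K1 + 6002) * T) (sem n p_try M)"
    unfolding e by (rule keep_sem(3)[OF r2 sg candidate_bound[OF p it(2)]])
qed

text \<open>Array 6 holds \<open>2 ^ h\<close> after \<open>h\<close> rounds, so the guess
  \<open>T = 2 ^ t\<close> is tried in the round that follows \<open>t\<close> others; the later
  rounds cannot spoil its bound.\<close>

lemma scale_sem:
  assumes "rows_stored M" "signs_stored M" "M 6 0 0 = 1" "M 7 0 0 = 1"
  defines "F h \<equiv> (sem n p_scale ^^ h) M"
  shows "rows_stored (F h)" "signs_stored (F h)" "F h 5 = M 5" "output_bounded B M \<Longrightarrow> output_bounded B (F h)"
    "M 5 0 0 = Lg \<Longrightarrow> T = 2 ^ t \<Longrightarrow> t < h \<Longrightarrow> output_bounded ((K1 + 6002) * T) (F h)"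
proof -
  have st: "rows_stored (sem n p_scale M) \<and> signs_stored (sem n p_scale M) \<and> sem n p_scale M 5 = M 5 \<and>
    sem n p_scale M 6 0 0 = 2 * M 6 0 0 \<and> sem n p_scale M 7 0 0 = M 7 0 0 / 2 \<and>
    (output_bounded B M \<longrightarrow> output_bounded B (sem n p_scale M)) \<and> (env M \<longrightarrow> output_bounded ((K1 + 6002) * T) (sem n p_scale M))"
    if "rows_stored M" "signs_stored M" for M B
  proof -
    note t = try_sem[OF that]
    define N where "N = sem n p_scale M"
    have N: "N b = sem n p_try M b" if "b \<notin> {6, 7, 56, 57}" for b using that by (simp add: N_def p_scale_def)
    have "N 6 0 0 = 2 * M 6 0 0" "N 7 0 0 = M 7 0 0 / 2" using t by (simp_all add: N_def p_scale_def)
    moreover have "N 1 = sem n p_try M 1" "N 2 = sem n p_try M 2" "N 3 = sem n p_try M 3" "N 5 = sem n p_try M 5"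
      by (rule N, simp)+
    ultimately show ?thesis unfolding N_def[symmetric] using t by (simp add: rows_stored_def signs_stored_def output_bounded_def)
  qed
  have all: "rows_stored (F h) \<and> signs_stored (F h) \<and> F h 5 = M 5 \<and> F h 6 0 0 = 2 ^ h \<and> F h 7 0 0 = 1 / 2 ^ h" for h
  proof (induction h)
    case 0
    then show ?case using assms by (simp add: F_def)
  next
    case (Suc h)
    then show ?case using st[of "F h"] by (simp add: F_def)
  qed
  show "rows_stored (F h)" "signs_stored (F h)" "F h 5 = M 5" using all by auto
  have mono: "output_bounded B (F h) \<Longrightarrow> output_bounded B (F (h + k))" for B h k
  proof (induction k)
    case (Suc k)
    then show ?case using st[of "F (h + k)" B] all[of "h + k"] by (simp add: F_def)
  qed simp
  show "output_bounded B (F h)" if "output_bounded B M" using mono[of B 0 h] that by (simp add: F_def)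
  assume h: "M 5 0 0 = Lg" "T = 2 ^ t" "t < h"
  have "env (F t)" unfolding env_def using all[of t] h by (simp add: rows_stored_def)
  then have "output_bounded ((K1 + 6002) * T) (F (Suc t))" using st[of "F t"] all[of t] by (simp add: F_def)
  then show "output_bounded ((K1 + 6002) * T) (F h)" using mono[of _ "Suc t" "h - Suc t"] h(3) by simp
qed

lemma log_sem:
  assumes "rows_stored M" "signs_stored M" "M 5 0 0 = 0"
  defines "F h \<equiv> (sem n p_log ^^ h) M"
  shows "signs_stored (F h)" "Lg = real lg \<Longrightarrow> 1 \<le> lg \<Longrightarrow> lg \<le> h \<Longrightarrow> T = 2 ^ t \<Longrightarrow> t < n \<Longrightarrow> output_bounded ((K1 + 6002) * T) (F h)"
proof -
  have st: "rows_stored (sem n p_log M) \<and> signs_stored (sem n p_log M) \<and> sem n p_log M 5 0 0 = M 5 0 0 + 1 \<and>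
    (output_bounded B M \<longrightarrow> output_bounded B (sem n p_log M)) \<and>
    (M 5 0 0 + 1 = Lg \<longrightarrow> T = 2 ^ t \<longrightarrow> t < n \<longrightarrow> output_bounded ((K1 + 6002) * T) (sem n p_log M))"
    if "rows_stored M" "signs_stored M" for M B t
  proof -
    define N where "N = sem n (seqs [Fill 5 o1 o1 o1 (CR (Add (sc 5) (cn 1))), Fill 6 o1 o1 o1 (CR (cn 1)), Fill 7 o1 o1 o1 (CR (cn 1))]) M"
    have e: "sem n p_log M = (sem n p_scale ^^ n) N" by (simp add: p_log_def N_def)
    have N: "N 6 0 0 = 1" "N 7 0 0 = 1" "N 5 0 0 = M 5 0 0 + 1" by (simp_all add: N_def)
    have Nb: "N b = M b" if "b \<notin> {5, 6, 7, 55, 56, 57}" for b using that by (simp add: N_def)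
    have "N 1 = M 1" "N 2 = M 2" "N 3 = M 3" by (rule Nb, simp)+
    then have N': "rows_stored N" "signs_stored N" "output_bounded B M \<Longrightarrow> output_bounded B N" using that by (simp_all add: rows_stored_def signs_stored_def output_bounded_def)
    note s = scale_sem[OF N'(1,2) N(1,2), where h = n, folded e]
    show ?thesis using s(1,2) s(3) s(4)[of B] s(5)[of t] N(3) N'(3) by auto
  qed
  have all: "rows_stored (F h) \<and> signs_stored (F h) \<and> F h 5 0 0 = real h" for h
  proof (induction h)
    case 0
    then show ?case using assms by (simp add: F_def)
  next
    case (Suc h)
    then show ?case using st[of "F h"] by (simp add: F_def)
  qed
  then show "signs_stored (F h)" by auto
  have mono: "output_bounded B (F h) \<Longrightarrow> output_bounded B (F (h + k))" for B h k
  proof (induction k)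
    case (Suc k)
    then show ?case using st[of "F (h + k)" B] all[of "h + k"] by (simp add: F_def)
  qed simp
  assume h: "Lg = real lg" "1 \<le> lg" "lg \<le> h" "T = 2 ^ t" "t < n"
  have "F (lg - 1) 5 0 0 + 1 = Lg" using all[of "lg - 1"] h by simp
  then have "output_bounded ((K1 + 6002) * T) (sem n p_log (F (lg - 1)))" using st[of "F (lg - 1)" _ t] all[of "lg - 1"] h by blast
  moreover have "sem n p_log (F (lg - 1)) = F lg" using h(2) by (cases lg) (simp_all add: F_def)
  ultimately show "output_bounded ((K1 + 6002) * T) (F h)" using mono[of _ lg "h - lg"] h(3) by simp
qed

end

subsection \<open>Discrepancy of the output\<close>

definition signed_rows :: "real mat \<Rightarrow> nat \<Rightarrow> nat \<Rightarrow> real" where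
  "signed_rows A i j = (if i < dim_row A then A $$ (i, j) else - (A $$ (i - dim_row A, j)))"

lemma sum_double: "(\<Sum>i<2*n. f i) = (\<Sum>i<n. f i) + (\<Sum>i<n. f (n + i))" for f :: "nat \<Rightarrow> real"
proof -
  have "(\<Sum>i<n+m. f i) = (\<Sum>i<n. f i) + (\<Sum>i<m. f (n + i))" for m by (induction m) auto
  from this[of n] show ?thesis by (simp add: mult_2)
qed

lemma l2_norm_sq: "(l2_norm v)\<^sup>2 = (\<Sum>i<dim_vec v. (v $ i)\<^sup>2)"
  by (simp add: l2_norm_def L2_set_def sum_nonneg)

lemma l2_norm_nonneg: "l2_norm v \<ge> 0" by (simp add: l2_norm_def)

lemma l2_norm_smult: "l2_norm (c \<cdot>\<^sub>v v) = \<bar>c\<bar> * l2_norm v"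
proof (rule power2_eq_imp_eq)
  show "(l2_norm (c \<cdot>\<^sub>v v))\<^sup>2 = (\<bar>c\<bar> * l2_norm v)\<^sup>2"
    by (simp add: l2_norm_sq power_mult_distrib sum_distrib_left)
qed (auto simp: l2_norm_nonneg)

text \<open>Homogeneity. The supremum is an upper bound only for a set bounded above, which follows
  from entries of absolute value at most 1.\<close>

lemma lambda_bound:
  assumes A: "A \<in> carrier_mat n n" "admissible A" and u: "u \<in> carrier_vec n" "u \<bullet> vec n (\<lambda>_. 1) = 0" "l2_norm u > 0"
  shows "l2_norm (entrywise_square A *\<^sub>v u) \<le> lambda A * l2_norm u"
proof -
  define B where "B = entrywise_square A"
  have B: "B \<in> carrier_mat n n" using A by (simp add: B_def entrywise_square_def)
  have Bij: "\<bar>B $$ (i, j)\<bar> \<le> 1" if "i < n" "j < n" for i j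
    using admissible_entry[OF A(2), of i j] A(1) that by (simp add: B_def entrywise_square_def abs_square_le_1)
  define X where "X = {l2_norm (B *\<^sub>v u) | u. u \<in> carrier_vec n \<and> l2_norm u = 1 \<and> u \<bullet> vec n (\<lambda>_. 1) = 0}"
  have lam: "lambda A = Sup X" using A(1) by (simp add: lambda_def X_def B_def)
  have "bdd_above X"
  proof (rule bdd_aboveI)
    fix y assume "y \<in> X"
    then obtain v where v: "y = l2_norm (B *\<^sub>v v)" "v \<in> carrier_vec n" "l2_norm v = 1" by (auto simp: X_def)
    have v1: "\<bar>v $ j\<bar> \<le> 1" if "j < n" for j
    proof -
      have "\<bar>v $ j\<bar> \<le> L2_set (\<lambda>j. \<bar>v $ j\<bar>) {..<n}" by (rule member_le_L2_set) (use that in auto)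
      also have "\<dots> = l2_norm v" using v(2) by (simp add: l2_norm_def L2_set_def)
      finally show ?thesis using v(3) by simp
    qed
    have "y \<le> (\<Sum>i<n. \<bar>(B *\<^sub>v v) $ i\<bar>)"
      using L2_set_le_sum_abs[of "\<lambda>i. (B *\<^sub>v v) $ i" "{..<n}"] B v(1) by (simp add: l2_norm_def)
    also have "\<dots> \<le> (\<Sum>i<n. real n)"
    proof (rule sum_mono)
      fix i assume "i \<in> {..<n}"
      then have i: "i < n" by simp
      have "(B *\<^sub>v v) $ i = (\<Sum>j\<in>{0..<n}. B $$ (i, j) * v $ j)"
        using B v(2) i by (simp add: mult_mat_vec_def scalar_prod_def)
      also have "\<bar>\<dots>\<bar> \<le> (\<Sum>j\<in>{0..<n}. 1)"
      proof (rule order_trans[OF sum_abs], rule sum_mono)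
        fix j assume "j \<in> {0..<n}"
        then show "\<bar>B $$ (i, j) * v $ j\<bar> \<le> 1" unfolding abs_mult using Bij[OF i, of j] v1[of j] by (intro mult_le_one) auto
      qed
      finally show "\<bar>(B *\<^sub>v v) $ i\<bar> \<le> real n" by simp
    qed
    finally show "y \<le> real n * real n" by simp
  qed
  define c where "c = 1 / l2_norm u"
  have c: "c > 0" using u by (simp add: c_def)
  have "l2_norm (B *\<^sub>v (c \<cdot>\<^sub>v u)) \<in> X"
  proof -
    have n: "l2_norm (c \<cdot>\<^sub>v u) = 1" using u(3) by (simp add: l2_norm_smult c_def)
    have o: "(c \<cdot>\<^sub>v u) \<bullet> vec n (\<lambda>_. 1) = 0" using u(1,2) by simp
    show ?thesis unfolding X_def
      by (rule CollectI, rule exI[of _ "c \<cdot>\<^sub>v u"]) (intro conjI refl n o smult_carrier_vec[THEN iffD2, OF u(1)])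
  qed
  then have "l2_norm (B *\<^sub>v (c \<cdot>\<^sub>v u)) \<le> lambda A" unfolding lam using \<open>bdd_above X\<close> by (rule cSup_upper)
  moreover have "B *\<^sub>v (c \<cdot>\<^sub>v u) = c \<cdot>\<^sub>v (B *\<^sub>v u)" using B u(1) by (rule mult_mat_vec)
  ultimately have "c * l2_norm (B *\<^sub>v u) \<le> lambda A" using c by (simp add: l2_norm_smult)
  then show ?thesis using u(3) by (simp add: c_def B_def divide_le_eq mult.commute)
qed

text \<open>The centred indicator has squared norm \<open>k - k\<^sup>2 / n \<le> k\<close>, and its
  image under the entrywise square lists the deviations of the energies from their shares. The
  factor 2 comes from the two signs of each row.\<close>

lemma spectral_bound:
  assumes A: "A \<in> carrier_mat n n" "admissible A" and S: "S \<subseteq> {..<n}" and lam: "lambda A \<le> lam" "lam > 0"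
  shows "(\<Sum>i<2*n. ((\<Sum>j\<in>S. (signed_rows A i j)\<^sup>2) - real (card S) / real n * (\<Sum>j<n. (signed_rows A i j)\<^sup>2))\<^sup>2) \<le> 2 * lam\<^sup>2 * real (card S)"
proof -
  define k where "k = real (card S)"
  define u where "u = vec n (\<lambda>j. (if j \<in> S then 1 else 0) - k / real n)"
  have n: "real n > 0" using A by (simp add: admissible_def)
  have finS: "finite S" using S finite_subset by blast
  have sumS: "(\<Sum>j<n. if j \<in> S then f j else 0) = (\<Sum>j\<in>S. f j)" for f :: "nat \<Rightarrow> real"
    using S by (subst sum.inter_restrict[symmetric]) (auto simp: Int_absorb1)
  have u: "u \<in> carrier_vec n" by (simp add: u_def)
  have s1: "(\<Sum>j<n. if j \<in> S then 1 else 0) = k" using sumS[of "\<lambda>_. 1"] by (simp add: k_def)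
  have "u \<bullet> vec n (\<lambda>_. 1) = (\<Sum>j<n. (if j \<in> S then 1 else 0) - k / real n)"
    by (simp add: u_def scalar_prod_def atLeast0LessThan)
  also have "\<dots> = 0" using n by (simp add: sum_subtractf s1)
  finally have orth: "u \<bullet> vec n (\<lambda>_. 1) = 0" .
  have un: "(l2_norm u)\<^sup>2 \<le> k"
  proof -
    have "(l2_norm u)\<^sup>2 = (\<Sum>j<n. ((if j \<in> S then 1 else 0) - k / real n)\<^sup>2)" by (simp add: l2_norm_sq u_def)
    also have "\<dots> = (\<Sum>j<n. (if j \<in> S then 1 else 0) - 2 * (k / real n) * (if j \<in> S then 1 else 0) + (k / real n)\<^sup>2)"
      by (intro sum.cong) (auto simp: power2_eq_square algebra_simps)
    also have "\<dots> = k - 2 * (k / real n) * k + real n * (k / real n)\<^sup>2"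
      unfolding sum.distrib sum_subtractf sum_distrib_left[symmetric] s1 by simp
    also have "\<dots> = k - k\<^sup>2 / real n" using n by (simp add: power2_eq_square field_simps)
    also have "\<dots> \<le> k" using n by simp
    finally show ?thesis .
  qed
  define y where "y = entrywise_square A *\<^sub>v u"
  have dy: "dim_vec y = n" using A by (simp add: y_def entrywise_square_def)
  have yi: "y $ i = (\<Sum>j\<in>S. (A $$ (i, j))\<^sup>2) - k / real n * (\<Sum>j<n. (A $$ (i, j))\<^sup>2)" if i: "i < n" for i
  proof -
    have "y $ i = (\<Sum>j<n. (A $$ (i, j))\<^sup>2 * ((if j \<in> S then 1 else 0) - k / real n))"
      using A i by (simp add: y_def u_def entrywise_square_def mult_mat_vec_def scalar_prod_def atLeast0LessThan)
    also have "\<dots> = (\<Sum>j<n. (if j \<in> S then (A $$ (i, j))\<^sup>2 else 0) - k / real n * (A $$ (i, j))\<^sup>2)"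
      by (intro sum.cong) (auto simp: algebra_simps)
    also have "\<dots> = (\<Sum>j\<in>S. (A $$ (i, j))\<^sup>2) - k / real n * (\<Sum>j<n. (A $$ (i, j))\<^sup>2)"
      by (simp add: sum_subtractf sumS sum_distrib_left)
    finally show ?thesis .
  qed
  have "(l2_norm y)\<^sup>2 \<le> lam\<^sup>2 * k"
  proof (cases "l2_norm u > 0")
    case True
    have y: "l2_norm y \<le> lambda A * l2_norm u" unfolding y_def by (rule lambda_bound[OF A u orth True])
    also have "\<dots> \<le> lam * l2_norm u" using lam True by (intro mult_right_mono) auto
    finally have "(l2_norm y)\<^sup>2 \<le> (lam * l2_norm u)\<^sup>2" using l2_norm_nonneg by (intro power_mono) auto
    also have "\<dots> \<le> lam\<^sup>2 * k" unfolding power_mult_distrib using un by (intro mult_left_mono) auto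
    finally show ?thesis .
  next
    case False
    \<comment> \<open>The centred indicator of the empty or the full set is 0 and cannot be
      normalised; its image is 0 as well. For \<open>n = 1\<close> this is always the case.\<close>
    then have "(\<Sum>j<n. (u $ j)\<^sup>2) = 0" using l2_norm_nonneg[of u] l2_norm_sq[of u] u by (simp add: not_less)
    then have "\<forall>j<n. u $ j = 0" by (simp add: sum_nonneg_eq_0_iff)
    then have "y = 0\<^sub>v n" using A by (intro eq_vecI) (auto simp: y_def entrywise_square_def mult_mat_vec_def scalar_prod_def u_def)
    then show ?thesis using lam by (simp add: l2_norm_sq k_def)
  qed
  then have half: "(\<Sum>i<n. ((\<Sum>j\<in>S. (A $$ (i, j))\<^sup>2) - k / real n * (\<Sum>j<n. (A $$ (i, j))\<^sup>2))\<^sup>2) \<le> lam\<^sup>2 * k"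
    unfolding l2_norm_sq dy by (simp add: yi)
  have dr: "dim_row A = n" using A by simp
  show ?thesis unfolding sum_double k_def[symmetric] using half by (simp add: signed_rows_def dr)
qed

lemma discrepancy_instance:
  assumes A: "A \<in> carrier_mat n n" "admissible A" and Lg: "Lg \<ge> 1" "ln (real n) \<le> Lg" and T: "T \<ge> 1" "lambda A \<le> T\<^sup>2 / Lg"
  shows "discrepancy n (signed_rows A) Lg T (T\<^sup>2 / Lg)"
proof
  show "n \<ge> 1" using A by (auto simp: admissible_def)
  fix j assume j: "j < n"
  have "(\<Sum>i<n. (A $$ (i, j))\<^sup>2) = (l2_norm (col A j))\<^sup>2" using A(1) j by (simp add: l2_norm_sq)
  also have "\<dots> \<le> 1\<^sup>2" using A j by (intro power_mono l2_norm_nonneg) (auto simp: admissible_def)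
  finally show "(\<Sum>i<2*n. (signed_rows A i j)\<^sup>2) \<le> 2" unfolding sum_double using A(1) by (simp add: signed_rows_def)
next
  fix S :: "nat set" assume "S \<subseteq> {..<n}"
  then show "(\<Sum>i<2*n. ((\<Sum>j\<in>S. (signed_rows A i j)\<^sup>2) - real (card S) / real n * (\<Sum>j<n. (signed_rows A i j)\<^sup>2))\<^sup>2)
    \<le> 2 * (T\<^sup>2 / Lg)\<^sup>2 * real (card S)"
    using T Lg by (intro spectral_bound[OF A]) auto
qed (use Lg T in auto)

definition result :: "real mat \<Rightarrow> nat \<Rightarrow> real" where
  "result A j = sem (dim_row A) p_main (rarr (input_state A)) 1 j 0"

lemma result_props:
  assumes A: "A \<in> carrier_mat n n" "admissible A" and Lg: "Lg \<ge> 1" "ln (real n) \<le> Lg" and T: "T \<ge> 1" "lambda A \<le> T\<^sup>2 / Lg"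
  shows "j < n \<Longrightarrow> result A j = 1 \<or> result A j = -1"
    "Lg = real lg \<Longrightarrow> lg \<le> n \<Longrightarrow> T = 2 ^ t \<Longrightarrow> t < n \<Longrightarrow> i < n \<Longrightarrow> \<bar>\<Sum>j<n. A $$ (i, j) * result A j\<bar> \<le> 31006002 * T"
proof -
  interpret discrepancy n "signed_rows A" Lg T "T\<^sup>2 / Lg" by (rule discrepancy_instance[OF assms])
  have dr: "dim_row A = n" "dim_col A = n" using A by auto
  define M0 where "M0 = rarr (input_state A)"
  define M where "M = sem n (seqs [Fill 2 n2 nn o1 (CI (BLess (OfNat rI) rN) (CR (Entry 0 rI rJ)) (CR (neg (Entry 0 (NSub rI (NReg 0)) rJ)))),
   Fill 3 n2 o1 nn (CR (Mul (Entry 2 rI rL) (Entry 2 rI rL))),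
   Fill 1 nn o1 o1 (CR (cn 1)), Fill 5 o1 o1 o1 (CR (cn 0))]) M0"
  have M0: "M0 0 i j = A $$ (i, j)" if "i < n" "j < n" for i j using that by (simp add: M0_def input_state_def dr)
  have e: "sem n p_main M0 = (sem n p_log ^^ n) M" by (simp add: p_main_def M_def)
  have M2: "M 2 i j = signed_rows A i j" if "i < 2*n" "j < n" for i j
    using that M0 by (simp add: M_def signed_rows_def dr)
  have M3: "M 3 i 0 = (\<Sum>j<n. (M 2 i j)\<^sup>2)" if "i < 2*n" for i
    using that by (simp add: M_def fillv_def power2_eq_square)
  have rows_stored: "rows_stored M" unfolding rows_stored_def using M2 M3 by simp
  have M1: "M 1 j 0 = 1" if "j < n" for j
    using that sem_same[of j nn n 0 o1 1 o1 "CR (cn 1)"] by (simp add: M_def)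
  have sg: "signs_stored M" using M1 by (simp add: signs_stored_def)
  have M5: "M 5 0 0 = 0" by (simp add: M_def)
  note l = log_sem[OF rows_stored sg M5, where h = n]
  have r: "result A j = (sem n p_log ^^ n) M 1 j 0" for j by (simp add: result_def dr M0_def[symmetric] e)
  show "j < n \<Longrightarrow> result A j = 1 \<or> result A j = -1" using l(1) by (simp add: signs_stored_def r)
  assume h: "Lg = real lg" "lg \<le> n" "T = 2 ^ t" "t < n" "i < n"
  have "output_bounded ((K1 + 6002) * T) ((sem n p_log ^^ n) M)" using l(2)[OF h(1) _ h(2,3,4)] h(1) Lg by simp
  moreover have "(\<lambda>j. (sem n p_log ^^ n) M 1 j 0) = result A" by (simp add: r fun_eq_iff)
  ultimately have b: "dot i' (result A) \<le> 31006002 * T" if "i' < 2*n" for i'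
    using that by (simp only: output_bounded_def K1_def) auto
  have "dot i (result A) = (\<Sum>j<n. A $$ (i, j) * result A j)" using h(5) by (simp add: dot_def signed_rows_def dr)
  moreover have "dot (n + i) (result A) = - (\<Sum>j<n. A $$ (i, j) * result A j)"
    by (simp add: dot_def signed_rows_def dr sum_negf)
  ultimately show "\<bar>\<Sum>j<n. A $$ (i, j) * result A j\<bar> \<le> 31006002 * T" using b[of i] b[of "n + i"] h(5) by (simp add: abs_le_iff)
qed

text \<open>A difference of two unit vectors is a test vector up to scaling; for
  \<open>n = 1\<close> there is none.\<close>

lemma lambda_nonneg:
  assumes A: "A \<in> carrier_mat n n" "admissible A" and n: "n \<ge> 2"
  shows "lambda A \<ge> 0"
proof -
  define f where "f j = (if j = 0 then 1 else if j = 1 then - 1 else (0::real))" for j :: nat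
  define u where "u = vec n f"
  have u: "u \<in> carrier_vec n" by (simp add: u_def)
  have "(\<Sum>j<n. f j) = (\<Sum>j\<in>{0, 1}. f j)" by (rule sum.mono_neutral_right) (use n in \<open>auto simp: f_def\<close>)
  then have orth: "u \<bullet> vec n (\<lambda>_. 1) = 0" by (simp add: u_def scalar_prod_def atLeast0LessThan f_def)
  have "(f 0)\<^sup>2 \<le> (\<Sum>j<n. (f j)\<^sup>2)" by (rule member_le_sum) (use n in auto)
  then have "(l2_norm u)\<^sup>2 \<ge> 1" by (simp add: l2_norm_sq u_def f_def)
  then have pos: "l2_norm u > 0" using l2_norm_nonneg[of u] by (cases "l2_norm u = 0") auto
  have "0 \<le> lambda A * l2_norm u"
    using lambda_bound[OF A u orth pos] l2_norm_nonneg[of "entrywise_square A *\<^sub>v u"] by linarith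
  then show ?thesis using pos by (simp add: zero_le_mult_iff)
qed

lemma linf_norm_le:
  assumes "dim_vec v = n" "n \<ge> 1" "\<And>i. i < n \<Longrightarrow> \<bar>v $ i\<bar> \<le> B"
  shows "linf_norm v \<le> B"
  unfolding linf_norm_def assms(1)
  by (rule Max.boundedI) (use assms in \<open>auto simp: lessThan_empty_iff\<close>)

text \<open>For \<open>n = 1\<close>, and if the required \<open>T\<close> is beyond the range of
  guesses, the trivial bound \<open>n\<close> on a row suffices. Otherwise the pair
  \<open>Lg\<close>, \<open>T\<close> chosen here is among those tried, and the kept vector is at
  least as good.\<close>

lemma result_linf:
  assumes A: "A \<in> carrier_mat n n" "admissible A"
  shows "\<And>j. j < n \<Longrightarrow> result A j = 1 \<or> result A j = -1"
    "linf_norm (A *\<^sub>v vec n (result A)) \<le> 124024008 * (1 + sqrt (lambda A * ln (real n)))"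
proof -
  have n: "n \<ge> 1" using A by (auto simp: admissible_def)
  define lg where "lg = nat (max 1 \<lceil>ln (real n)\<rceil>)"
  define Lg where "Lg = real lg"
  \<comment> \<open>\<open>max 0\<close> is for \<open>n = 1\<close>, where \<open>lambda A\<close>
    is an unspecified real. The guess has to satisfy \<open>lambda A \<le> T\<^sup>2 / Lg\<close>,
    and rounding \<open>m\<close> up to a power of two costs a factor of at most 2.\<close>
  define m where "m = max 1 (sqrt (max 0 (lambda A) * Lg))"
  define t where "t = (LEAST t. m \<le> 2 ^ t)"
  define T where "T = (2::real) ^ t"
  have Lge: "Lg = of_int (max 1 \<lceil>ln (real n)\<rceil>)" by (simp add: Lg_def lg_def)
  have lnn: "ln (real n) \<le> real n - 1" using n by (intro ln_le_minus_one) simp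
  have ln0: "ln (real n) \<ge> 0" using n by simp
  have "real_of_int \<lceil>ln (real n)\<rceil> < ln (real n) + 1" "ln (real n) \<le> real_of_int \<lceil>ln (real n)\<rceil>" by linarith+
  then have Lg: "Lg \<ge> 1" "ln (real n) \<le> Lg" "Lg \<le> ln (real n) + 1"
    unfolding Lge using ln0 by (auto simp: of_int_max max_def)
  have lgn: "lg \<le> n"
  proof -
    have "Lg \<le> real n" using Lg lnn by linarith
    then show ?thesis by (simp add: Lg_def)
  qed
  have ex: "\<exists>t. m \<le> 2 ^ t" using real_arch_pow[of 2 m] by (auto intro: less_imp_le)
  have mT: "m \<le> T" unfolding T_def t_def by (rule LeastI_ex[OF ex])
  have T2: "T \<le> 2 * m"
  proof (cases t)
    case 0
    then show ?thesis by (simp add: T_def m_def)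
  next
    case (Suc k)
    then have "\<not> m \<le> 2 ^ k" unfolding t_def using not_less_Least[of k "\<lambda>t. m \<le> 2 ^ t"] by simp
    then show ?thesis by (simp add: T_def Suc)
  qed
  have T1: "T \<ge> 1" by (simp add: T_def)
  have "lambda A * Lg \<le> max 0 (lambda A) * Lg" using Lg by (intro mult_right_mono) auto
  also have "\<dots> = (sqrt (max 0 (lambda A) * Lg))\<^sup>2" using Lg by simp
  also have "\<dots> \<le> T\<^sup>2" using mT Lg by (intro power_mono) (auto simp: m_def)
  finally have lamT: "lambda A \<le> T\<^sup>2 / Lg" using Lg by (simp add: pos_le_divide_eq)
  note rp = result_props[OF A Lg(1,2) T1 lamT]
  show sgn: "\<And>j. j < n \<Longrightarrow> result A j = 1 \<or> result A j = -1" by (rule rp(1))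
  have ent: "(A *\<^sub>v vec n (result A)) $ i = (\<Sum>j<n. A $$ (i, j) * result A j)" if "i < n" for i
    using A(1) that by (simp add: mult_mat_vec_def scalar_prod_def atLeast0LessThan)
  have triv: "\<bar>\<Sum>j<n. A $$ (i, j) * result A j\<bar> \<le> real n" if i: "i < n" for i
  proof -
    have "\<bar>\<Sum>j<n. A $$ (i, j) * result A j\<bar> \<le> (\<Sum>j<n. 1)"
    proof (rule order_trans[OF sum_abs], rule sum_mono)
      fix j assume "j \<in> {..<n}"
      then have j: "j < n" by simp
      have "\<bar>A $$ (i, j)\<bar> \<le> 1" using admissible_entry[OF A(2), of i j] A(1) i j by simp
      moreover have "\<bar>result A j\<bar> = 1" using sgn[OF j] by auto
      ultimately show "\<bar>A $$ (i, j) * result A j\<bar> \<le> 1" by (simp add: abs_mult)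
    qed
    then show ?thesis by simp
  qed
  have dim: "dim_vec (A *\<^sub>v vec n (result A)) = n" using A by simp
  show "linf_norm (A *\<^sub>v vec n (result A)) \<le> 124024008 * (1 + sqrt (lambda A * ln (real n)))"
  proof (cases "n = 1")
    case True
    then show ?thesis using ent triv by (intro linf_norm_le[OF dim n]) fastforce
  next
    case False
    then have n2: "n \<ge> 2" using n by simp
    have lam0: "lambda A \<ge> 0" by (rule lambda_nonneg[OF A n2])
    have "ln 2 \<le> ln (real n)" using n2 by (subst ln_le_cancel_iff) auto
    \<comment> \<open>Now the 1 added by rounding \<open>ln n\<close> up is at most
      \<open>2 * ln n\<close>. The constant 4 in the next step is convenient for its root.\<close>
    then have "ln (real n) \<ge> 1/2" using ln_le_minus_one[of "1/2 :: real"] by (simp add: ln_div)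
    then have "Lg \<le> 4 * ln (real n)" using Lg(3) by linarith
    then have "sqrt (lambda A * Lg) \<le> sqrt (4 * (lambda A * ln (real n)))"
      using mult_left_mono[OF _ lam0] by (intro real_sqrt_le_mono) fastforce
    also have "\<dots> = 2 * sqrt (lambda A * ln (real n))" by (simp add: real_sqrt_mult)
    finally have s2: "sqrt (lambda A * Lg) \<le> 2 * sqrt (lambda A * ln (real n))" .
    define s where "s = sqrt (lambda A * ln (real n))"
    have s0: "s \<ge> 0" using lam0 ln0 by (simp add: s_def)
    have "m \<le> 1 + 2 * s" using lam0 s0 s2 by (auto simp: m_def max_absorb2 s_def)
    then have "2 * m \<le> 4 * (1 + s)" using s0 by (simp add: algebra_simps)
    then have T4: "T \<le> 4 * (1 + s)" by (rule order_trans[OF T2])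
    have "\<bar>\<Sum>j<n. A $$ (i, j) * result A j\<bar> \<le> 31006002 * T" if i: "i < n" for i
    proof (cases "t < n")
      case True
      then show ?thesis using rp(2)[OF Lg_def lgn T_def _ i] by simp
    next
      case False
      have "real n < 2 ^ n" by (rule of_nat_less_two_power)
      also have "\<dots> \<le> T" unfolding T_def using False by (intro power_increasing) auto
      finally show ?thesis using triv[OF i] T1 by linarith
    qed
    then have "linf_norm (A *\<^sub>v vec n (result A)) \<le> 31006002 * T"
      using ent by (intro linf_norm_le[OF dim n]) simp
    \<comment> \<open>The final constant is \<open>4 * (K1 + 6002)\<close>.\<close>
    then show ?thesis using T4 by (simp add: s_def)
  qed
qed

theorem theorem5p2:
  shows "\<exists>C > 0. \<exists>p :: prog. polynomial_time admissible p \<and>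
    (\<forall>(n :: nat) A. A \<in> carrier_mat n n \<and> admissible A \<longrightarrow>
      (\<exists>x. outputs p A x \<and> x \<in> carrier_vec n \<and> (\<forall>i<n. x $ i = 1 \<or> x $ i = -1) \<and>
        linf_norm (A *\<^sub>v x) \<le> C * (1 + sqrt (lambda A * ln (real n)))))"
proof (intro exI[of _ 124024008] conjI exI[of _ "gcomp p_main"] polynomial_time_main allI impI)
  fix n A assume "A \<in> carrier_mat n n \<and> admissible A"
  then have A: "A \<in> carrier_mat n n" "admissible A" by auto
  obtain t s where ts: "exec uniform_charge (gcomp p_main) (input_state A) t s"
    "rarr s = sem n p_main (rarr (input_state A))"
    using exec_main[of A n] A(1) by auto
  have "vec n (result A) = vec (dim_col A) (\<lambda>i. rarr s 1 i 0)"
    using A(1) ts(2) by (intro eq_vecI) (auto simp: result_def)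
  then have "outputs (gcomp p_main) A (vec n (result A))" unfolding outputs_def using ts(1) by blast
  then show "\<exists>x. outputs (gcomp p_main) A x \<and> x \<in> carrier_vec n \<and> (\<forall>i<n. x $ i = 1 \<or> x $ i = -1) \<and>
        linf_norm (A *\<^sub>v x) \<le> 124024008 * (1 + sqrt (lambda A * ln (real n)))"
    using result_linf[OF A] by (intro exI[of _ "vec n (result A)"]) auto
qed simp

end
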